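(* Suppose that $f \in \mathcal{A}$ (the MacLane class) and that the set $CV(f)$ of critical values of $f$ is bounded. If either of the following conditions also holds, then $f$ has no arc tracts. (a) The set $AV(f)$ of finite asymptotic values of $f$ is bounded. (b) Infinity is a monotonically accessible asymptotic value of $f$ at every point of some dense subset of $\partial \mathbb{D}$.
   Context: $\mathbb{D}=\{z\in\mathbb{C}:|z|<1\}$ and $\widehat{\mathbb{C}}=\mathbb{C}\cup\{\infty\}$. A boundary path is a path $\Gamma:[0,1)\to\mathbb{D}$ with $|\Gamma(t)|\to 1$ as $t\to 1$; its end is the set $\overline{\Gamma}\cap\partial\mathbb{D}$. A holomorphic function $f$ in $\mathbb{D}$ has asymptotic value $a\in\widehat{\mathbb{C}}$ if there is a boundary path $\Gamma$ with $f(\Gamma(t))\to a$ as $t\to1$; then $\Gamma$ is called an asymptotic curve over $a$. If moreover the end of $\Gamma$ is a singleton $\{\zeta\}$, then $\Gamma$ is said to end at $\zeta$ and $f$ has asymptotic value $a$ at $\zeta$. The MacLane class $\mathcal{A}$ is the set of functions holomorphic and non-constant in $\mathbb{D}$ that have asymptotic values (in $\widehat{\mathbb{C}}$) at points of a dense subset of $\partial\mathbb{D}$. $CV(f)=\{f(z): z\in\mathbb{D},\ f'(z)=0\}$, and $AV(f)$ is the set of finite asymptotic values of $f$. Tracts: let $d$ be the chordal metric on $\widehat{\mathbb{C}}$ and $U(a,\epsilon)=\{z\in\widehat{\mathbb{C}}: d(a,z)<\epsilon\}$. Suppose $a\in\widehat{\mathbb{C}}$ and to each $\epsilon>0$ there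 is a component $D(\epsilon)$ of $f^{-1}(U(a,\epsilon))$ such that $D(\epsilon_1)\subset D(\epsilon_2)$ for $0<\epsilon_1<\epsilon_2$ and $\bigcap_{\epsilon>0}D(\epsilon)=\emptyset$. Then the pair $\{D(\epsilon),a\}$ is a tract of $f$ over $a$, with end $K=\bigcap_{\epsilon>0}\overline{D(\epsilon)}$. The end $K$ is either a point of $\partial\mathbb{D}$ (a point tract) or an arc of $\partial\mathbb{D}$ (an arc tract). A curve $\gamma\subset\mathbb{C}$ is monotonic if there exists $R>0$ such that for all $r>R$ there is exactly one point on $\gamma$ of modulus $r$. Infinity is a monotonically accessible asymptotic value of $f$ at $\zeta\in\partial\mathbb{D}$ if there is an asymptotic curve $\Gamma$ over infinity which ends at $\zeta$ and such that $f(\Gamma)$ is monotonic. *)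

theory Defs
  imports "HOL-Complex_Analysis.Complex_Analysis"
begin

text \<open>The extended plane is \<^typ>\<open>complex option\<close>, with \<^term>\<open>None\<close> playing the role of infinity
  (the convention of \<^const>\<open>Alexandroff_compactification\<close>).\<close>

abbreviation unit_disc :: "complex set"  where "unit_disc \<equiv> ball 0 1"
abbreviation unit_circle :: "complex set"  where "unit_circle \<equiv> sphere 0 1"

fun chordal_dist :: "complex option \<Rightarrow> complex option \<Rightarrow> real" where
  "chordal_dist (Some z) (Some w) =
     2 * cmod (z - w) / (sqrt (1 + (cmod z)\<^sup>2) * sqrt (1 + (cmod w)\<^sup>2))"
| "chordal_dist (Some z) None = 2 / sqrt (1 + (cmod z)\<^sup>2)"
| "chordal_dist None (Some w) = 2 / sqrt (1 + (cmod w)\<^sup>2)"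
| "chordal_dist None None = 0"

definition chordal_ball :: "complex option \<Rightarrow> real \<Rightarrow> complex option set" where
  "chordal_ball a \<epsilon> = {z. chordal_dist a z < \<epsilon>}"

definition boundary_path :: "(real \<Rightarrow> complex) \<Rightarrow> bool" where
  "boundary_path \<Gamma> \<longleftrightarrow>
     continuous_on {0..<1} \<Gamma> \<and> \<Gamma> ` {0..<1} \<subseteq> unit_disc \<and>
     ((\<lambda>t. cmod (\<Gamma> t)) \<longlongrightarrow> 1) (at_left 1)"

definition path_end :: "(real \<Rightarrow> complex) \<Rightarrow> complex set" where
  "path_end \<Gamma> = closure (\<Gamma> ` {0..<1}) \<inter> unit_circle"

definition asymptotic_curve :: "(complex \<Rightarrow> complex) \<Rightarrow> complex option \<Rightarrow> (real \<Rightarrow> complex) \<Rightarrow> bool" where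
  "asymptotic_curve f a \<Gamma> \<longleftrightarrow>
     boundary_path \<Gamma> \<and> ((\<lambda>t. chordal_dist a (Some (f (\<Gamma> t)))) \<longlongrightarrow> 0) (at_left 1)"

definition asymptotic_value :: "(complex \<Rightarrow> complex) \<Rightarrow> complex option \<Rightarrow> bool" where
  "asymptotic_value f a \<longleftrightarrow> (\<exists>\<Gamma>. asymptotic_curve f a \<Gamma>)"

definition asymptotic_value_at :: "(complex \<Rightarrow> complex) \<Rightarrow> complex option \<Rightarrow> complex \<Rightarrow> bool" where
  "asymptotic_value_at f a \<zeta> \<longleftrightarrow> (\<exists>\<Gamma>. asymptotic_curve f a \<Gamma> \<and> path_end \<Gamma> = {\<zeta>})"

definition dense_in_circle :: "complex set \<Rightarrow> bool" where
  "dense_in_circle S \<longleftrightarrow> S \<subseteq> unit_circle \<and> unit_circle \<subseteq> closure S"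

definition MacLane_class :: "(complex \<Rightarrow> complex) set" where
  "MacLane_class = {f. f holomorphic_on unit_disc \<and> \<not> f constant_on unit_disc \<and>
     (\<exists>S. dense_in_circle S \<and> (\<forall>\<zeta>\<in>S. \<exists>a. asymptotic_value_at f a \<zeta>))}"

definition critical_values :: "(complex \<Rightarrow> complex) \<Rightarrow> complex set" where
  "critical_values f = {f z |z. z \<in> unit_disc \<and> deriv f z = 0}"

definition finite_asymptotic_values :: "(complex \<Rightarrow> complex) \<Rightarrow> complex set" where
  "finite_asymptotic_values f = {a. asymptotic_value f (Some a)}"

text \<open>Only the values of \<open>D\<close> at positive reals are relevant.\<close>

definition tract :: "(complex \<Rightarrow> complex) \<Rightarrow> (real \<Rightarrow> complex set) \<Rightarrow> complex option \<Rightarrow> bool" where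
  "tract f D a \<longleftrightarrow>
     (\<forall>\<epsilon>>0. D \<epsilon> \<in> components {z \<in> unit_disc. Some (f z) \<in> chordal_ball a \<epsilon>}) \<and>
     (\<forall>\<epsilon>\<^sub>1 \<epsilon>\<^sub>2. 0 < \<epsilon>\<^sub>1 \<and> \<epsilon>\<^sub>1 < \<epsilon>\<^sub>2 \<longrightarrow> D \<epsilon>\<^sub>1 \<subseteq> D \<epsilon>\<^sub>2) \<and>
     (\<Inter>\<epsilon>\<in>{0<..}. D \<epsilon>) = {}"

definition tract_end :: "(real \<Rightarrow> complex set) \<Rightarrow> complex set" where
  "tract_end D = (\<Inter>\<epsilon>\<in>{0<..}. closure (D \<epsilon>))"

text \<open>Nondegenerate closed arcs; the case \<open>\<beta> = \<alpha> + 2 * pi\<close> is the whole circle, which counts as an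
  arc because the end of a tract is always either a point or an arc.\<close>

definition circle_arc :: "complex set \<Rightarrow> bool" where
  "circle_arc K \<longleftrightarrow> (\<exists>\<alpha> \<beta>. \<alpha> < \<beta> \<and> \<beta> \<le> \<alpha> + 2 * pi \<and> K = cis ` {\<alpha>..\<beta>})"

definition arc_tract :: "(complex \<Rightarrow> complex) \<Rightarrow> (real \<Rightarrow> complex set) \<Rightarrow> complex option \<Rightarrow> bool" where
  "arc_tract f D a \<longleftrightarrow> tract f D a \<and> circle_arc (tract_end D)"

text \<open>Monotonicity is a property of the curve as a point set.\<close>

definition monotonic_curve :: "complex set \<Rightarrow> bool" where
  "monotonic_curve \<gamma> \<longleftrightarrow> (\<exists>R>0. \<forall>r>R. \<exists>!z. z \<in> \<gamma> \<and> cmod z = r)"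

definition infinity_monotonically_accessible :: "(complex \<Rightarrow> complex) \<Rightarrow> complex \<Rightarrow> bool" where
  "infinity_monotonically_accessible f \<zeta> \<longleftrightarrow>
     (\<exists>\<Gamma>. asymptotic_curve f None \<Gamma> \<and> path_end \<Gamma> = {\<zeta>} \<and>
          monotonic_curve (f ` \<Gamma> ` {0..<1}))"

text \<open>Convergence in the chordal metric is ordinary convergence, resp. divergence to infinity.\<close>

lemma tendsto_chordal_None_iff:
  "((\<lambda>x. chordal_dist None (Some (g x))) \<longlongrightarrow> 0) F \<longleftrightarrow> filterlim g at_infinity F"
proof -
  let ?s = "\<lambda>x. sqrt (1 + (cmod (g x))\<^sup>2)"
  have pos: "?s x > 0" for x by (simp add: add_pos_nonneg)
  have "((\<lambda>x. 2 / ?s x) \<longlongrightarrow> 0) F \<longleftrightarrow> filterlim ?s at_top F"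
  proof
    assume "((\<lambda>x. 2 / ?s x) \<longlongrightarrow> 0) F"
    then have "((\<lambda>x. (2 / ?s x) / 2) \<longlongrightarrow> 0 / 2) F" by (intro tendsto_intros) auto
    then have "((\<lambda>x. inverse (?s x)) \<longlongrightarrow> 0) F" by (simp add: field_simps)
    then have "filterlim (\<lambda>x. inverse (inverse (?s x))) at_top F"
      by (rule filterlim_inverse_at_top) (use pos in \<open>auto intro!: always_eventually\<close>)
    then show "filterlim ?s at_top F" by simp
  next
    assume "filterlim ?s at_top F"
    then show "((\<lambda>x. 2 / ?s x) \<longlongrightarrow> 0) F"
      by (intro tendsto_divide_0[OF tendsto_const] filterlim_at_top_imp_at_infinity)
  qed
  also have "\<dots> \<longleftrightarrow> filterlim (\<lambda>x. cmod (g x)) at_top F"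
  proof
    assume "filterlim ?s at_top F"
    then have "filterlim (\<lambda>x. -1 + ?s x) at_top F"
      by (rule filterlim_tendsto_add_at_top[OF tendsto_const])
    moreover have "-1 + ?s x \<le> cmod (g x)" for x
      using real_le_lsqrt[of "1 + cmod (g x)" "1 + (cmod (g x))\<^sup>2"]
      by (simp add: power2_sum)
    ultimately show "filterlim (\<lambda>x. cmod (g x)) at_top F"
      by (blast intro: filterlim_at_top_mono always_eventually)
  next
    assume "filterlim (\<lambda>x. cmod (g x)) at_top F"
    moreover have "cmod (g x) \<le> ?s x" for x by (rule real_le_rsqrt) simp
    ultimately show "filterlim ?s at_top F"
      by (blast intro: filterlim_at_top_mono always_eventually)
  qed
  finally show ?thesis by (simp add: filterlim_at_infinity_conv_norm_at_top)
qed

lemma tendsto_chordal_Some_iff: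
  "((\<lambda>x. chordal_dist (Some a) (Some (g x))) \<longlongrightarrow> 0) F \<longleftrightarrow> (g \<longlongrightarrow> a) F"
proof
  note chordal_dist.simps [simp del]
  define c where "c = sqrt (1 + (cmod a)\<^sup>2)"
  let ?s = "\<lambda>x. sqrt (1 + (cmod (g x))\<^sup>2)"
  let ?d = "\<lambda>x. chordal_dist (Some a) (Some (g x))"
  let ?m = "\<lambda>x. cmod (g x - a)"
  have c: "c \<ge> 1" and s: "?s x \<ge> 1" for x by (auto simp: c_def)
  have d: "?d x = 2 * ?m x / (c * ?s x)" for x
    unfolding c_def chordal_dist.simps norm_minus_commute[of a "g x"] ..
  have aux: "u = p * (u / (p * q)) * q" if "p \<noteq> 0" "q \<noteq> 0" for u p q :: real
    using that by simp
  show "(g \<longlongrightarrow> a) F" if lim: "(?d \<longlongrightarrow> 0) F"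
  proof -
    have "?m x * (2 - c * ?d x) \<le> c * (1 + cmod a) * ?d x" for x
    proof -
      have "?s x \<le> 1 + cmod (g x)"
        by (rule real_le_lsqrt) (auto simp: power2_sum)
      also have "cmod (g x) \<le> cmod a + ?m x"
        by (metis add.commute norm_triangle_sub)
      finally have le: "?s x \<le> 1 + cmod a + ?m x" by simp
      have nn: "0 \<le> c * ?d x" unfolding d using c s[of x] by (intro mult_nonneg_nonneg divide_nonneg_nonneg) auto
      have "c \<noteq> 0" "?s x \<noteq> 0" using c s[of x] by linarith+
      then have "2 * ?m x = c * ?d x * ?s x" unfolding d by (rule aux)
      also have "\<dots> \<le> c * ?d x * (1 + cmod a + ?m x)" using le nn by (rule mult_left_mono)
      finally show ?thesis by (simp add: algebra_simps)
    qed
    moreover have ev: "eventually (\<lambda>x. 0 < 2 - c * ?d x) F"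
    proof -
      have "((\<lambda>x. 2 - c * ?d x) \<longlongrightarrow> 2 - c * 0) F" by (intro tendsto_intros lim)
      then show ?thesis by (intro order_tendstoD) auto
    qed
    ultimately have "eventually (\<lambda>x. ?m x \<le> c * (1 + cmod a) * ?d x / (2 - c * ?d x)) F"
      by (auto elim!: eventually_mono simp: pos_le_divide_eq)
    moreover have "((\<lambda>x. c * (1 + cmod a) * ?d x / (2 - c * ?d x)) \<longlongrightarrow>
                     c * (1 + cmod a) * 0 / (2 - c * 0)) F"
      by (intro tendsto_intros lim) auto
    ultimately have "(?m \<longlongrightarrow> 0) F"
      by (intro tendsto_sandwich[of "\<lambda>_. 0" ?m F "\<lambda>x. c * (1 + cmod a) * ?d x / (2 - c * ?d x)" 0])
         auto
    then show ?thesis by (simp add: LIM_zero_iff tendsto_norm_zero_iff)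
  qed
  show "(?d \<longlongrightarrow> 0) F" if "(g \<longlongrightarrow> a) F"
  proof -
    have "((\<lambda>x. 2 * cmod (g x - a) / (c * ?s x)) \<longlongrightarrow>
           2 * cmod (a - a) / (c * sqrt (1 + (cmod a)\<^sup>2))) F"
      using c by (intro tendsto_intros that) (auto simp: add_pos_nonneg add_nonneg_eq_0_iff)
    then show ?thesis unfolding d by simp
  qed
qed

end

theory Submission
  imports Defs
begin

text \<open>
  Suppose that \<open>f\<close> has a tract \<open>D\<close> over \<open>a\<close> whose end is an arc.

  \<^emph>\<open>Two curves.\<close> A crosscut of the disc separates the two circular arcs between its ends
  (\<open>crosscut_separates\<close>). The sets \<open>D \<epsilon>\<close> are connected and accumulate at every point of the end, so of
  two asymptotic curves that end at different inner points of the arc, at least one meets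
  every \<open>D \<epsilon>\<close>. As the end points of asymptotic curves are dense, there are two curves with different
  end points that both meet every \<open>D \<epsilon>\<close> (\<open>two_meeting_curves\<close>); along them \<open>f\<close> tends to \<open>a\<close>.

  \<^emph>\<open>Koebe's lemma\<close> (\<open>vanishes_on_open_set\<close>). Let \<open>h\<close> be bounded on two curves with different end points and tend to
  zero on cross paths between them that approach the circle. Then \<open>h\<close> vanishes on an open set,
  provided that the circuits formed by the curves and the cross paths enclose only points at which \<open>h\<close>
  is holomorphic. For \<open>h = f - a\<close> and cross paths in the tract this excludes finite \<open>a\<close>.

  \<^emph>\<open>Convex models.\<close> If \<open>a\<close> is infinite, the lemma is applied to \<open>1 / f\<close>, and \<open>f\<close> must not have zeros inside
  the circuits. This is guaranteed if the curves run inside the continuous image of a convex set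
  \<open>Q\<close> under a map \<open>\<Phi>\<close> with \<open>cmod (f (\<Phi> q)) = exp (Re q)\<close>, because the image of a loop in \<open>Q\<close> winds only around points
  of the image of \<open>Q\<close> (\<open>no_uniformised_pair_of_curves\<close>). It remains to construct \<open>\<Phi>\<close>. Over values of large
  modulus \<open>f\<close> has no critical points, so paths can be lifted until the lift escapes to the circle
  (\<open>lift_dichotomy\<close>).

  In case (a) an escaping lift of a path would produce a finite asymptotic value of large modulus.
  So all lifts exist, and \<open>Q\<close> is a half-plane on which \<open>f (\<Phi> q) = exp q\<close>.

  In case (b) the curves can be parametrised by the logarithm of the modulus of \<open>f\<close>
  (\<open>monotonic_curve_reparametrised_by_modulus\<close>). A Jordan loop that follows the first curve outwards, crosses over
  inside the tract and comes back along the second one meets each level of \<open>cmod f\<close> in a suitable range in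
  at most two points, one on each curve. Hence the level curve that enters the loop at the first curve reaches
  the second one (\<open>level_arc_from_turn\<close>). The arcs obtained in this way depend continuously on the level
  (\<open>first_hit_continuous\<close>) and sweep out a half-strip \<open>Q\<close>.
\<close>

section \<open>Winding numbers of paths in the closed disc\<close>

text \<open>Open paths are compared through differences: \<open>p\<close> followed by the reverse of \<open>q\<close> is a loop, and
  its winding number is the difference of the two (in general not integral) numbers. No loops have to
  be assembled when three or more paths with common end points are played off against each other.\<close>

lemma winding_number_diff_const:
  assumes p: "path p" and q: "path q" and ends: "pathstart q = pathstart p" "pathfinish q = pathfinish p"
    and S: "connected S" "S \<inter> path_image p = {}" "S \<inter> path_image q = {}" and zw: "z \<in> S" "w \<in> S"
  shows "winding_number p z - winding_number q z = winding_number p w - winding_number q w"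
proof -
  define L where "L = p +++ reversepath q"
  have L: "path L" "pathfinish L = pathstart L" "S \<inter> path_image L = {}"
    using assms by (auto simp: L_def path_image_join)
  have "winding_number L x = winding_number p x - winding_number q x" if "x \<in> S" for x
  proof -
    have x: "x \<notin> path_image p" "x \<notin> path_image q" using that S by auto
    show ?thesis unfolding L_def using x p q ends
      by (subst winding_number_join) (auto simp: winding_number_reversepath)
  qed
  moreover have "winding_number L z = winding_number L w"
    by (rule winding_number_eq[OF L(1,2) zw S(1) L(3)])
  ultimately show ?thesis using zw by simp
qed

lemma winding_number_eq_if_not_enclosed:
  assumes p: "path p" and q: "path q" and ends: "pathstart q = pathstart p" "pathfinish q = pathfinish p"
    and C: "convex C" "path_image p \<subseteq> C" "path_image q \<subseteq> C"
    and S: "connected S" "S \<inter> path_image p = {}" "S \<inter> path_image q = {}" "\<not> S \<subseteq> C" and z: "z \<in> S"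
  shows "winding_number p z = winding_number q z"
proof -
  obtain w where w: "w \<in> S" "w \<notin> C" using S by auto
  have "winding_number (p +++ reversepath q) w = 0"
    using assms w by (intro winding_number_zero_outside[of _ C]) (auto simp: path_image_join)
  moreover have "winding_number (p +++ reversepath q) w = winding_number p w - winding_number q w"
  proof -
    have "w \<notin> path_image p" "w \<notin> path_image q" using C w by auto
    then show ?thesis using p q ends by (subst winding_number_join) (auto simp: winding_number_reversepath)
  qed
  ultimately show ?thesis
    using winding_number_diff_const[OF p q ends S(1-3) z w(1)] by simp
qed

lemma winding_number_circular_arc_centre:
  "winding_number (part_circlepath 0 1 a b) 0 = of_real (b - a) / (2 * of_real pi)"
proof -
  have im: "0 \<notin> path_image (part_circlepath 0 1 a b)"
    by (auto simp: path_image_def part_circlepath_def)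
  have "((\<lambda>x. \<i> * of_real (b - a)) has_integral \<i> * of_real (b - a)) {0..1::real}"
    using has_integral_const_real[of "\<i> * complex_of_real (b - a)" 0 1] by simp
  then have "((\<lambda>w. 1 / (w - 0)) has_contour_integral \<i> * of_real (b - a)) (part_circlepath 0 1 a b)"
    unfolding has_contour_integral_def
    by (rule has_integral_eq[rotated])
       (simp add: vector_derivative_part_circlepath01, simp add: part_circlepath_def field_simps)
  then have "contour_integral (part_circlepath 0 1 a b) (\<lambda>w. 1 / (w - 0)) = \<i> * of_real (b - a)"
    by (rule contour_integral_unique)
  moreover have "winding_number (part_circlepath 0 1 a b) 0 =
      1 / (2 * pi * \<i>) * contour_integral (part_circlepath 0 1 a b) (\<lambda>w. 1 / (w - 0))"
    by (rule winding_number_valid_path) (use im in auto)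
  ultimately show ?thesis by (simp only:) (simp add: field_simps)
qed

lemma disc_circle_disjoint: "unit_disc \<inter> unit_circle = {}"
  by auto

lemma cis_eq_imp_eq:
  assumes "cis x = cis y" "\<bar>x - y\<bar> < 2 * pi"
  shows "x = y"
proof -
  obtain n :: int where "\<i> * of_real x = \<i> * of_real y + (of_int (2 * n) * pi) * \<i>"
    using assms(1) by (auto simp: cis_conv_exp exp_eq)
  then have "x = y + 2 * n * pi"
    by (auto simp: complex_eq_iff)
  moreover from this have "\<bar>real_of_int n\<bar> * (2 * pi) < 1 * (2 * pi)"
    using assms(2) by (simp add: abs_mult)
  then have "\<bar>real_of_int n\<bar> < 1" by (subst (asm) mult_less_cancel_right_pos) auto
  then have "n = 0" by linarith
  ultimately show ?thesis by simp
qed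

lemma circular_arc:
  shows "pathstart (part_circlepath 0 1 a b) = cis a" "pathfinish (part_circlepath 0 1 a b) = cis b"
    "path_image (part_circlepath 0 1 a b) \<subseteq> unit_circle"
    "path_image (part_circlepath 0 1 a b) = cis ` closed_segment a b"
  using path_image_part_circlepath'[of 0 1 a b] by (auto simp: cis_conv_exp)

lemma cis_minus_2pi: "cis (b - 2 * pi) = cis b"
  by (simp flip: cis_divide)

lemma cis_notin_circular_arc:
  assumes "a \<le> b" "x < a \<or> b < x" "b - 2 * pi < x" "x < a + 2 * pi"
  shows "cis x \<notin> path_image (part_circlepath 0 1 a b)" "cis x \<notin> path_image (part_circlepath 0 1 b a)"
proof -
  have "cis x \<noteq> cis y" if "a \<le> y" "y \<le> b" for y
    using cis_eq_imp_eq[of x y] that assms by fastforce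
  then have "cis x \<notin> cis ` {a..b}" by (metis atLeastAtMost_iff imageE)
  then show "cis x \<notin> path_image (part_circlepath 0 1 a b)" "cis x \<notin> path_image (part_circlepath 0 1 b a)"
    using assms(1) unfolding circular_arc(4)
    by (auto simp: closed_segment_eq_real_ivl split: if_splits)
qed

text \<open>The two arcs from \<open>cis a\<close> to \<open>cis b\<close> together run once around the circle. This jump by one is
  all that is used of the topology of the plane in the next lemma and in Koebe's lemma.\<close>

lemma circular_arc_windings_differ:
  assumes "cmod z < 1"
  shows "winding_number (part_circlepath 0 1 a b) z - winding_number (part_circlepath 0 1 a (b - 2 * pi)) z = 1"
proof -
  have "winding_number (part_circlepath 0 1 a b) z - winding_number (part_circlepath 0 1 a (b - 2 * pi)) z
     = winding_number (part_circlepath 0 1 a b) 0 - winding_number (part_circlepath 0 1 a (b - 2 * pi)) 0"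
  proof (rule winding_number_diff_const[of _ _ unit_disc])
    have "unit_disc \<inter> path_image (part_circlepath 0 1 a c) = {}" for c
      using circular_arc(3)[of a c] by (meson disc_circle_disjoint disjoint_iff subset_iff)
    from this[of b] this[of "b - 2 * pi"]
    show "unit_disc \<inter> path_image (part_circlepath 0 1 a b) = {}"
      "unit_disc \<inter> path_image (part_circlepath 0 1 a (b - 2 * pi)) = {}" .
  qed (use assms in \<open>simp_all only: circular_arc(1,2) cis_minus_2pi path_part_circlepath, auto\<close>)
  also have "\<dots> = 1"
    unfolding winding_number_circular_arc_centre by (simp add: field_simps)
  finally show ?thesis .
qed

text \<open>A small disc about a point of the unit circle sticks out of the closed disc, so two paths inside the
  closed disc that avoid it cannot wind around its points.\<close>

lemma winding_number_eq_near_circle_point: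
  assumes p: "path p" and q: "path q" and ends: "pathstart q = pathstart p" "pathfinish q = pathfinish p"
    and im: "path_image p \<subseteq> cball 0 1" "path_image q \<subseteq> cball 0 1"
    and k: "cmod k = 1" "k \<notin> path_image p" "k \<notin> path_image q"
  obtains e where "e > 0" "\<And>z. dist z k < e \<Longrightarrow> winding_number p z = winding_number q z"
proof -
  have "open (- (path_image p \<union> path_image q))"
    using p q by (intro open_Compl closed_Un closed_path_image)
  then obtain e where e: "e > 0" "ball k e \<subseteq> - (path_image p \<union> path_image q)"
    using k unfolding open_contains_ball by blast
  have out: "\<not> ball k e \<subseteq> cball 0 1"
  proof -
    have "dist k (of_real (1 + e / 2) * k) = cmod (of_real (e / 2) * k)"
      unfolding dist_norm norm_minus_commute[of k] by (rule arg_cong[where f = cmod]) (simp add: algebra_simps)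
    then have "of_real (1 + e / 2) * k \<in> ball k e"
      using e(1) k(1) by (simp add: norm_mult del: of_real_divide)
    moreover have "cmod (of_real (1 + e / 2) * k) = \<bar>1 + e / 2\<bar>"
      using k(1) by (simp only: norm_mult norm_of_real mult_1_right)
    then have "of_real (1 + e / 2) * k \<notin> cball 0 1"
      using e(1) by simp
    ultimately show ?thesis by blast
  qed
  show ?thesis
  proof (rule that[OF e(1)])
    fix z assume "dist z k < e"
    then show "winding_number p z = winding_number q z"
      using e out by (intro winding_number_eq_if_not_enclosed[OF p q ends convex_cball im, of "ball k e"])
        (auto simp: dist_commute)
  qed
qed

text \<open>Close the crosscut by either of the two circular arcs. A loop closed on the far side does not wind
  around points near the open arc on the near side. So on \<open>A\<close>, where the two loops have constant
  winding number, both winding numbers would vanish; but they differ by one.\<close>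

lemma crosscut_separates:
  assumes J: "path J" "pathstart J = cis a" "pathfinish J = cis b" "J ` {0<..<1} \<subseteq> unit_disc"
    and ab: "a < b" "b < a + 2 * pi"
    and A: "connected A" "A \<subseteq> unit_disc" "A \<inter> path_image J = {}"
    and x: "cis x \<in> closure A" "a < x" "x < b" and y: "cis y \<in> closure A" "b - 2 * pi < y" "y < a"
  shows False
proof -
  define P where "P = part_circlepath 0 1 a b"
  define Q where "Q = part_circlepath 0 1 a (b - 2 * pi)"
  have PQ: "path P" "path Q" "pathstart P = cis a" "pathfinish P = cis b" "pathstart Q = cis a"
     "pathfinish Q = cis b" "path_image P \<subseteq> unit_circle" "path_image Q \<subseteq> unit_circle"
    unfolding P_def Q_def circular_arc(1,2) cis_minus_2pi
    using circular_arc(3) path_part_circlepath by blast+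
  have imJ: "path_image J \<subseteq> unit_disc \<union> {cis a, cis b}"
  proof
    fix z assume "z \<in> path_image J"
    then obtain t where t: "t \<in> {0..1}" "z = J t" by (auto simp: path_image_def)
    then show "z \<in> unit_disc \<union> {cis a, cis b}"
      using J by (cases "t = 0"; cases "t = 1") (auto simp: pathstart_def pathfinish_def image_subset_iff)
  qed
  have cJ: "path_image J \<subseteq> cball 0 1" using imJ by auto
  have cPQ: "path_image P \<subseteq> cball 0 1" "path_image Q \<subseteq> cball 0 1" using PQ by auto
  have nJ: "cis t \<notin> path_image J" if "cis t \<noteq> cis a" "cis t \<noteq> cis b" for t
    using imJ that by auto
  have xne: "cis x \<noteq> cis a" "cis x \<noteq> cis b"
    using cis_eq_imp_eq[of x a] cis_eq_imp_eq[of x b] x ab by auto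
  have yne: "cis y \<noteq> cis a" "cis y \<noteq> cis b"
    using cis_eq_imp_eq[of y a] cis_eq_imp_eq[of y "b - 2 * pi"] y ab by (auto simp flip: cis_divide)
  obtain e where e: "e > 0" "\<And>z. dist z (cis x) < e \<Longrightarrow> winding_number J z = winding_number Q z"
    using winding_number_eq_near_circle_point[of J Q "cis x"] J PQ cJ cPQ nJ[OF xne]
      cis_notin_circular_arc(2)[of "b - 2 * pi" a x] x ab by (auto simp: Q_def)
  obtain d where d: "d > 0" "\<And>z. dist z (cis y) < d \<Longrightarrow> winding_number J z = winding_number P z"
    using winding_number_eq_near_circle_point[of J P "cis y"] J PQ cJ cPQ nJ[OF yne]
      cis_notin_circular_arc(1)[of a b y] y ab by (auto simp: P_def)
  obtain z where z: "z \<in> A" "dist z (cis x) < e" using x(1) e(1) unfolding closure_approachable by blast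
  obtain w where w: "w \<in> A" "dist w (cis y) < d" using y(1) d(1) unfolding closure_approachable by blast
  have "winding_number J z - winding_number P z = winding_number J w - winding_number P w"
  proof (rule winding_number_diff_const[of _ _ A])
    show "A \<inter> path_image P = {}" using A(2) PQ(7) disc_circle_disjoint by blast
  qed (use J PQ A z w in auto)
  then have "winding_number P z = winding_number Q z" using d(2)[OF w(2)] e(2)[OF z(2)] by simp
  moreover have "cmod z < 1" using z A by auto
  ultimately show False
    using circular_arc_windings_differ[of z a b] by (simp add: P_def Q_def)
qed

section \<open>Koebe's lemma\<close>

text \<open>The configuration of Koebe's lemma: two curves \<open>c1\<close>, \<open>c2\<close> ending on the circle, a base path \<open>b\<close>
  between their starting points, and cross paths \<open>\<alpha> n\<close> between their tails that approach the circle and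
  along which \<open>h\<close> tends to zero.\<close>

locale koebe_curves =
  fixes G :: "complex set" and h :: "complex \<Rightarrow> complex"
    and c1 c2 b :: "real \<Rightarrow> complex" and \<alpha> :: "nat \<Rightarrow> real \<Rightarrow> complex"
    and t u e :: "nat \<Rightarrow> real" and M :: real
  assumes G: "open G" "G \<subseteq> unit_disc" "h holomorphic_on G"
    and c1: "path c1" "c1 ` {0..<1} \<subseteq> G" "cmod (c1 1) = 1"
    and c2: "path c2" "c2 ` {0..<1} \<subseteq> G" "cmod (c2 1) = 1"
    and b: "path b" "pathstart b = c1 0" "pathfinish b = c2 0" "path_image b \<subseteq> G"
    and \<alpha>: "\<And>n. path (\<alpha> n)" "\<And>n. pathstart (\<alpha> n) = c1 (t n)" "\<And>n. pathfinish (\<alpha> n) = c2 (u n)"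
      "\<And>n. path_image (\<alpha> n) \<subseteq> G"
    and tu: "\<And>n. 0 \<le> t n \<and> t n < 1" "\<And>n. 0 \<le> u n \<and> u n < 1"
    and bound: "\<And>z. z \<in> c1 ` {0..<1} \<union> c2 ` {0..<1} \<union> path_image b \<Longrightarrow> cmod (h z) \<le> M"
    and small: "\<And>n z. z \<in> path_image (\<alpha> n) \<Longrightarrow> cmod (h z) \<le> e n" "e \<longlonglongrightarrow> 0"
    and near: "\<And>\<rho>. \<rho> < 1 \<Longrightarrow>
      \<forall>\<^sub>F n in sequentially. \<forall>z \<in> path_image (\<alpha> n) \<union> c1 ` {t n..1} \<union> c2 ` {u n..1}. \<rho> < cmod z"
begin

definition "crosscut = reversepath c1 +++ b +++ c2"
definition "outer n = reversepath (subpath (t n) 1 c1) +++ \<alpha> n +++ subpath (u n) 1 c2"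
definition "circuit n = reversepath (subpath 0 (t n) c1) +++ b +++ subpath 0 (u n) c2 +++ reversepath (\<alpha> n)"

lemma paths:
  "path crosscut" "pathstart crosscut = c1 1" "pathfinish crosscut = c2 1"
  "path_image crosscut = c1 ` {0..1} \<union> path_image b \<union> c2 ` {0..1}"
  "path (outer n)" "pathstart (outer n) = c1 1" "pathfinish (outer n) = c2 1"
  "path_image (outer n) = c1 ` {t n..1} \<union> path_image (\<alpha> n) \<union> c2 ` {u n..1}"
  "path (circuit n)" "pathfinish (circuit n) = pathstart (circuit n)"
  "path_image (circuit n) = c1 ` {0..t n} \<union> path_image b \<union> c2 ` {0..u n} \<union> path_image (\<alpha> n)"
  using c1 c2 b \<alpha>[of n] tu[of n]
  by (auto simp: crosscut_def outer_def circuit_def path_image_join path_image_subpath pathstart_def[of c1]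
      pathstart_def[of c2] pathfinish_def[of c1] pathfinish_def[of c2]) (auto simp: path_image_def)

lemma crosscut_subset: "path_image crosscut \<subseteq> unit_disc \<union> {c1 1, c2 1}"
proof -
  have "c1 ` {0..1} \<subseteq> unit_disc \<union> {c1 1}" "c2 ` {0..1} \<subseteq> unit_disc \<union> {c2 1}"
  proof -
    have "{0..1::real} = {0..<1} \<union> {1}" by auto
    then show "c1 ` {0..1} \<subseteq> unit_disc \<union> {c1 1}" "c2 ` {0..1} \<subseteq> unit_disc \<union> {c2 1}"
      using c1(2) c2(2) G(2) by auto
  qed
  then show ?thesis using b(4) G(2) unfolding paths by blast
qed

lemma circuit_subset: "path_image (circuit n) \<subseteq> G"
proof -
  have "{0..t n} \<subseteq> {0..<1}" "{0..u n} \<subseteq> {0..<1}" using tu[of n] by auto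
  then show ?thesis using c1(2) c2(2) b(4) \<alpha>(4)[of n] unfolding paths by blast
qed

text \<open>The crosscut splits into the circuit and the part of the configuration that lies beyond \<open>\<alpha> n\<close>.\<close>

lemma winding_circuit:
  assumes "z \<notin> path_image crosscut" "z \<notin> path_image (\<alpha> n)"
  shows "winding_number (circuit n) z = winding_number crosscut z - winding_number (outer n) z"
proof -
  have ends: "pathstart c1 = c1 0" "pathstart c2 = c2 0" "pathfinish c1 = c1 1" "pathfinish c2 = c2 1"
    by (simp_all add: pathstart_def pathfinish_def)
  have z: "z \<notin> path_image c1" "z \<notin> path_image c2" "z \<notin> path_image b"
    using assms unfolding paths by (auto simp: path_image_def)
  have sub: "z \<notin> path_image (subpath x y c1)" "z \<notin> path_image (subpath x y c2)"
    if "x \<in> {0..1}" "y \<in> {0..1}" for x y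
    using z path_image_subpath_subset[OF that] by blast+
  have sums: "winding_number (subpath 0 (t n) c1) z + winding_number (subpath (t n) 1 c1) z = winding_number c1 z"
    "winding_number (subpath 0 (u n) c2) z + winding_number (subpath (u n) 1 c2) z = winding_number c2 z"
    using winding_number_subpath_combine[OF c1(1) z(1), of 0 "t n" 1]
      winding_number_subpath_combine[OF c2(1) z(2), of 0 "u n" 1] tu[of n] by (auto simp: subpath_trivial)
  moreover have "winding_number (circuit n) z = - winding_number (subpath 0 (t n) c1) z + (winding_number b z
     + (winding_number (subpath 0 (u n) c2) z - winding_number (\<alpha> n) z))"
    unfolding circuit_def using c1 c2 b \<alpha>[of n] tu[of n] z assms sub
    by (simp add: winding_number_join winding_number_reversepath path_image_join ends)
  moreover have "winding_number crosscut z = - winding_number c1 z + (winding_number b z + winding_number c2 z)"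
    unfolding crosscut_def using c1 c2 b z
    by (simp add: winding_number_join winding_number_reversepath path_image_join ends)
  moreover have "winding_number (outer n) z = - winding_number (subpath (t n) 1 c1) z +
      (winding_number (\<alpha> n) z + winding_number (subpath (u n) 1 c2) z)"
    unfolding outer_def using c1 c2 \<alpha>[of n] tu[of n] z assms sub
    by (simp add: winding_number_join winding_number_reversepath path_image_join ends)
  ultimately show ?thesis unfolding sums[symmetric] by simp
qed

lemma winding_circuit_outside_disc: "z \<notin> unit_disc \<Longrightarrow> winding_number (circuit n) z = 0"
  using circuit_subset[of n] G(2)
  by (intro winding_number_zero_outside[OF paths(9) convex_ball[of 0 1] paths(10)]) auto

end

text \<open>The function \<open>h\<close> need not be defined in the whole disc, but the circuits must not enclose points
  outside its domain.\<close>

locale koebe_arcs = koebe_curves +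
  assumes null: "\<And>n z. z \<notin> G \<Longrightarrow> winding_number (circuit n) z = 0"
begin

text \<open>The points with non-zero winding number form a bounded open subset of \<open>G\<close> whose frontier lies on
  the circuit, so the maximum principle applies to it.\<close>

lemma circuit_interior_bound:
  assumes z: "winding_number (circuit n) z \<noteq> 0" "z \<notin> path_image (circuit n)"
    and k: "k holomorphic_on G" "\<And>w. w \<in> path_image (circuit n) \<Longrightarrow> cmod (k w) \<le> B"
  shows "cmod (k z) \<le> B"
proof -
  define W where "W = (\<Union>j\<in>-{0}. {z. z \<notin> path_image (circuit n) \<and> winding_number (circuit n) z = j})"
  have oW: "open W"
    unfolding W_def by (intro open_UN ballI open_winding_number_levelsets paths)
  have o0: "open {z. z \<notin> path_image (circuit n) \<and> winding_number (circuit n) z = 0}"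
    by (intro open_winding_number_levelsets paths)
  have cl: "closure W \<subseteq> W \<union> path_image (circuit n)"
  proof
    fix w assume w: "w \<in> closure W"
    have "{z. z \<notin> path_image (circuit n) \<and> winding_number (circuit n) z = 0} \<inter> W = {}"
      by (auto simp: W_def)
    then have "{z. z \<notin> path_image (circuit n) \<and> winding_number (circuit n) z = 0} \<inter> closure W = {}"
      using o0 open_Int_closure_eq_empty by blast
    then show "w \<in> W \<union> path_image (circuit n)" using w by (auto simp: W_def)
  qed
  have WG: "W \<subseteq> G" using null[of _ n] by (auto simp: W_def)
  show ?thesis
  proof (rule maximum_modulus_frontier[of k W B z])
    show "k holomorphic_on interior W"
      using k(1) WG interior_subset holomorphic_on_subset by blast
    show "continuous_on (closure W) k"
      using holomorphic_on_imp_continuous_on[OF k(1)] cl WG circuit_subset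
      by (meson continuous_on_subset le_sup_iff order_trans)
    show "bounded W"
      by (rule bounded_subset[OF bounded_winding_number_nz[OF paths(9,10)[of n]]]) (auto simp: W_def)
    show "z \<in> W" using z by (auto simp: W_def)
    show "cmod (k w) \<le> B" if "w \<in> frontier W" for w
      using that cl k(2) oW by (auto simp: frontier_def interior_open)
  qed
qed

text \<open>The set \<open>H\<close> is a half-plane cutting off a cap at \<open>\<eta>\<close> that avoids the crosscut and \<open>B\<close>. A point of the
  cap is enclosed by the circuit whenever \<open>outer n\<close> winds differently from \<open>B\<close> around the centre, which
  happens for infinitely many \<open>n\<close>. There the maximum principle is applied to \<open>h\<close> times the exponential
  of \<open>N\<close> times the linear functional defining \<open>H\<close>: that factor is at most one on the crosscut, and on
  \<open>\<alpha> n\<close> it is outweighed by \<open>e n\<close>. Letting first \<open>n\<close> and then \<open>N\<close> tend to infinity gives \<open>h = 0\<close>.\<close>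

lemma vanishes_near_circle_point:
  assumes B: "path B" "pathstart B = c1 1" "pathfinish B = c2 1" "path_image B \<subseteq> unit_circle"
    and \<eta>: "cmod \<eta> = 1" "\<eta> \<notin> path_image B"
    and freq: "\<exists>\<^sub>F n in sequentially. winding_number (outer n) 0 \<noteq> winding_number B 0"
  shows "\<exists>U. open U \<and> U \<noteq> {} \<and> U \<subseteq> G \<and> (\<forall>z\<in>U. h z = 0)"
proof -
  define K where "K = path_image crosscut \<union> path_image B"
  have cK: "compact K" using B paths(1) by (auto simp: K_def intro: compact_Un compact_path_image)
  have neK: "K \<noteq> {}" by (auto simp: K_def)
  have K1: "K \<subseteq> cball 0 1" using crosscut_subset B(4) c1(3) c2(3) by (fastforce simp: K_def)
  have ends: "c1 1 \<in> path_image B" "c2 1 \<in> path_image B"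
    using B pathstart_in_path_image pathfinish_in_path_image by metis+
  have \<eta>K: "\<eta> \<notin> K" using crosscut_subset \<eta> ends by (auto simp: K_def)
  obtain k where k: "k \<in> K" "\<And>z. z \<in> K \<Longrightarrow> \<eta> \<bullet> z \<le> \<eta> \<bullet> k"
    using continuous_attains_sup[OF cK neK, of "\<lambda>z. \<eta> \<bullet> z"]
      continuous_on_inner[OF continuous_on_const continuous_on_id] by blast
  define c where "c = max 0 (\<eta> \<bullet> k)"
  have "\<eta> \<bullet> k < 1"
  proof -
    have "0 < (cmod (\<eta> - k))\<^sup>2" using k(1) \<eta>K by auto
    also have "\<dots> = 1 + (cmod k)\<^sup>2 - 2 * (\<eta> \<bullet> k)"
      using \<eta>(1) by (simp add: power2_norm_eq_inner inner_diff inner_commute norm_eq_1)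
    also have "\<dots> \<le> 2 - 2 * (\<eta> \<bullet> k)" using k(1) K1 power_le_one[of "cmod k" 2] by auto
    finally show ?thesis by simp
  qed
  then have c: "c < 1" "0 \<le> c" "\<And>z. z \<in> K \<Longrightarrow> \<eta> \<bullet> z \<le> c" using k(2) by (auto simp: c_def le_max_iff_disj)
  define H where "H = {z. \<eta> \<bullet> z > c}"
  define U where "U = unit_disc \<inter> H"
  have H: "open H" "connected H" "H \<inter> K = {}"
    using c(3) by (auto simp: H_def open_halfspace_gt convex_connected convex_halfspace_gt not_less[symmetric])
  have oU: "open U" using H by (auto simp: U_def)
  have in\<eta>: "\<eta> \<bullet> (of_real r * \<eta>) = r" for r :: real
    using \<eta>(1) by (simp add: norm_eq_1 flip: scaleR_conv_of_real)
  have "of_real ((1 + c) / 2) * \<eta> \<in> U"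
    unfolding U_def H_def using in\<eta>[of "(1 + c) / 2"] \<eta>(1) c by (simp add: norm_mult del: of_real_divide)
  then have neU: "U \<noteq> {}" by auto
  have "2 *\<^sub>R \<eta> \<in> H" unfolding H_def using in\<eta>[of 2] c by (simp add: scaleR_conv_of_real)
  moreover have "2 *\<^sub>R \<eta> \<notin> cball 0 1" using \<eta>(1) by simp
  ultimately have Hout: "\<not> H \<subseteq> cball 0 1" by blast
  have B1: "path_image B \<subseteq> cball 0 1" using B(4) by auto
  have J1: "path_image crosscut \<subseteq> cball 0 1" using K1 by (auto simp: K_def)
  have ev: "\<forall>\<^sub>F n in sequentially. winding_number (outer n) 0 \<noteq> winding_number B 0 \<longrightarrow>
      z \<notin> path_image (circuit n) \<and> winding_number (circuit n) z \<noteq> 0" if z: "z \<in> U" for z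
  proof (rule eventually_mono[OF near[of "cmod z"]])
    show "cmod z < 1" using z by (auto simp: U_def)
    fix n assume n: "\<forall>w \<in> path_image (\<alpha> n) \<union> c1 ` {t n..1} \<union> c2 ` {u n..1}. cmod z < cmod w"
    have "w \<notin> cball 0 (cmod z)" if "w \<in> path_image (outer n)" for w
      using that n unfolding paths by (simp add: not_le) blast
    then have av: "cball 0 (cmod z) \<inter> path_image (outer n) = {}" by blast
    have zB: "cball 0 (cmod z) \<inter> path_image B = {}" using B(4) \<open>cmod z < 1\<close> by fastforce
    have "winding_number (outer n) z - winding_number B z = winding_number (outer n) 0 - winding_number B 0"
      by (rule winding_number_diff_const[of _ _ "cball 0 (cmod z)"]) (use paths B av zB in auto)
    moreover have "winding_number crosscut z = winding_number B z"
      by (rule winding_number_eq_if_not_enclosed[OF _ _ _ _ convex_cball J1 B1, of H])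
         (use paths B H Hout z in \<open>auto simp: U_def K_def\<close>)
    moreover have zJ: "z \<notin> path_image crosscut" using z H by (auto simp: U_def K_def)
    moreover have za: "z \<notin> path_image (\<alpha> n)" using n by auto
    moreover have "z \<notin> path_image (circuit n)"
      using zJ za tu[of n] unfolding paths by fastforce
    ultimately show "winding_number (outer n) 0 \<noteq> winding_number B 0 \<longrightarrow>
      z \<notin> path_image (circuit n) \<and> winding_number (circuit n) z \<noteq> 0"
      using winding_circuit[of z n] by auto
  qed
  have M: "0 \<le> M" using bound[of "c1 0"] norm_ge_zero[of "h (c1 0)"] by (force simp del: norm_ge_zero)
  have est: "cmod (h z) * exp (N * (\<eta> \<bullet> z - c)) \<le> M + 1" if z: "z \<in> U" and N: "N \<ge> 0" for z N
  proof -
    have "(\<lambda>n. e n * exp (N * (1 - c))) \<longlonglongrightarrow> 0 * exp (N * (1 - c))"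
      by (intro tendsto_intros small)
    then have "\<forall>\<^sub>F n in sequentially. e n * exp (N * (1 - c)) < M + 1"
      by (rule order_tendstoD(2)) (use M in simp)
    with ev[OF z] have "\<forall>\<^sub>F n in sequentially. winding_number (outer n) 0 \<noteq> winding_number B 0 \<longrightarrow>
      e n * exp (N * (1 - c)) < M + 1 \<and> z \<notin> path_image (circuit n) \<and> winding_number (circuit n) z \<noteq> 0"
      by eventually_elim auto
    from frequently_mp[OF this freq] obtain n where n: "e n * exp (N * (1 - c)) < M + 1"
      "z \<notin> path_image (circuit n)" "winding_number (circuit n) z \<noteq> 0"
      by (auto dest: frequently_ex)
    define k where "k w = h w * exp (of_real N * (w * cnj \<eta> - of_real c))" for w
    have nk: "cmod (k w) = cmod (h w) * exp (N * (\<eta> \<bullet> w - c))" for w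
      by (simp add: k_def norm_mult inner_complex_def algebra_simps)
    have "cmod (k z) \<le> M + 1"
    proof (rule circuit_interior_bound[OF n(3,2)])
      show "k holomorphic_on G" unfolding k_def by (intro holomorphic_intros G)
      fix w assume w: "w \<in> path_image (circuit n)"
      then consider "w \<in> path_image (\<alpha> n)" | "w \<in> c1 ` {0..<1} \<union> c2 ` {0..<1} \<union> path_image b"
        using tu[of n] unfolding paths by force
      then show "cmod (k w) \<le> M + 1"
      proof cases
        case 1
        then have "cmod w \<le> 1" using \<alpha>(4)[of n] G by fastforce
        then have "\<eta> \<bullet> w \<le> 1" using norm_cauchy_schwarz[of \<eta> w] \<eta>(1) by simp
        then have "exp (N * (\<eta> \<bullet> w - c)) \<le> exp (N * (1 - c))" using N by (auto intro: mult_left_mono)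
        then have "cmod (k w) \<le> e n * exp (N * (1 - c))"
          unfolding nk using small(1)[OF 1] by (intro mult_mono) (auto intro: order_trans[OF norm_ge_zero])
        then show ?thesis using n by simp
      next
        case 2
        then have "w \<in> K" unfolding K_def paths by force
        then have "exp (N * (\<eta> \<bullet> w - c)) \<le> 1" using c(3)[of w] N by (simp add: mult_nonneg_nonpos)
        then have "cmod (k w) \<le> M * 1" unfolding nk using bound[OF 2] M by (intro mult_mono) auto
        then show ?thesis by simp
      qed
    qed
    then show ?thesis by (simp add: nk)
  qed
  have "h z = 0" if z: "z \<in> U" for z
  proof (rule ccontr)
    assume nz: "h z \<noteq> 0"
    have d: "\<eta> \<bullet> z - c > 0" using z by (auto simp: U_def H_def)
    \<comment> \<open>With this \<open>N\<close> the estimate fails.\<close>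
    define N where "N = (M + 1) / (cmod (h z) * (\<eta> \<bullet> z - c))"
    have N: "N \<ge> 0" using M d nz by (simp add: N_def)
    have "M + 1 = cmod (h z) * (N * (\<eta> \<bullet> z - c))" using d nz by (simp add: N_def)
    also have "\<dots> < cmod (h z) * exp (N * (\<eta> \<bullet> z - c))"
    proof (rule mult_strict_left_mono)
      show "N * (\<eta> \<bullet> z - c) < exp (N * (\<eta> \<bullet> z - c))"
        using exp_ge_add_one_self[of "N * (\<eta> \<bullet> z - c)"] by linarith
    qed (use nz in simp)
    finally show False using est[OF z N] by simp
  qed
  moreover have "U \<subseteq> G"
  proof
    fix z assume "z \<in> U"
    from frequently_mp[OF ev[OF this] freq] obtain n where "winding_number (circuit n) z \<noteq> 0" by (auto dest: frequently_ex)
    then show "z \<in> G" using null[of z n] by auto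
  qed
  ultimately show ?thesis using oU neU by blast
qed

text \<open>For a given \<open>n\<close> the outer path can wind like at most one of the two circular arcs, so for
  infinitely many \<open>n\<close> it winds differently from the same one of them.\<close>

theorem vanishes_on_open_set:
  assumes "c1 1 \<noteq> c2 1"
  shows "\<exists>U. open U \<and> U \<noteq> {} \<and> U \<subseteq> G \<and> (\<forall>z\<in>U. h z = 0)"
proof -
  define a where "a = Arg2pi (c1 1)"
  have a: "c1 1 = cis a" using Arg2pi_eq[of "c1 1"] c1(3) by (simp add: a_def cis_conv_exp)
  define a' where "a' = Arg2pi (c2 1)"
  have a': "c2 1 = cis a'" using Arg2pi_eq[of "c2 1"] c2(3) by (simp add: a'_def cis_conv_exp)
  define b where "b = (if a < a' then a' else a' + 2 * pi)"
  have ran: "0 \<le> a" "a < 2 * pi" "0 \<le> a'" "a' < 2 * pi"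
    by (auto simp: a_def a'_def Arg2pi_ge_0 Arg2pi_lt_2pi)
  have "a \<noteq> a'" using assms a a' by auto
  then have ab: "a < b" "b < a + 2 * pi" using ran by (auto simp: b_def)
  have b: "c2 1 = cis b" using a' cis_minus_2pi[of "a' + 2 * pi"] by (auto simp: b_def)
  define P where "P = part_circlepath 0 1 a b"
  define Q where "Q = part_circlepath 0 1 a (b - 2 * pi)"
  have PQ: "path P" "path Q" "pathstart P = c1 1" "pathfinish P = c2 1" "pathstart Q = c1 1"
     "pathfinish Q = c2 1" "path_image P \<subseteq> unit_circle" "path_image Q \<subseteq> unit_circle"
    unfolding P_def Q_def a b circular_arc(1,2) cis_minus_2pi
    using circular_arc(3) path_part_circlepath by blast+
  have "winding_number P 0 \<noteq> winding_number Q 0"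
    using circular_arc_windings_differ[of 0 a b] by (auto simp: P_def Q_def)
  then have "\<not> ((\<forall>\<^sub>F n in sequentially. winding_number (outer n) 0 = winding_number P 0) \<and>
    (\<forall>\<^sub>F n in sequentially. winding_number (outer n) 0 = winding_number Q 0))"
    by (metis (mono_tags, lifting) eventually_conj_iff eventually_happens trivial_limit_sequentially)
  then consider "\<exists>\<^sub>F n in sequentially. winding_number (outer n) 0 \<noteq> winding_number P 0"
    | "\<exists>\<^sub>F n in sequentially. winding_number (outer n) 0 \<noteq> winding_number Q 0"
    unfolding frequently_def by auto
  then show ?thesis
  proof cases
    case 1
    show ?thesis
      by (rule vanishes_near_circle_point[OF PQ(1,3,4,7) _ _ 1, of "cis ((a + b - 2 * pi) / 2)"])
         (use cis_notin_circular_arc(1)[of a b "(a + b - 2 * pi) / 2"] ab in \<open>auto simp: P_def\<close>)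
  next
    case 2
    show ?thesis
      by (rule vanishes_near_circle_point[OF PQ(2,5,6,8) _ _ 2, of "cis ((a + b) / 2)"])
         (use cis_notin_circular_arc(2)[of "b - 2 * pi" a "(a + b) / 2"] ab in \<open>auto simp: Q_def\<close>)
  qed
qed

end

section \<open>Lifting paths and families of paths\<close>

lemma continuous_on_if_locally_continuous:
  fixes g :: "'a::t2_space \<Rightarrow> 'b::topological_space"
  assumes "\<And>x. x \<in> S \<Longrightarrow> \<exists>U. open U \<and> x \<in> U \<and> continuous_on (S \<inter> U) g"
  shows "continuous_on S g"
  unfolding continuous_on_eq_continuous_within
proof
  fix x assume x: "x \<in> S"
  obtain U where U: "open U" "x \<in> U" "continuous_on (S \<inter> U) g" using assms[OF x] by blast
  have "at x within S = at x within (S \<inter> U)" by (rule at_within_nhd[OF U(2,1)]) auto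
  then show "continuous (at x within S) g"
    using U x by (auto simp: continuous_on_eq_continuous_within)
qed

text \<open>A holomorphic function without critical points over a set of values; paths in that set can be lifted
  locally, but a lift may leave the disc in finite time.\<close>

locale regular_over =
  fixes f :: "complex \<Rightarrow> complex" and \<Omega> :: "complex set"
  assumes holf: "f holomorphic_on unit_disc"
    and regular: "\<And>z. z \<in> unit_disc \<Longrightarrow> f z \<in> \<Omega> \<Longrightarrow> deriv f z \<noteq> 0"
begin

definition lifts :: "('a::topological_space \<Rightarrow> complex) \<Rightarrow> ('a \<Rightarrow> complex) \<Rightarrow> 'a set \<Rightarrow> bool" where
  "lifts \<psi> w S \<longleftrightarrow> continuous_on S \<psi> \<and> \<psi> ` S \<subseteq> unit_disc \<and> (\<forall>t\<in>S. f (\<psi> t) = w t) \<and> w ` S \<subseteq> \<Omega>"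

lemma lifts_subset: "lifts \<psi> w S \<Longrightarrow> T \<subseteq> S \<Longrightarrow> lifts \<psi> w T"
  unfolding lifts_def by (blast intro: continuous_on_subset)

lemma contf: "continuous_on unit_disc f"
  using holf by (rule holomorphic_on_imp_continuous_on)

lemma local_inverse:
  assumes "z0 \<in> unit_disc" "f z0 \<in> \<Omega>"
  obtains V g where "open V" "z0 \<in> V" "V \<subseteq> unit_disc" "inj_on f V" "open (f ` V)" "continuous_on (f ` V) g"
    "\<And>z. z \<in> V \<Longrightarrow> g (f z) = z"
proof -
  obtain r where r: "r > 0" "ball z0 r \<subseteq> unit_disc" "open (f ` ball z0 r)" "inj_on f (ball z0 r)"
    using has_complex_derivative_locally_invertible[OF holf assms(1) open_ball regular[OF assms]] .
  obtain g where g: "g holomorphic_on f ` ball z0 r" "\<And>z. z \<in> ball z0 r \<Longrightarrow> g (f z) = z"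
    using holomorphic_has_inverse[OF holomorphic_on_subset[OF holf r(2)] open_ball r(4)] by metis
  show ?thesis
    by (rule that[of "ball z0 r" g]) (use r g holomorphic_on_imp_continuous_on in auto)
qed

text \<open>The coincidence set of two lifts is open because \<open>f\<close> is locally injective along them.\<close>

lemma lift_unique:
  assumes T: "connected T" and u: "lifts u w T" and v: "lifts v w T" and "s \<in> T" "u s = v s" "t \<in> T"
  shows "u t = v t"
proof (rule connected_induction_simple[where P = "\<lambda>t. u t = v t", OF T])
  show "u s = v s" "s \<in> T" "t \<in> T" by fact+
  fix a assume a: "a \<in> T"
  have cu: "continuous_on T u" and cv: "continuous_on T v" using u v by (auto simp: lifts_def)
  have *: "openin (top_of_set T) (T \<inter> h -` A)" if "continuous_on T h" "open A" for A and h :: "'a \<Rightarrow> complex"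
    using that continuous_openin_preimage_gen by blast
  show "\<exists>U. openin (top_of_set T) U \<and> a \<in> U \<and> (\<forall>x\<in>U. \<forall>y\<in>U. u x = v x \<longrightarrow> u y = v y)"
  proof (cases "u a = v a")
    case True
    have "u a \<in> unit_disc" "f (u a) \<in> \<Omega>" using u a by (auto simp: lifts_def image_subset_iff)
    then obtain V g where V: "open V" "u a \<in> V" "inj_on f V"
      by (rule local_inverse)
    have "openin (top_of_set T) ((T \<inter> u -` V) \<inter> (T \<inter> v -` V))"
      by (intro openin_Int * cu cv V)
    moreover have "u y = v y" if "y \<in> T" "u y \<in> V" "v y \<in> V" for y
      using that V(3) u v by (metis inj_onD lifts_def)
    ultimately show ?thesis using True V a by (intro exI[of _ "(T \<inter> u -` V) \<inter> (T \<inter> v -` V)"]) auto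
  next
    case False
    obtain A B where AB: "open A" "open B" "u a \<in> A" "v a \<in> B" "A \<inter> B = {}"
      using False hausdorff by metis
    have "openin (top_of_set T) ((T \<inter> u -` A) \<inter> (T \<inter> v -` B))"
      by (intro openin_Int * cu cv AB)
    then show ?thesis using AB a by (intro exI[of _ "(T \<inter> u -` A) \<inter> (T \<inter> v -` B)"]) auto
  qed
qed

text \<open>Take a maximal lift. If it ends at a finite time and does not escape to the circle, then it
  accumulates at a point of the disc, and the local inverse there continues it.\<close>

lemma lift_dichotomy:
  fixes w :: "real \<Rightarrow> complex"
  assumes w: "continuous_on {0..} w" "w ` {0..} \<subseteq> \<Omega>" and z0: "z0 \<in> unit_disc" "f z0 = w 0"
  obtains (global) \<psi> where "lifts \<psi> w {0..}" "\<psi> 0 = z0"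
    | (escape) \<psi> T where "T > 0" "lifts \<psi> w {0..<T}" "\<psi> 0 = z0" "((\<lambda>t. cmod (\<psi> t)) \<longlongrightarrow> 1) (at_left T)"
proof -
  define A where "A = {T. 0 \<le> T \<and> (\<exists>\<psi>. lifts \<psi> w {0..T} \<and> \<psi> 0 = z0)}"
  define \<Psi> where "\<Psi> T = (SOME \<psi>. lifts \<psi> w {0..T} \<and> \<psi> 0 = z0)" for T
  define \<phi> where "\<phi> t = \<Psi> t t" for t
  have \<Psi>: "lifts (\<Psi> T) w {0..T}" "\<Psi> T 0 = z0" if "T \<in> A" for T
    using that someI_ex[of "\<lambda>\<psi>. lifts \<psi> w {0..T} \<and> \<psi> 0 = z0"] by (auto simp: A_def \<Psi>_def)
  have 0: "0 \<in> A" using w z0 by (auto simp: A_def lifts_def intro!: exI[of _ "\<lambda>_. z0"])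
  have down: "s \<in> A" if "T \<in> A" "0 \<le> s" "s \<le> T" for s T
    using that \<Psi>[of T] lifts_subset[of "\<Psi> T" w "{0..T}" "{0..s}"] by (auto simp: A_def)
  have agree: "\<phi> s = \<Psi> T s" if T: "T \<in> A" "0 \<le> s" "s \<le> T" for s T
    unfolding \<phi>_def
    by (rule lift_unique[of "{0..s}" _ w _ 0])
       (use T \<Psi>[OF T(1)] \<Psi>[OF down[OF T]] lifts_subset[of "\<Psi> T" w "{0..T}" "{0..s}"] in auto)
  have \<phi>: "lifts \<phi> w {0..T}" if "T \<in> A" for T
  proof -
    have "continuous_on {0..T} \<phi>"
      using \<Psi>[OF that] by (subst continuous_on_cong[OF refl agree[OF that]]) (auto simp: lifts_def)
    then show ?thesis using \<Psi>(1)[OF that] agree[OF that] by (auto simp: lifts_def image_subset_iff)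
  qed
  have \<phi>0: "\<phi> 0 = z0" using \<Psi>[OF 0] by (simp add: \<phi>_def)
  have extend: "T \<in> A"
    if s: "s \<in> A" "s \<le> T" and V: "V \<subseteq> unit_disc" "\<phi> s \<in> V" "w ` {s..T} \<subseteq> f ` V"
      and g: "continuous_on (f ` V) g" "\<And>z. z \<in> V \<Longrightarrow> g (f z) = z" for s T V g
  proof -
    have s0: "0 \<le> s" using s by (auto simp: A_def)
    define \<psi> where "\<psi> t = (if t \<le> s then \<phi> t else g (w t))" for t
    have "continuous_on {0..T} \<psi>"
      unfolding \<psi>_def
    proof (rule continuous_on_cases_le)
      show "continuous_on {t \<in> {0..T}. t \<le> s} \<phi>"
        by (rule continuous_on_subset[of "{0..s}"]) (use \<phi>[OF s(1)] in \<open>auto simp: lifts_def\<close>)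
      show "continuous_on {t \<in> {0..T}. s \<le> t} (\<lambda>t. g (w t))"
        by (rule continuous_on_compose2[OF g(1)], rule continuous_on_subset[OF w(1)]) (use V in auto)
      show "\<phi> t = g (w t)" if "t \<in> {0..T}" "t = s" for t
        using that g(2)[OF V(2)] \<phi>[OF s(1)] s0 by (auto simp: lifts_def)
    qed auto
    moreover have "\<psi> t \<in> unit_disc \<and> f (\<psi> t) = w t" if t: "t \<in> {0..T}" for t
    proof (cases "t \<le> s")
      case True
      then show ?thesis using \<phi>[OF s(1)] t by (auto simp: \<psi>_def lifts_def image_subset_iff)
    next
      case False
      then have "w t \<in> w ` {s..T}" using t by auto
      then obtain z where "z \<in> V" "w t = f z" using V(3) by blast
      then show ?thesis using False V(1) g(2) by (auto simp: \<psi>_def)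
    qed
    ultimately have "lifts \<psi> w {0..T}" using w(2) by (auto simp: lifts_def)
    then show ?thesis using s s0 \<phi>0 by (auto simp: A_def \<psi>_def)
  qed
  have wnear: "\<exists>d>0. \<forall>t\<ge>0. \<bar>t - a\<bar> < d \<longrightarrow> w t \<in> B" if "a \<ge> 0" "open B" "w a \<in> B" for a B
  proof -
    have "continuous (at a within {0..}) w" using w(1) that(1) by (auto simp: continuous_on_eq_continuous_within)
    then have "\<forall>\<^sub>F t in at a within {0..}. w t \<in> B"
      using that by (auto simp: continuous_within intro: topological_tendstoD)
    then obtain d where d: "d > 0" "\<And>t. t \<ge> 0 \<Longrightarrow> t \<noteq> a \<Longrightarrow> dist t a < d \<Longrightarrow> w t \<in> B"
      unfolding eventually_at by auto
    then show ?thesis using that(3) by (intro exI[of _ d]) (metis dist_real_def)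
  qed
  show ?thesis
  proof (cases "bdd_above A")
    case False
    have all: "T \<in> A" if "T \<ge> 0" for T
    proof -
      obtain T' where "T' \<in> A" "T \<le> T'" using False unfolding bdd_above_def by (meson linear)
      then show ?thesis using down that by blast
    qed
    have "continuous_on {0..} \<phi>"
    proof (rule continuous_on_if_locally_continuous)
      fix t :: real assume "t \<in> {0..}"
      then have "t + 1 \<in> A" by (intro all) auto
      then have "continuous_on {0..t+1} \<phi>" using \<phi> by (auto simp: lifts_def)
      then have "continuous_on ({0..} \<inter> {..<t+1}) \<phi>"
        by (rule continuous_on_subset) auto
      then show "\<exists>U. open U \<and> t \<in> U \<and> continuous_on ({0..} \<inter> U) \<phi>" by (intro exI[of _ "{..<t+1}"]) auto
    qed
    moreover have "\<phi> t \<in> unit_disc \<and> f (\<phi> t) = w t" if "t \<ge> 0" for t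
      using \<phi>[OF all[OF that]] that by (auto simp: lifts_def image_subset_iff)
    ultimately have "lifts \<phi> w {0..}" using w(2) by (auto simp: lifts_def)
    then show ?thesis using \<phi>0 global by blast
  next
    case True
    define T where "T = Sup A"
    have ub: "s \<le> T" if "s \<in> A" for s using that True by (simp add: T_def cSup_upper)
    have T0: "0 \<le> T" using ub 0 by auto
    have TA: "T \<notin> A"
    proof
      assume T: "T \<in> A"
      then have "\<phi> T \<in> unit_disc" "f (\<phi> T) = w T" "w T \<in> \<Omega>" using \<phi>[OF T] T0 by (auto simp: lifts_def image_subset_iff)
      then obtain V g where V: "open V" "\<phi> T \<in> V" "V \<subseteq> unit_disc" "open (f ` V)" "continuous_on (f ` V) g"
        "\<And>z. z \<in> V \<Longrightarrow> g (f z) = z" using local_inverse[of "\<phi> T"] by metis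
      then obtain d where d: "d > 0" "\<And>t. t \<ge> 0 \<Longrightarrow> \<bar>t - T\<bar> < d \<Longrightarrow> w t \<in> f ` V"
        using wnear[OF T0 V(4)] \<open>f (\<phi> T) = w T\<close> by (metis imageI)
      have "T + d / 2 \<in> A"
        by (rule extend[OF T _ V(3,2) _ V(5,6)]) (use d T0 in auto)
      then show False using ub d by force
    qed
    have less: "s \<in> A" if s: "0 \<le> s" "s < T" for s
    proof -
      have "A \<noteq> {}" using 0 by auto
      then obtain T' where "T' \<in> A" "s < T'"
        using s True unfolding T_def by (auto simp: less_cSup_iff)
      then show ?thesis using down s by auto
    qed
    have Tpos: "T > 0" using TA 0 T0 by (cases "T = 0") auto
    have "continuous_on {0..<T} \<phi>"
    proof (rule continuous_on_if_locally_continuous)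
      fix t :: real assume t: "t \<in> {0..<T}"
      then have "(t + T) / 2 \<in> A" by (intro less) auto
      then have "continuous_on {0..(t+T)/2} \<phi>" using \<phi> by (auto simp: lifts_def)
      then have "continuous_on ({0..<T} \<inter> {..<(t+T)/2}) \<phi>"
        by (rule continuous_on_subset) auto
      then show "\<exists>U. open U \<and> t \<in> U \<and> continuous_on ({0..<T} \<inter> U) \<phi>"
        using t by (intro exI[of _ "{..<(t+T)/2}"]) auto
    qed
    moreover have disc: "\<phi> t \<in> unit_disc \<and> f (\<phi> t) = w t" if "0 \<le> t" "t < T" for t
      using \<phi>[OF less[OF that]] that by (auto simp: lifts_def image_subset_iff)
    ultimately have lift: "lifts \<phi> w {0..<T}" using w(2) by (auto simp: lifts_def)
    have "((\<lambda>t. cmod (\<phi> t)) \<longlongrightarrow> 1) (at_left T)"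
    proof (rule ccontr)
      assume not: "\<not> ((\<lambda>t. cmod (\<phi> t)) \<longlongrightarrow> 1) (at_left T)"
      have ev: "\<forall>\<^sub>F t in at_left T. 0 < t \<and> t < T"
        using eventually_at_left_real[OF Tpos] by (auto elim: eventually_mono)
      have "\<exists>\<rho><1. \<exists>\<^sub>F t in at_left T. cmod (\<phi> t) \<le> \<rho>"
      proof (rule ccontr)
        assume "\<not> ?thesis"
        then have *: "\<forall>\<^sub>F t in at_left T. \<rho> < cmod (\<phi> t)" if "\<rho> < 1" for \<rho>
          using that by (auto simp: frequently_def not_le)
        have "\<forall>\<^sub>F t in at_left T. cmod (\<phi> t) < \<rho>" if "\<rho> > 1" for \<rho>
          using ev
        proof eventually_elim
          case (elim t)
          then have "cmod (\<phi> t) < 1" using disc[of t] by auto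
          then show ?case using that by linarith
        qed
        then show False using not * by (metis order_tendstoI)
      qed
      then obtain \<rho> where \<rho>: "\<rho> < 1" "\<exists>\<^sub>F t in at_left T. cmod (\<phi> t) \<le> \<rho>" by blast
      have "\<exists>t. T - 1 / Suc n < t \<and> 0 < t \<and> t < T \<and> cmod (\<phi> t) \<le> \<rho>" for n :: nat
      proof -
        have "\<forall>\<^sub>F t in at_left T. T - 1 / Suc n < t"
          using eventually_at_left_real[of "T - 1 / Suc n" T] by (auto elim: eventually_mono)
        with ev have "\<forall>\<^sub>F t in at_left T. cmod (\<phi> t) \<le> \<rho> \<longrightarrow> T - 1 / Suc n < t \<and> 0 < t \<and> t < T \<and> cmod (\<phi> t) \<le> \<rho>"
          by eventually_elim auto
        from frequently_mp[OF this \<rho>(2)] show ?thesis by (auto dest: frequently_ex)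
      qed
      then obtain s where s: "\<And>n::nat. T - 1 / Suc n < s n" "\<And>n. 0 < s n" "\<And>n. s n < T" "\<And>n. cmod (\<phi> (s n)) \<le> \<rho>"
        by metis
      have sT: "s \<longlonglongrightarrow> T"
      proof (rule tendsto_sandwich[of "\<lambda>n. T - 1 / Suc n" _ _ "\<lambda>_. T"])
        show "(\<lambda>n. T - 1 / Suc n) \<longlonglongrightarrow> T"
          using tendsto_diff[OF tendsto_const[of T] LIMSEQ_inverse_real_of_nat] by (simp add: inverse_eq_divide)
      qed (use s in \<open>auto intro!: always_eventually less_imp_le\<close>)
      have "\<forall>n. (\<phi> \<circ> s) n \<in> cball 0 \<rho>" using s by auto
      then obtain q r where q: "q \<in> cball 0 \<rho>" "strict_mono r" "((\<phi> \<circ> s) \<circ> r) \<longlonglongrightarrow> q"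
        using compact_cball[of "0::complex" \<rho>] unfolding compact_def by blast
      have qd: "q \<in> unit_disc" using q \<rho> by auto
      have srT: "(s \<circ> r) \<longlonglongrightarrow> T" using LIMSEQ_subseq_LIMSEQ[OF sT q(2)] .
      have "(\<lambda>n. f (\<phi> (s (r n)))) \<longlonglongrightarrow> f q"
        by (rule continuous_on_tendsto_compose[OF contf _ qd])
           (use q disc s in \<open>auto simp: o_def less_imp_le\<close>)
      moreover have "(\<lambda>n. w (s (r n))) \<longlonglongrightarrow> w T"
        by (rule continuous_on_tendsto_compose[OF w(1)])
           (use srT s T0 in \<open>auto simp: o_def less_imp_le\<close>)
      moreover have "f (\<phi> (s (r n))) = w (s (r n))" for n using disc s by (simp add: less_imp_le)
      ultimately have fq: "f q = w T" using LIMSEQ_unique by simp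
      then have "f q \<in> \<Omega>" using w(2) T0 by auto
      then obtain V g where V: "open V" "q \<in> V" "V \<subseteq> unit_disc" "open (f ` V)" "continuous_on (f ` V) g"
        "\<And>z. z \<in> V \<Longrightarrow> g (f z) = z" using local_inverse[OF qd] by metis
      then obtain d where d: "d > 0" "\<And>t. t \<ge> 0 \<Longrightarrow> \<bar>t - T\<bar> < d \<Longrightarrow> w t \<in> f ` V"
        using wnear[OF T0 V(4)] fq by (metis imageI)
      have "\<forall>\<^sub>F n in sequentially. ((\<phi> \<circ> s) \<circ> r) n \<in> V" using topological_tendstoD[OF q(3) V(1,2)] .
      moreover have "\<forall>\<^sub>F n in sequentially. T - d < (s \<circ> r) n" using order_tendstoD(1)[OF srT, of "T - d"] d by auto
      ultimately have "\<forall>\<^sub>F n in sequentially. \<phi> (s (r n)) \<in> V \<and> T - d < s (r n)"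
        by eventually_elim auto
      then obtain n where n: "\<phi> (s (r n)) \<in> V" "T - d < s (r n)"
        by (auto dest: eventually_happens)
      have "T \<in> A"
      proof (rule extend[OF less _ V(3) n(1) _ V(5,6)])
        show "0 \<le> s (r n)" "s (r n) < T" "s (r n) \<le> T" using s by (auto simp: less_imp_le)
        have "w t \<in> f ` V" if "s (r n) \<le> t" "t \<le> T" for t
        proof (rule d(2))
          show "0 \<le> t" "\<bar>t - T\<bar> < d" using that s(2)[of "r n"] n(2) d(1) by auto
        qed
        then show "w ` {s (r n)..T} \<subseteq> f ` V" by auto
      qed
      then show False using TA by blast
    qed
    then show ?thesis using escape[OF Tpos lift \<phi>0] by blast
  qed
qed

text \<open>A lift over the parameter \<open>x0\<close> spreads to nearby parameters: the set of times up to which it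
  does so is open and closed, since one local inverse serves a whole product neighbourhood.\<close>

lemma lift_near:
  fixes w :: "'a::t2_space \<times> real \<Rightarrow> complex"
  assumes w: "continuous_on (X \<times> {0..T}) w" "w ` (X \<times> {0..T}) \<subseteq> \<Omega>"
    and g0: "continuous_on X g0" "g0 ` X \<subseteq> unit_disc" "\<And>x. x \<in> X \<Longrightarrow> f (g0 x) = w (x, 0)"
    and x0: "x0 \<in> X" and \<psi>: "lifts \<psi> (\<lambda>t. w (x0, t)) {0..T}" "\<psi> 0 = g0 x0" and T: "0 \<le> T"
  obtains U \<Phi> where "open U" "x0 \<in> U" "lifts \<Phi> w ((X \<inter> U) \<times> {0..T})"
     "\<And>x. x \<in> X \<inter> U \<Longrightarrow> \<Phi> (x, 0) = g0 x" "\<And>t. t \<in> {0..T} \<Longrightarrow> \<Phi> (x0, t) = \<psi> t"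
proof -
  define P where "P t \<longleftrightarrow> (\<exists>U \<Phi>. open U \<and> x0 \<in> U \<and> lifts \<Phi> w ((X \<inter> U) \<times> {0..t}) \<and>
     (\<forall>x \<in> X \<inter> U. \<Phi> (x, 0) = g0 x))" for t
  have sect: "lifts (\<lambda>s. \<Phi> (x, s)) (\<lambda>s. w (x, s)) {0..t}" if "lifts \<Phi> w ((X \<inter> U) \<times> {0..t})" "x \<in> X \<inter> U"
    for \<Phi> U t x
    using that unfolding lifts_def
    by (auto intro!: continuous_on_compose2[where f = "Pair x"] continuous_intros)
  have on\<psi>: "\<Phi> (x0, s) = \<psi> s"
    if "x0 \<in> U" "lifts \<Phi> w ((X \<inter> U) \<times> {0..t})" "\<Phi> (x0, 0) = g0 x0" "0 \<le> s" "s \<le> t" "t \<le> T" for U \<Phi> t s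
    by (rule lift_unique[of "{0..t}" "\<lambda>s. \<Phi> (x0, s)" "\<lambda>s. w (x0, s)" \<psi> 0 s])
       (use that sect[of \<Phi> U t x0] x0 \<psi> lifts_subset[OF \<psi>(1), of "{0..t}"] in auto)
  have "P T"
  proof (rule connected_induction_simple[of "{0..T}" 0 T P])
    show "P 0" unfolding P_def
      using w g0 T by (intro exI[of _ UNIV] exI[of _ "\<lambda>(x, t). g0 x"])
       (auto simp: lifts_def split_beta intro!: continuous_on_compose2[OF g0(1)] continuous_intros)
    fix t0 assume t0: "t0 \<in> {0..T}"
    have "\<psi> t0 \<in> unit_disc" "f (\<psi> t0) = w (x0, t0)" "w (x0, t0) \<in> \<Omega>"
      using \<psi> t0 by (auto simp: lifts_def image_subset_iff)
    then obtain V g where V: "open V" "\<psi> t0 \<in> V" "V \<subseteq> unit_disc" "open (f ` V)" "continuous_on (f ` V) g"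
        "\<And>z. z \<in> V \<Longrightarrow> g (f z) = z" using local_inverse[of "\<psi> t0"] by metis
    have "continuous (at (x0, t0) within X \<times> {0..T}) w"
      using w x0 t0 by (auto simp: continuous_on_eq_continuous_within)
    then obtain N where N: "open N" "(x0, t0) \<in> N" "\<And>p. p \<in> X \<times> {0..T} \<Longrightarrow> p \<in> N \<Longrightarrow> w p \<in> f ` V"
      using V(2,4) \<open>f (\<psi> t0) = w (x0, t0)\<close> unfolding continuous_within_topological by (metis imageI)
    obtain U0 I0 where UI: "open U0" "open I0" "x0 \<in> U0" "t0 \<in> I0" "U0 \<times> I0 \<subseteq> N"
      using open_prod_elim[OF N(1,2)] by (metis mem_Sigma_iff)
    have "continuous (at t0 within {0..T}) \<psi>"
      using \<psi> t0 by (auto simp: lifts_def continuous_on_eq_continuous_within)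
    then obtain I1 where I1: "open I1" "t0 \<in> I1" "\<And>t. t \<in> {0..T} \<Longrightarrow> t \<in> I1 \<Longrightarrow> \<psi> t \<in> V"
      using V(1,2) unfolding continuous_within_topological by metis
    obtain d where d: "d > 0" "ball t0 d \<subseteq> I0 \<inter> I1"
      using UI I1 by (metis IntI open_Int open_contains_ball)
    show "\<exists>S. openin (top_of_set {0..T}) S \<and> t0 \<in> S \<and> (\<forall>x\<in>S. \<forall>y\<in>S. P x \<longrightarrow> P y)"
    proof (intro exI[of _ "{0..T} \<inter> ball t0 d"] conjI ballI impI)
      fix t1 t2 assume t1: "t1 \<in> {0..T} \<inter> ball t0 d" and t2: "t2 \<in> {0..T} \<inter> ball t0 d" and "P t1"
      then obtain U \<Phi> where U: "open U" "x0 \<in> U" and \<Phi>: "lifts \<Phi> w ((X \<inter> U) \<times> {0..t1})"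
        "\<And>x. x \<in> X \<inter> U \<Longrightarrow> \<Phi> (x, 0) = g0 x" unfolding P_def by blast
      show "P t2"
      proof (cases "t2 \<le> t1")
        case True
        have "lifts \<Phi> w ((X \<inter> U) \<times> {0..t2})"
          by (rule lifts_subset[OF \<Phi>(1)]) (use True in auto)
        then show ?thesis unfolding P_def using U \<Phi>(2) by blast
      next
        case False
        have "\<Phi> (x0, t1) = \<psi> t1" using on\<psi>[OF U(2) \<Phi>(1), of t1] \<Phi>(2)[of x0] x0 U(2) t1 by auto
        then have in_V: "\<Phi> (x0, t1) \<in> V" using I1(3)[of t1] t1 d by auto
        have "continuous (at x0 within X \<inter> U) (\<lambda>x. \<Phi> (x, t1))"
        proof -
          have "continuous_on (X \<inter> U) (\<lambda>x. \<Phi> (x, t1))"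
            using \<Phi>(1) t1 unfolding lifts_def
            by (auto intro!: continuous_on_compose2[where f = "\<lambda>x. (x, t1)" and g = \<Phi>] continuous_intros)
          then show ?thesis using x0 U by (auto simp: continuous_on_eq_continuous_within)
        qed
        then obtain U2 where U2: "open U2" "x0 \<in> U2" "\<And>x. x \<in> X \<inter> U \<Longrightarrow> x \<in> U2 \<Longrightarrow> \<Phi> (x, t1) \<in> V"
          using V(1) in_V unfolding continuous_within_topological by metis
        define U' where "U' = U \<inter> U2 \<inter> U0"
        define \<Phi>' where "\<Phi>' p = (if snd p \<le> t1 then \<Phi> p else g (w p))" for p
        have wV: "w p \<in> f ` V" if p: "p \<in> (X \<inter> U') \<times> {t1..t2}" for p
        proof (rule N(3))
          have "snd p \<in> ball t0 d"
            using p t1 t2 by (auto simp: dist_real_def)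
          then show "p \<in> N" using UI(5) d(2) p by (cases p) (auto simp: U'_def)
        qed (use p t1 t2 in auto)
        have "continuous_on ((X \<inter> U') \<times> {0..t2}) \<Phi>'"
          unfolding \<Phi>'_def
        proof (rule continuous_on_cases_le)
          show "continuous_on {p \<in> (X \<inter> U') \<times> {0..t2}. snd p \<le> t1} \<Phi>"
            by (rule continuous_on_subset[of "(X \<inter> U) \<times> {0..t1}"]) (use \<Phi>(1) in \<open>auto simp: lifts_def U'_def\<close>)
          show "continuous_on {p \<in> (X \<inter> U') \<times> {0..t2}. t1 \<le> snd p} (\<lambda>p. g (w p))"
            by (rule continuous_on_compose2[OF V(5)], rule continuous_on_subset[OF w(1)])
               (use wV t1 t2 in auto)
          show "\<Phi> p = g (w p)" if p: "p \<in> (X \<inter> U') \<times> {0..t2}" "snd p = t1" for p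
          proof -
            have "\<Phi> p \<in> V" using U2(3)[of "fst p"] p by (auto simp: U'_def)
            moreover have "f (\<Phi> p) = w p" using \<Phi>(1) p t1 by (auto simp: lifts_def U'_def)
            ultimately show ?thesis using V(6) by metis
          qed
        qed (auto intro: continuous_intros)
        moreover have "\<Phi>' p \<in> unit_disc \<and> f (\<Phi>' p) = w p" if p: "p \<in> (X \<inter> U') \<times> {0..t2}" for p
        proof (cases "snd p \<le> t1")
          case True
          then have "p \<in> (X \<inter> U) \<times> {0..t1}" using p by (auto simp: U'_def)
          then show ?thesis using True \<Phi>(1) by (auto simp: \<Phi>'_def lifts_def image_subset_iff)
        next
          case False
          then have "w p \<in> f ` V" using p by (intro wV) auto
          then show ?thesis using False V(3,6) by (auto simp: \<Phi>'_def)
        qed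
        moreover have "w ` ((X \<inter> U') \<times> {0..t2}) \<subseteq> \<Omega>" using w(2) t2 by (auto simp: image_subset_iff)
        ultimately have "lifts \<Phi>' w ((X \<inter> U') \<times> {0..t2})" by (auto simp: lifts_def)
        then show ?thesis unfolding P_def
          using U U2 UI \<Phi>(2) t1 by (intro exI[of _ U'] exI[of _ \<Phi>']) (auto simp: U'_def \<Phi>'_def)
      qed
    qed (use t0 d in auto)
  qed (use T in auto)
  then obtain U \<Phi> where U: "open U" "x0 \<in> U" and \<Phi>: "lifts \<Phi> w ((X \<inter> U) \<times> {0..T})"
        "\<And>x. x \<in> X \<inter> U \<Longrightarrow> \<Phi> (x, 0) = g0 x" unfolding P_def by blast
  show ?thesis by (rule that[OF U \<Phi>]) (use on\<psi>[OF U(2) \<Phi>(1)] \<Phi>(2) x0 U in auto)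
qed

lemma lifts_jointly_continuous:
  fixes w :: "'a::t2_space \<times> real \<Rightarrow> complex"
  assumes w: "continuous_on (X \<times> {0..T}) w" and T: "0 \<le> T"
    and lift: "\<And>x. x \<in> X \<Longrightarrow> lifts (\<lambda>t. \<Phi> (x, t)) (\<lambda>t. w (x, t)) {0..T}"
    and start: "continuous_on X (\<lambda>x. \<Phi> (x, 0))"
  shows "lifts \<Phi> w (X \<times> {0..T})"
proof -
  have w2: "w ` (X \<times> {0..T}) \<subseteq> \<Omega>" using lift by (fastforce simp: lifts_def)
  have "continuous_on (X \<times> {0..T}) \<Phi>"
  proof (rule continuous_on_if_locally_continuous)
    fix p assume p: "p \<in> X \<times> {0..T}"
    obtain U \<Phi>' where U: "open U" "fst p \<in> U" "lifts \<Phi>' w ((X \<inter> U) \<times> {0..T})"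
      "\<And>x. x \<in> X \<inter> U \<Longrightarrow> \<Phi>' (x, 0) = \<Phi> (x, 0)"
      by (rule lift_near[of X T w "\<lambda>x. \<Phi> (x, 0)" "fst p" "\<lambda>t. \<Phi> (fst p, t)"])
         (use w w2 start p lift T in \<open>auto simp: lifts_def image_subset_iff\<close>)
    have eq: "\<Phi>' q = \<Phi> q" if q: "q \<in> (X \<inter> U) \<times> {0..T}" for q
    proof -
      obtain x t where xt: "q = (x, t)" "x \<in> X \<inter> U" "t \<in> {0..T}" using q by auto
      have "lifts (\<lambda>s. \<Phi>' (x, s)) (\<lambda>s. w (x, s)) {0..T}"
        using U(3) xt(2) unfolding lifts_def
        by (auto intro!: continuous_on_compose2[where f = "Pair x" and g = \<Phi>'] continuous_intros)
      then show ?thesis unfolding xt(1)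
        using lift_unique[of "{0..T}" "\<lambda>s. \<Phi>' (x, s)" _ "\<lambda>s. \<Phi> (x, s)" 0 t] lift[of x] U(4)[OF xt(2)] xt T by auto
    qed
    have "continuous_on ((X \<inter> U) \<times> {0..T}) \<Phi>"
      using U(3) by (subst continuous_on_cong[OF refl eq[symmetric]]) (auto simp: lifts_def)
    moreover have "X \<times> {0..T} \<inter> U \<times> UNIV = (X \<inter> U) \<times> {0..T}" by auto
    ultimately show "\<exists>N. open N \<and> p \<in> N \<and> continuous_on (X \<times> {0..T} \<inter> N) \<Phi>"
      using U(1,2) by (intro exI[of _ "U \<times> UNIV"]) (auto simp: open_Times mem_Times_iff)
  qed
  then show ?thesis using lift w2 by (auto simp: lifts_def image_subset_iff)
qed

end

section \<open>Chordal distance and boundary paths\<close>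

lemma chordal_dist_nonneg: "0 \<le> chordal_dist a b"
  by (cases a; cases b) auto

lemma chordal_dist_tendsto_0_if_less_inverse:
  assumes "\<And>n. chordal_dist a (Some (w n)) < 1 / Suc n"
  shows "(\<lambda>n. chordal_dist a (Some (w n))) \<longlonglongrightarrow> 0"
proof (rule tendsto_sandwich)
  show "\<forall>\<^sub>F n in sequentially. 0 \<le> chordal_dist a (Some (w n))"
    by (rule always_eventually) (simp only: chordal_dist_nonneg simp_thms)
  show "\<forall>\<^sub>F n in sequentially. chordal_dist a (Some (w n)) \<le> inverse (real (Suc n))"
    by (rule always_eventually, rule allI, rule less_imp_le) (simp only: assms inverse_eq_divide)
qed (rule tendsto_const LIMSEQ_inverse_real_of_nat)+

lemma chordal_small_Some:
  assumes "\<delta> > 0"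
  shows "\<exists>\<epsilon>>0. \<forall>w. chordal_dist (Some a) (Some w) < \<epsilon> \<longrightarrow> cmod (w - a) < \<delta>"
proof (rule ccontr)
  assume no: "\<not> ?thesis"
  have "\<exists>w. chordal_dist (Some a) (Some w) < 1 / Suc n \<and> \<not> cmod (w - a) < \<delta>" for n :: nat
  proof -
    have "0 < 1 / real (Suc n)" by simp
    then show ?thesis using no by blast
  qed
  then obtain w where w: "\<And>n::nat. chordal_dist (Some a) (Some (w n)) < 1 / Suc n"
    "\<And>n. \<not> cmod (w n - a) < \<delta>" by metis
  have "w \<longlonglongrightarrow> a"
    using chordal_dist_tendsto_0_if_less_inverse[OF w(1)] tendsto_chordal_Some_iff by blast
  then have "\<forall>\<^sub>F n in sequentially. dist (w n) a < \<delta>" using assms by (rule tendstoD)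
  then show False using w(2) by (auto simp: dist_norm dest: eventually_happens)
qed

lemma chordal_small_None:
  "\<exists>\<epsilon>>0. \<forall>w. chordal_dist None (Some w) < \<epsilon> \<longrightarrow> B < cmod w"
proof (rule ccontr)
  assume no: "\<not> ?thesis"
  have "\<exists>w. chordal_dist None (Some w) < 1 / Suc n \<and> \<not> B < cmod w" for n :: nat
  proof -
    have "0 < 1 / real (Suc n)" by simp
    then show ?thesis using no by blast
  qed
  then obtain w where w: "\<And>n::nat. chordal_dist None (Some (w n)) < 1 / Suc n"
    "\<And>n. \<not> B < cmod (w n)" by metis
  have "filterlim w at_infinity sequentially"
    using chordal_dist_tendsto_0_if_less_inverse[OF w(1)] tendsto_chordal_None_iff by blast
  then have "filterlim (\<lambda>n. cmod (w n)) at_top sequentially"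
    by (simp add: filterlim_at_infinity_conv_norm_at_top)
  then have "\<forall>\<^sub>F n in sequentially. B < cmod (w n)" by (simp add: filterlim_at_top_dense)
  then show False using w(2) by (auto dest: eventually_happens)
qed

lemma chordal_None_small_if_large:
  assumes "\<epsilon> > 0"
  shows "\<exists>B>0. \<forall>w. B < cmod w \<longrightarrow> chordal_dist None (Some w) < \<epsilon>"
proof (intro exI[of _ "2 / \<epsilon>"] conjI allI impI)
  show "0 < 2 / \<epsilon>" using assms by simp
  fix w assume w: "2 / \<epsilon> < cmod w"
  have "2 / \<epsilon> < sqrt (1 + (cmod w)\<^sup>2)"
    using w real_le_rsqrt[of "cmod w" "1 + (cmod w)\<^sup>2"] by simp
  then show "chordal_dist None (Some w) < \<epsilon>"
    using assms by (simp add: field_simps add_pos_nonneg)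
qed

lemma boundary_path_in_disc: "boundary_path \<Gamma> \<Longrightarrow> 0 \<le> t \<Longrightarrow> t < 1 \<Longrightarrow> \<Gamma> t \<in> unit_disc"
  unfolding boundary_path_def image_subset_iff by (meson atLeastLessThan_iff)

text \<open>A boundary path can accumulate only on the circle, so if its end is a single point then it converges.\<close>

lemma boundary_path_tendsto_end:
  assumes "boundary_path \<Gamma>" "path_end \<Gamma> = {\<zeta>}"
  shows "cmod \<zeta> = 1" "(\<Gamma> \<longlongrightarrow> \<zeta>) (at_left 1)"
proof -
  have \<zeta>: "\<zeta> \<in> closure (\<Gamma> ` {0..<1}) \<inter> unit_circle" using assms(2) by (auto simp: path_end_def)
  then show "cmod \<zeta> = 1" by simp
  have disc: "\<Gamma> t \<in> unit_disc" if "0 \<le> t" "t < 1" for t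
    using boundary_path_in_disc[OF assms(1) that] .
  have lim: "((\<lambda>t. cmod (\<Gamma> t)) \<longlongrightarrow> 1) (at_left 1)" using assms(1) by (simp add: boundary_path_def)
  have ev: "\<forall>\<^sub>F t in at_left (1::real). 0 < t \<and> t < 1"
    using eventually_at_left_real[of 0 1] by (auto elim: eventually_mono)
  show "(\<Gamma> \<longlongrightarrow> \<zeta>) (at_left 1)"
  proof (rule topological_tendstoI, rule ccontr)
    fix A assume A: "open A" "\<zeta> \<in> A" and "\<not> (\<forall>\<^sub>F t in at_left 1. \<Gamma> t \<in> A)"
    then have freq: "\<exists>\<^sub>F t in at_left 1. \<Gamma> t \<notin> A" by (simp add: frequently_def)
    have "\<exists>t. 1 - 1 / Suc n < t \<and> 0 < t \<and> t < 1 \<and> \<Gamma> t \<notin> A" for n :: nat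
    proof -
      have "\<forall>\<^sub>F t in at_left 1. 1 - 1 / Suc n < t"
        using eventually_at_left_real[of "1 - 1 / Suc n" 1] by (auto elim: eventually_mono)
      with ev have "\<forall>\<^sub>F t in at_left 1. \<Gamma> t \<notin> A \<longrightarrow> 1 - 1 / Suc n < t \<and> 0 < t \<and> t < 1 \<and> \<Gamma> t \<notin> A"
        by eventually_elim auto
      from frequently_mp[OF this freq] show ?thesis by (auto dest: frequently_ex)
    qed
    then obtain s where s: "\<And>n::nat. 1 - 1 / Suc n < s n" "\<And>n. 0 < s n" "\<And>n. s n < 1" "\<And>n. \<Gamma> (s n) \<notin> A"
      by metis
    have s1: "s \<longlonglongrightarrow> 1"
    proof (rule tendsto_sandwich[of "\<lambda>n. 1 - 1 / Suc n" _ _ "\<lambda>_. 1"])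
      show "(\<lambda>n. 1 - 1 / real (Suc n)) \<longlonglongrightarrow> 1"
        using tendsto_diff[OF tendsto_const[of 1] LIMSEQ_inverse_real_of_nat] by (simp add: inverse_eq_divide)
    qed (use s in \<open>auto intro!: always_eventually less_imp_le\<close>)
    have "\<forall>n. (\<Gamma> \<circ> s) n \<in> cball 0 1" using s disc by (auto simp: less_imp_le)
    then obtain q r where q: "q \<in> cball 0 1" "strict_mono r" "((\<Gamma> \<circ> s) \<circ> r) \<longlonglongrightarrow> q"
      using compact_cball[of "0::complex" 1] unfolding compact_def by blast
    have "filterlim s (at_left 1) sequentially"
      using s1 s(3) by (auto simp: filterlim_at less_imp_neq intro!: always_eventually)
    from filterlim_compose[OF lim filterlim_compose[OF this filterlim_subseq[OF q(2)]]]
    have "(\<lambda>n. cmod (\<Gamma> (s (r n)))) \<longlonglongrightarrow> 1" .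
    moreover have "(\<lambda>n. cmod (\<Gamma> (s (r n)))) \<longlonglongrightarrow> cmod q" using tendsto_norm[OF q(3)] by (simp add: o_def)
    ultimately have "cmod q = 1" using LIMSEQ_unique by blast
    moreover have "q \<in> closure (\<Gamma> ` {0..<1})"
    proof -
      have "\<Gamma> (s (r n)) \<in> closure (\<Gamma> ` {0..<1})" for n
        using s(2,3)[of "r n"] by (intro subsetD[OF closure_subset] imageI) simp
      then show ?thesis by (intro closed_sequentially[OF closed_closure _ q(3)]) (simp add: o_def)
    qed
    ultimately have "q \<in> path_end \<Gamma>" unfolding path_end_def by simp
    then have "q = \<zeta>" using assms(2) by simp
    moreover have "q \<in> - A"
    proof (rule closed_sequentially[OF _ _ q(3)])
      show "closed (- A)" using A(1) by (rule closed_Compl)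
      show "((\<Gamma> \<circ> s) \<circ> r) n \<in> - A" for n using s(4)[of "r n"] by simp
    qed
    ultimately show False using A(2) by simp
  qed
qed

lemma path_with_endpoint:
  fixes \<Gamma> :: "real \<Rightarrow> complex"
  assumes "continuous_on {0..<1} \<Gamma>" "(\<Gamma> \<longlongrightarrow> \<zeta>) (at_left 1)"
  shows "path (\<lambda>t. if t < 1 then \<Gamma> t else \<zeta>)"
  unfolding path_def continuous_on_eq_continuous_within
proof
  let ?c = "\<lambda>t. if t < 1 then \<Gamma> t else \<zeta>"
  fix t :: real assume t: "t \<in> {0..1}"
  show "continuous (at t within {0..1}) ?c"
  proof (cases "t = 1")
    case True
    have "(?c \<longlongrightarrow> \<zeta>) (at_left 1)"
      using assms(2)
      by (rule Lim_transform_eventually) (rule eventually_mono[OF eventually_at_left_real[of 0 1]], auto)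
    then have "(?c \<longlongrightarrow> \<zeta>) (at 1 within {0..1})"
      by (rule tendsto_mono[rotated]) (auto simp: at_within_Icc_at_left)
    then show ?thesis using True by (simp add: continuous_within)
  next
    case False
    have "continuous_on ({0..1} \<inter> {..<1}) ?c"
      by (subst continuous_on_cong[of _ "{0..<1}" _ \<Gamma>]) (use assms(1) in auto)
    moreover have "at t within {0..1} = at t within ({0..1} \<inter> {..<1})"
      by (rule at_within_nhd[of _ "{..<1}"]) (use t False in auto)
    ultimately show ?thesis using t False by (auto simp: continuous_on_eq_continuous_within)
  qed
qed

lemma dense_in_circle_meets_arc:
  assumes "dense_in_circle S" "l < u"
  obtains s where "l < s" "s < u" "cis s \<in> S"
proof -
  define m where "m = (l + u) / 2"
  have "isCont Arg 1" by (rule continuous_at_Arg) auto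
  then obtain d where d: "d > 0" "\<And>w. dist w 1 < d \<Longrightarrow> dist (Arg w) (Arg 1) < (u - l) / 2"
    unfolding continuous_at_eps_delta using assms(2) by (metis half_gt_zero_iff diff_gt_0_iff_gt)
  have "cis m \<in> closure S" using assms(1) by (auto simp: dense_in_circle_def)
  then obtain z where z: "z \<in> S" "dist z (cis m) < d" using d(1) by (auto simp: closure_approachable)
  have z1: "cmod z = 1" using z(1) assms(1) by (auto simp: dense_in_circle_def)
  define w where "w = z * cis (- m)"
  have cc: "cis m * cis (- m) = 1" by (simp add: cis_mult)
  have "w - 1 = (z - cis m) * cis (- m)" by (simp only: w_def left_diff_distrib cc)
  then have "dist w 1 < d" using z(2) by (simp add: dist_norm norm_mult)
  then have small: "\<bar>Arg w\<bar> < (u - l) / 2" using d(2)[of w] by (simp add: dist_real_def)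
  have "w \<noteq> 0" "cmod w = 1" using z1 by (auto simp: w_def norm_mult)
  then have "cis (Arg w) = w" by (simp add: cis_Arg sgn_eq)
  moreover have "cis m * w = z"
    using cc by (simp add: w_def mult.left_commute)
  ultimately have "cis (m + Arg w) = z" using cis_mult[of m "Arg w"] by simp
  moreover have "l < m + Arg w" "m + Arg w < u"
    using small unfolding m_def abs_less_iff by (simp_all add: field_simps)
  ultimately show ?thesis using z(1) by (intro that[of "m + Arg w"]) auto
qed

section \<open>Curves that meet a tract\<close>

locale holomorphic_tract =
  fixes f :: "complex \<Rightarrow> complex" and D :: "real \<Rightarrow> complex set" and a :: "complex option"
  assumes holf: "f holomorphic_on unit_disc"
    and tract: "tract f D a"
    and tract_end: "tract_end D \<subseteq> unit_circle"
begin

lemma contf: "continuous_on unit_disc f"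
  using holf by (rule holomorphic_on_imp_continuous_on)

lemma component: "\<epsilon> > 0 \<Longrightarrow> D \<epsilon> \<in> components {z \<in> unit_disc. Some (f z) \<in> chordal_ball a \<epsilon>}"
  using tract by (simp add: tract_def)

lemma D_mono: "0 < \<epsilon> \<Longrightarrow> \<epsilon> \<le> \<epsilon>' \<Longrightarrow> D \<epsilon> \<subseteq> D \<epsilon>'"
  using tract by (cases "\<epsilon> = \<epsilon>'") (auto simp: tract_def)

lemma D_subset: "\<epsilon> > 0 \<Longrightarrow> z \<in> D \<epsilon> \<Longrightarrow> z \<in> unit_disc \<and> chordal_dist a (Some (f z)) < \<epsilon>"
  using in_components_subset[OF component] by (auto simp: chordal_ball_def)

lemma D_connected: "\<epsilon> > 0 \<Longrightarrow> connected (D \<epsilon>)"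
  using component in_components_connected by blast

lemma D_maximal:
  assumes "\<epsilon> > 0" "connected C" "C \<subseteq> unit_disc" "\<And>z. z \<in> C \<Longrightarrow> chordal_dist a (Some (f z)) < \<epsilon>" "C \<inter> D \<epsilon> \<noteq> {}"
  shows "C \<subseteq> D \<epsilon>"
  by (rule components_maximal[OF component]) (use assms in \<open>auto simp: chordal_ball_def\<close>)

lemma D_open:
  assumes "\<epsilon> > 0" shows "open (D \<epsilon>)"
proof (rule open_components[OF _ component[OF assms]])
  have "continuous_on unit_disc (\<lambda>z. chordal_dist a (Some (f z)))"
  proof (cases a)
    case None
    have "1 + (cmod (f z))\<^sup>2 > 0" for z by (simp add: add_pos_nonneg)
    then show ?thesis unfolding None by (auto intro!: continuous_intros contf simp: less_imp_neq[symmetric])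
  next
    case (Some b)
    have "1 + (cmod (f z))\<^sup>2 > 0" "1 + (cmod b)\<^sup>2 > 0" for z by (simp_all add: add_pos_nonneg)
    then show ?thesis unfolding Some by (auto intro!: continuous_intros contf simp: less_imp_neq[symmetric])
  qed
  then have "open (unit_disc \<inter> (\<lambda>z. chordal_dist a (Some (f z))) -` {..<\<epsilon>})"
    by (rule continuous_open_preimage) auto
  then show "open {z \<in> unit_disc. Some (f z) \<in> chordal_ball a \<epsilon>}"
    by (simp add: chordal_ball_def vimage_def Int_def)
qed

lemma D_joins:
  assumes "\<epsilon> > 0" "x \<in> D \<epsilon>" "y \<in> D \<epsilon>"
  obtains g where "path g" "path_image g \<subseteq> D \<epsilon>" "pathstart g = x" "pathfinish g = y"
  using assms D_open[of \<epsilon>] D_connected[of \<epsilon>] connected_open_path_connected[of "D \<epsilon>"]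
  unfolding path_connected_def by blast

text \<open>The closures of the tract sets are compact and nested with intersection on the circle.\<close>

lemma D_leaves_disc:
  assumes "\<rho> < 1"
  shows "\<exists>\<epsilon>0>0. \<forall>\<epsilon> z. 0 < \<epsilon> \<longrightarrow> \<epsilon> \<le> \<epsilon>0 \<longrightarrow> z \<in> D \<epsilon> \<longrightarrow> \<rho> < cmod z"
proof (rule ccontr)
  assume no: "\<not> ?thesis"
  define F where "F n = closure (D (1 / real (Suc n))) \<inter> cball 0 \<rho>" for n
  have "\<Inter> (range F) \<noteq> {}"
  proof (rule compact_nest)
    show "compact (F n)" for n by (simp add: F_def closed_Int_compact)
    show "F n \<noteq> {}" for n
    proof -
      have "0 < 1 / real (Suc n)" by simp
      then obtain \<epsilon> z where "0 < \<epsilon>" "\<epsilon> \<le> 1 / real (Suc n)" "z \<in> D \<epsilon>" "\<not> \<rho> < cmod z"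
        using no by blast
      then have "z \<in> F n" using D_mono[of \<epsilon> "1 / real (Suc n)"] closure_subset by (auto simp: F_def)
      then show ?thesis by blast
    qed
    show "F n \<subseteq> F m" if "m \<le> n" for m n
      using closure_mono[OF D_mono[of "1 / real (Suc n)" "1 / real (Suc m)"]] that
      by (auto simp: F_def frac_le)
  qed
  then obtain z where z: "\<And>n. z \<in> F n" by auto
  have "z \<in> closure (D \<epsilon>)" if \<epsilon>: "\<epsilon> > 0" for \<epsilon>
  proof -
    obtain n where "inverse (real (Suc n)) < \<epsilon>" using reals_Archimedean[OF \<epsilon>] by blast
    then have "closure (D (1 / real (Suc n))) \<subseteq> closure (D \<epsilon>)"
      by (intro closure_mono D_mono) (auto simp: inverse_eq_divide)
    then show ?thesis using z[of n] by (auto simp: F_def)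
  qed
  then have "z \<in> tract_end D" by (auto simp: tract_end_def)
  then have "cmod z = 1" using tract_end by auto
  then show False using z[of 0] assms by (auto simp: F_def)
qed

definition meets :: "(real \<Rightarrow> complex) \<Rightarrow> bool" where
  "meets \<Gamma> \<longleftrightarrow> (\<forall>\<epsilon>>0. \<Gamma> ` {0..<1} \<inter> D \<epsilon> \<noteq> {})"

lemma meets_late:
  assumes \<Gamma>: "boundary_path \<Gamma>" "meets \<Gamma>" and "\<tau> < 1" "\<epsilon> > 0"
  shows "\<exists>t. 0 \<le> t \<and> \<tau> < t \<and> t < 1 \<and> \<Gamma> t \<in> D \<epsilon>"
proof -
  have "continuous_on {0..\<tau>} \<Gamma>"
    by (rule continuous_on_subset[of "{0..<1}"]) (use \<Gamma> assms(3) in \<open>auto simp: boundary_path_def\<close>)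
  then have "compact (\<Gamma> ` {0..\<tau>})" by (intro compact_continuous_image compact_Icc)
  moreover have "\<Gamma> ` {0..\<tau>} \<subseteq> unit_disc"
    using boundary_path_in_disc[OF \<Gamma>(1)] assms(3) by (auto simp del: mem_ball_0)
  ultimately have "\<exists>\<rho><1. \<forall>z \<in> \<Gamma> ` {0..\<tau>}. cmod z \<le> \<rho>"
  proof (cases "\<Gamma> ` {0..\<tau>} = {}")
    case False
    assume c: "compact (\<Gamma> ` {0..\<tau>})" and sub: "\<Gamma> ` {0..\<tau>} \<subseteq> unit_disc"
    obtain m where m: "m \<in> \<Gamma> ` {0..\<tau>}" "\<And>z. z \<in> \<Gamma> ` {0..\<tau>} \<Longrightarrow> cmod z \<le> cmod m"
      using continuous_attains_sup[OF c False, of cmod] continuous_on_norm_id by blast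
    then have "cmod m < 1" using sub by (meson mem_ball_0 subsetD)
    then show ?thesis using m(2) by blast
  qed (auto intro: exI[of _ 0])
  then obtain \<rho> where \<rho>: "\<rho> < 1" "\<And>z. z \<in> \<Gamma> ` {0..\<tau>} \<Longrightarrow> cmod z \<le> \<rho>" by blast
  obtain \<epsilon>0 where \<epsilon>0: "\<epsilon>0 > 0" "\<And>\<epsilon> z. 0 < \<epsilon> \<Longrightarrow> \<epsilon> \<le> \<epsilon>0 \<Longrightarrow> z \<in> D \<epsilon> \<Longrightarrow> \<rho> < cmod z"
    using D_leaves_disc[OF \<rho>(1)] by blast
  have "\<Gamma> ` {0..<1} \<inter> D (min \<epsilon> \<epsilon>0) \<noteq> {}" using \<Gamma>(2) \<open>\<epsilon> > 0\<close> \<epsilon>0(1) by (simp add: meets_def)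
  then obtain t where t: "0 \<le> t" "t < 1" "\<Gamma> t \<in> D (min \<epsilon> \<epsilon>0)" by auto
  have "\<rho> < cmod (\<Gamma> t)" using \<epsilon>0(2)[of "min \<epsilon> \<epsilon>0"] \<epsilon>0(1) t(3) \<open>\<epsilon> > 0\<close> by simp
  then have "t \<notin> {0..\<tau>}" using \<rho>(2)[of "\<Gamma> t"] by force
  then show ?thesis using t D_mono[of "min \<epsilon> \<epsilon>0" \<epsilon>] \<epsilon>0(1) \<open>\<epsilon> > 0\<close> by (intro exI[of _ t]) auto
qed

lemma meets_eventually:
  assumes \<Gamma>: "boundary_path \<Gamma>" "meets \<Gamma>" and "\<forall>\<^sub>F t in at_left 1. P t" "\<epsilon> > 0"
  shows "\<exists>t. 0 \<le> t \<and> t < 1 \<and> P t \<and> \<Gamma> t \<in> D \<epsilon>"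
proof -
  obtain \<tau> where \<tau>: "\<tau> < 1" "\<And>t. \<tau> < t \<Longrightarrow> t < 1 \<Longrightarrow> P t"
    using assms(3) unfolding eventually_at_left_field by blast
  obtain t where t: "0 \<le> t" "\<tau> < t" "t < 1" "\<Gamma> t \<in> D \<epsilon>" using meets_late[OF \<Gamma> \<tau>(1) assms(4)] by blast
  then show ?thesis using \<tau>(2) by blast
qed

text \<open>On the tail of the curve \<open>f\<close> is close to \<open>b\<close>, and on the points of that tail in \<open>D \<epsilon>\<close> it is close
  to \<open>a\<close>.\<close>

lemma asymptotic_value_along_meeting_curve:
  assumes \<Gamma>: "asymptotic_curve f b \<Gamma>" "meets \<Gamma>"
  shows "b = a"
proof -
  have bp: "boundary_path \<Gamma>" and lim: "((\<lambda>t. chordal_dist b (Some (f (\<Gamma> t)))) \<longlongrightarrow> 0) (at_left 1)"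
    using \<Gamma> by (auto simp: asymptotic_curve_def)
  have ev: "\<forall>\<^sub>F t in at_left 1. chordal_dist b (Some (f (\<Gamma> t))) < e" if "e > 0" for e
    using order_tendstoD(2)[OF lim that] .
  have far: False if e: "e > 0" and no: "\<And>w. chordal_dist b (Some w) < e \<Longrightarrow> chordal_dist a (Some w) < e \<Longrightarrow> False" for e
  proof -
    obtain t where "chordal_dist b (Some (f (\<Gamma> t))) < e" "\<Gamma> t \<in> D e"
      using meets_eventually[OF bp \<Gamma>(2) ev[OF e] e] by blast
    then show False using no D_subset[OF e] by blast
  qed
  have ne: False if "b = None" "a = Some c" for c
  proof -
    obtain e1 where e1: "e1 > 0" "\<And>w. chordal_dist (Some c) (Some w) < e1 \<Longrightarrow> cmod (w - c) < 1"
      using chordal_small_Some[OF zero_less_one] by blast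
    obtain e2 where e2: "e2 > 0" "\<And>w. chordal_dist None (Some w) < e2 \<Longrightarrow> cmod c + 1 < cmod w"
      using chordal_small_None by blast
    show False
    proof (rule far[of "min e1 e2"])
      fix w assume w: "chordal_dist b (Some w) < min e1 e2" "chordal_dist a (Some w) < min e1 e2"
      then have "cmod (w - c) < 1" "cmod c + 1 < cmod w" using e1(2)[of w] e2(2)[of w] that by auto
      then show False using norm_triangle_ineq2[of w c] by linarith
    qed (use e1 e2 in auto)
  qed
  show ?thesis
  proof (cases a; cases b)
    fix c d assume cd: "a = Some c" "b = Some d"
    show ?thesis
    proof (rule ccontr)
      assume "b \<noteq> a"
      then have pos: "cmod (c - d) / 2 > 0" using cd by auto
      obtain e1 where e1: "e1 > 0" "\<And>w. chordal_dist (Some c) (Some w) < e1 \<Longrightarrow> cmod (w - c) < cmod (c - d) / 2"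
        using chordal_small_Some[OF pos] by blast
      obtain e2 where e2: "e2 > 0" "\<And>w. chordal_dist (Some d) (Some w) < e2 \<Longrightarrow> cmod (w - d) < cmod (c - d) / 2"
        using chordal_small_Some[OF pos] by blast
      show False
      proof (rule far[of "min e1 e2"])
        fix w assume w: "chordal_dist b (Some w) < min e1 e2" "chordal_dist a (Some w) < min e1 e2"
        then have "cmod (w - c) < cmod (c - d) / 2" "cmod (w - d) < cmod (c - d) / 2"
          using e1(2)[of w] e2(2)[of w] cd by auto
        then show False using norm_triangle_ineq4[of "w - d" "w - c"] by (simp add: algebra_simps)
      qed (use e1 e2 in auto)
    qed
  next
    fix c assume cd: "a = None" "b = Some c"
    obtain e1 where e1: "e1 > 0" "\<And>w. chordal_dist (Some c) (Some w) < e1 \<Longrightarrow> cmod (w - c) < 1"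
      using chordal_small_Some[OF zero_less_one] by blast
    obtain e2 where e2: "e2 > 0" "\<And>w. chordal_dist None (Some w) < e2 \<Longrightarrow> cmod c + 1 < cmod w"
      using chordal_small_None by blast
    have False
    proof (rule far[of "min e1 e2"])
      fix w assume w: "chordal_dist b (Some w) < min e1 e2" "chordal_dist a (Some w) < min e1 e2"
      then have "cmod (w - c) < 1" "cmod c + 1 < cmod w" using e1(2)[of w] e2(2)[of w] cd by auto
      then show False using norm_triangle_ineq2[of w c] by linarith
    qed (use e1 e2 in auto)
    then show ?thesis ..
  qed (use ne in auto)
qed

text \<open>The tail is connected and mapped near \<open>a\<close>, hence it lies in a single component, which must be
  \<open>D \<epsilon>\<close>.\<close>

lemma tail_in_D:
  assumes \<Gamma>: "asymptotic_curve f a \<Gamma>" "meets \<Gamma>" and "\<epsilon> > 0"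
  obtains \<tau> where "0 \<le> \<tau>" "\<tau> < 1" "\<Gamma> ` {\<tau>..<1} \<subseteq> D \<epsilon>"
proof -
  have bp: "boundary_path \<Gamma>" and lim: "((\<lambda>t. chordal_dist a (Some (f (\<Gamma> t)))) \<longlongrightarrow> 0) (at_left 1)"
    using \<Gamma> by (auto simp: asymptotic_curve_def)
  have "\<forall>\<^sub>F t in at_left 1. chordal_dist a (Some (f (\<Gamma> t))) < \<epsilon>" by (rule order_tendstoD(2)[OF lim assms(3)])
  then have "\<exists>\<tau><1. \<forall>t>\<tau>. t < 1 \<longrightarrow> chordal_dist a (Some (f (\<Gamma> t))) < \<epsilon>"
    by (simp only: eventually_at_left_field)
  then obtain \<tau> where \<tau>: "\<tau> < 1" "\<forall>t>\<tau>. t < 1 \<longrightarrow> chordal_dist a (Some (f (\<Gamma> t))) < \<epsilon>"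
    by (elim exE conjE)
  have "\<exists>t. 0 \<le> t \<and> \<tau> < t \<and> t < 1 \<and> \<Gamma> t \<in> D \<epsilon>"
    by (rule meets_late[OF bp \<Gamma>(2) \<tau>(1) assms(3)])
  then obtain t where t: "0 \<le> t" "\<tau> < t" "t < 1" "\<Gamma> t \<in> D \<epsilon>" by (elim exE conjE)
  have "\<Gamma> ` {t..<1} \<subseteq> D \<epsilon>"
  proof (rule D_maximal[OF assms(3)])
    have "continuous_on {0..<1} \<Gamma>" using bp unfolding boundary_path_def by blast
    then have "continuous_on {t..<1} \<Gamma>" by (rule continuous_on_subset) (use t(1) in auto)
    then show "connected (\<Gamma> ` {t..<1})" by (rule connected_continuous_image) simp
    show "\<Gamma> ` {t..<1} \<subseteq> unit_disc"
    proof (rule image_subsetI)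
      fix s assume "s \<in> {t..<1}"
      then show "\<Gamma> s \<in> unit_disc" using t(1) by (intro boundary_path_in_disc[OF bp]) auto
    qed
    fix z assume "z \<in> \<Gamma> ` {t..<1}"
    then obtain s where s: "t \<le> s" "s < 1" "z = \<Gamma> s" by auto
    show "chordal_dist a (Some (f z)) < \<epsilon>" unfolding s(3) by (rule \<tau>(2)[rule_format]) (use s t(2) in linarith)+
  next
    have "\<Gamma> t \<in> \<Gamma> ` {t..<1}" using t(3) by (intro imageI) simp
    then show "\<Gamma> ` {t..<1} \<inter> D \<epsilon> \<noteq> {}" using t(4) by blast
  qed
  then show ?thesis by (rule that[OF t(1,3)])
qed

text \<open>The two curves, joined inside the disc, form a crosscut with points of the end of the tract on either
  side. A tract set that is small enough to miss the joining segment has to cross one of the curves.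
  Nothing better can be said about a single curve: if the end is the whole circle, the tract may be
  slit along it.\<close>

lemma one_of_two_curves_meets:
  assumes \<Gamma>: "boundary_path \<Gamma>1" "path_end \<Gamma>1 = {cis x}" "boundary_path \<Gamma>2" "path_end \<Gamma>2 = {cis y}"
    and K: "tract_end D = cis ` {\<alpha>..\<beta>}" "\<beta> \<le> \<alpha> + 2 * pi" "\<alpha> < x" "x < y" "y < \<beta>"
  shows "meets \<Gamma>1 \<or> meets \<Gamma>2"
proof (rule ccontr)
  assume "\<not> ?thesis"
  then obtain e1 e2 where e: "e1 > 0" "\<Gamma>1 ` {0..<1} \<inter> D e1 = {}" "e2 > 0" "\<Gamma>2 ` {0..<1} \<inter> D e2 = {}"
    unfolding meets_def by blast
  define c1 where "c1 t = (if t < 1 then \<Gamma>1 t else cis x)" for t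
  define c2 where "c2 t = (if t < 1 then \<Gamma>2 t else cis y)" for t
  have pc: "path c1" "path c2"
    unfolding c1_def c2_def
    by (intro path_with_endpoint boundary_path_tendsto_end \<Gamma>; use \<Gamma> in \<open>simp add: boundary_path_def\<close>)+
  have disc: "\<Gamma>1 t \<in> unit_disc" "\<Gamma>2 t \<in> unit_disc" if "0 \<le> t" "t < 1" for t
    using \<Gamma>(1,3)[THEN boundary_path_in_disc] that by blast+
  define L where "L = linepath (c1 0) (c2 0)"
  have L: "path_image L \<subseteq> unit_disc"
    unfolding L_def path_image_linepath
    by (rule closed_segment_subset) (use disc[of 0] in \<open>auto simp: c1_def c2_def\<close>)
  have "compact (path_image L)" "path_image L \<noteq> {}" by (auto simp: L_def)
  then obtain m where m: "m \<in> path_image L" "\<And>z. z \<in> path_image L \<Longrightarrow> cmod z \<le> cmod m"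
    using continuous_attains_sup[of "path_image L" cmod] continuous_on_norm_id by blast
  then have "cmod m < 1" using L by (meson mem_ball_0 subsetD)
  then obtain e3 where e3: "e3 > 0" "\<And>\<epsilon> z. 0 < \<epsilon> \<Longrightarrow> \<epsilon> \<le> e3 \<Longrightarrow> z \<in> D \<epsilon> \<Longrightarrow> cmod m < cmod z"
    using D_leaves_disc by blast
  define \<epsilon> where "\<epsilon> = min e1 (min e2 e3)"
  have \<epsilon>: "\<epsilon> > 0" using e e3 by (simp add: \<epsilon>_def)
  have sub: "D \<epsilon> \<subseteq> D e1" "D \<epsilon> \<subseteq> D e2" using \<epsilon> by (intro D_mono; simp add: \<epsilon>_def)+
  define J where "J = reversepath c1 +++ L +++ c2"
  have c01: "c1 0 = \<Gamma>1 0" "c2 0 = \<Gamma>2 0" "c1 1 = cis x" "c2 1 = cis y" by (auto simp: c1_def c2_def)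
  have imc: "c1 ` {0..1} \<subseteq> \<Gamma>1 ` {0..<1} \<union> {cis x}" "c2 ` {0..1} \<subseteq> \<Gamma>2 ` {0..<1} \<union> {cis y}"
    by (auto simp: c1_def c2_def)
  have imJ: "path_image J \<subseteq> c1 ` {0..1} \<union> (path_image L \<union> c2 ` {0..1})"
    using path_image_join_subset[of "reversepath c1" "L +++ c2"] path_image_join_subset[of L c2]
    unfolding J_def path_image_reversepath by (auto simp: path_image_def)
  have arcs: "cis t \<in> closure (D \<epsilon>)" if "\<alpha> \<le> t" "t \<le> \<beta>" for t
  proof -
    have "cis t \<in> tract_end D" unfolding K(1) using that by simp
    then show ?thesis using \<epsilon> unfolding tract_end_def by blast
  qed
  show False
  proof (rule crosscut_separates[of J x y "D \<epsilon>" "(x + y) / 2" "(\<alpha> + x) / 2"])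
    have "pathstart c1 = c1 0" "pathstart c2 = c2 0" "pathfinish c1 = cis x" "pathfinish c2 = cis y"
      by (simp_all add: pathstart_def pathfinish_def c01)
    then show "path J" "pathstart J = cis x" "pathfinish J = cis y"
      using pc by (simp_all add: J_def L_def)
    show "J ` {0<..<1} \<subseteq> unit_disc"
    proof
      fix z assume "z \<in> J ` {0<..<1}"
      then obtain t where t: "0 < t" "t < 1" "z = J t" by auto
      consider "t \<le> 1/2" | "1/2 < t" "2 * t - 1 \<le> 1/2" | "1/2 < 2 * t - 1" by linarith
      then show "z \<in> unit_disc"
      proof cases
        case 1
        then have "z = \<Gamma>1 (1 - 2 * t)" using t by (simp add: J_def joinpaths_def reversepath_def c1_def)
        then show ?thesis using disc[of "1 - 2 * t"] 1 t by simp
      next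
        case 2
        then have "z = L (2 * (2 * t - 1))" using t by (simp add: J_def joinpaths_def)
        moreover have "L (2 * (2 * t - 1)) \<in> path_image L"
          unfolding path_image_def by (rule imageI) (use 2 in simp)
        ultimately show ?thesis using L by blast
      next
        case 3
        then have "z = \<Gamma>2 (2 * (2 * t - 1) - 1)" using t by (simp add: J_def joinpaths_def c2_def)
        then show ?thesis using disc[of "2 * (2 * t - 1) - 1"] 3 t by simp
      qed
    qed
    show "connected (D \<epsilon>)" by (rule D_connected[OF \<epsilon>])
    show "D \<epsilon> \<subseteq> unit_disc" using D_subset[OF \<epsilon>] by blast
    show "D \<epsilon> \<inter> path_image J = {}"
    proof -
      have offL: "z \<notin> path_image L" if "z \<in> D \<epsilon>" for z
      proof -
        have "\<epsilon> \<le> e3" by (simp add: \<epsilon>_def)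
        then have "cmod m < cmod z" using e3(2)[OF \<epsilon> _ that] by blast
        then show ?thesis using m(2)[of z] by linarith
      qed
      have notin: "cis t \<notin> D \<epsilon>" for t
      proof
        assume "cis t \<in> D \<epsilon>"
        then have "cis t \<in> unit_disc" using D_subset[OF \<epsilon>] by blast
        then show False by simp
      qed
      have off: "z \<notin> \<Gamma>1 ` {0..<1}" "z \<notin> \<Gamma>2 ` {0..<1}" "z \<noteq> cis x" "z \<noteq> cis y" if z: "z \<in> D \<epsilon>" for z
      proof -
        have "z \<in> D e1" "z \<in> D e2" by (rule subsetD[OF sub(1) z], rule subsetD[OF sub(2) z])
        then show "z \<notin> \<Gamma>1 ` {0..<1}" "z \<notin> \<Gamma>2 ` {0..<1}" using e(2,4) by (simp_all only: disjoint_iff) blast+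
        show "z \<noteq> cis x" "z \<noteq> cis y" using z notin by blast+
      qed
      show ?thesis
      proof (rule ccontr)
        assume "D \<epsilon> \<inter> path_image J \<noteq> {}"
        then obtain z where z: "z \<in> D \<epsilon>" "z \<in> path_image J" by blast
        from subsetD[OF imJ z(2)] consider "z \<in> c1 ` {0..1}" | "z \<in> path_image L" | "z \<in> c2 ` {0..1}" by (elim UnE)
        then show False
        proof cases
          case 1 then show ?thesis using off(1,3)[OF z(1)] subsetD[OF imc(1), of z] by simp
        next
          case 2 then show ?thesis using offL[OF z(1)] by simp
        next
          case 3 then show ?thesis using off(2,4)[OF z(1)] subsetD[OF imc(2), of z] by simp
        qed
      qed
    qed
    have le: "\<alpha> \<le> (x + y) / 2" "(x + y) / 2 \<le> \<beta>" "\<alpha> \<le> (\<alpha> + x) / 2" "(\<alpha> + x) / 2 \<le> \<beta>"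
      using K(3-5) by (auto simp: field_simps)
    show "cis ((x + y) / 2) \<in> closure (D \<epsilon>)" by (rule arcs[OF le(1,2)])
    show "cis ((\<alpha> + x) / 2) \<in> closure (D \<epsilon>)" by (rule arcs[OF le(3,4)])
    show "x < y" "y < x + 2 * pi" "x < (x + y) / 2" "(x + y) / 2 < y" "y - 2 * pi < (\<alpha> + x) / 2" "(\<alpha> + x) / 2 < x"
      using K(2-5) by (auto simp: field_simps)
  qed
qed

text \<open>Among three curves at most one can fail to meet all sets of the tract.\<close>

lemma two_meeting_curves:
  assumes S: "dense_in_circle S" "\<And>\<zeta>. \<zeta> \<in> S \<Longrightarrow> \<exists>\<Gamma>. boundary_path \<Gamma> \<and> path_end \<Gamma> = {\<zeta>} \<and> P \<Gamma>"
    and K: "circle_arc (tract_end D)"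
  obtains \<Gamma>1 \<Gamma>2 \<zeta>1 \<zeta>2 where "P \<Gamma>1" "P \<Gamma>2" "boundary_path \<Gamma>1" "boundary_path \<Gamma>2"
    "path_end \<Gamma>1 = {\<zeta>1}" "path_end \<Gamma>2 = {\<zeta>2}" "\<zeta>1 \<noteq> \<zeta>2" "meets \<Gamma>1" "meets \<Gamma>2"
proof -
  obtain \<alpha> \<beta> where ab: "\<alpha> < \<beta>" "\<beta> \<le> \<alpha> + 2 * pi" "tract_end D = cis ` {\<alpha>..\<beta>}"
    using K unfolding circle_arc_def by blast
  obtain x where x: "\<alpha> < x" "x < \<beta>" "cis x \<in> S" using dense_in_circle_meets_arc[OF S(1) ab(1)] .
  obtain y where y: "x < y" "y < \<beta>" "cis y \<in> S" using dense_in_circle_meets_arc[OF S(1) x(2)] .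
  obtain z where z: "y < z" "z < \<beta>" "cis z \<in> S" using dense_in_circle_meets_arc[OF S(1) y(2)] .
  obtain X where X: "boundary_path X" "path_end X = {cis x}" "P X" using S(2)[OF x(3)] by blast
  obtain Y where Y: "boundary_path Y" "path_end Y = {cis y}" "P Y" using S(2)[OF y(3)] by blast
  obtain Z where Z: "boundary_path Z" "path_end Z = {cis z}" "P Z" using S(2)[OF z(3)] by blast
  have ne: "cis x \<noteq> cis y" "cis y \<noteq> cis z" "cis x \<noteq> cis z"
    using cis_eq_imp_eq[of x y] cis_eq_imp_eq[of y z] cis_eq_imp_eq[of x z] ab(1,2) x(1,2) y(1,2) z(1,2) by linarith+
  have "meets X \<or> meets Y"
    by (rule one_of_two_curves_meets[OF X(1,2) Y(1,2) ab(3,2)]) (fact x y)+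
  moreover have "meets Y \<or> meets Z"
    by (rule one_of_two_curves_meets[OF Y(1,2) Z(1,2) ab(3,2)]) (use x y z in linarith)+
  moreover have "meets X \<or> meets Z"
    by (rule one_of_two_curves_meets[OF X(1,2) Z(1,2) ab(3,2)]) (use x y z in linarith)+
  ultimately consider "meets X" "meets Y" | "meets Y" "meets Z" | "meets X" "meets Z" by blast
  then show ?thesis
  proof cases
    case 1 then show ?thesis by (rule that[OF X(3) Y(3) X(1) Y(1) X(2) Y(2) ne(1)])
  next
    case 2 then show ?thesis by (rule that[OF Y(3) Z(3) Y(1) Z(1) Y(2) Z(2) ne(2)])
  next
    case 3 then show ?thesis by (rule that[OF X(3) Z(3) X(1) Z(1) X(2) Z(2) ne(3)])
  qed
qed

end

section \<open>Consequences of Koebe's lemma for tracts\<close>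

lemma curve_eventually_beyond:
  fixes g :: "real \<Rightarrow> real"
  assumes "filterlim g at_top (at_left 1)"
  shows "\<exists>t. 0 \<le> t \<and> t < 1 \<and> (\<forall>s. t \<le> s \<longrightarrow> s < 1 \<longrightarrow> B \<le> g s)"
proof -
  have "\<forall>\<^sub>F s in at_left 1. B \<le> g s" using assms by (simp only: filterlim_at_top)
  then have "\<exists>\<tau><1. \<forall>s>\<tau>. s < 1 \<longrightarrow> B \<le> g s" by (simp only: eventually_at_left_field)
  then obtain \<tau> where \<tau>: "\<tau> < 1" "\<forall>s>\<tau>. s < 1 \<longrightarrow> B \<le> g s" by (elim exE conjE)
  show ?thesis
  proof (intro exI[of _ "max 0 ((\<tau> + 1) / 2)"] conjI allI impI)
    fix s assume "max 0 ((\<tau> + 1) / 2) \<le> s" "s < 1"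
    then show "B \<le> g s" using \<tau> by (intro \<tau>(2)[rule_format]) (auto simp: field_simps)
  qed (use \<tau> in \<open>auto simp: field_simps\<close>)
qed

lemma near_circle_at_left:
  fixes g :: "real \<Rightarrow> complex"
  assumes "((\<lambda>t. cmod (g t)) \<longlongrightarrow> 1) (at_left 1)" "\<rho> < 1"
  shows "\<exists>\<tau><1. \<forall>s>\<tau>. s < 1 \<longrightarrow> \<rho> < cmod (g s)"
proof -
  have "\<forall>\<^sub>F s in at_left 1. \<rho> < cmod (g s)" by (rule order_tendstoD(1)[OF assms])
  then show ?thesis by (simp only: eventually_at_left_field)
qed

lemma bounded_of_convergent_at_left:
  fixes g :: "real \<Rightarrow> complex"
  assumes "continuous_on {0..<1} g" "(g \<longlongrightarrow> l) (at_left 1)"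
  shows "\<exists>M. \<forall>t. 0 \<le> t \<longrightarrow> t < 1 \<longrightarrow> cmod (g t) \<le> M"
proof -
  let ?c = "\<lambda>t. if t < 1 then g t else l"
  have "bounded (path_image ?c)" by (rule bounded_path_image[OF path_with_endpoint[OF assms]])
  then obtain M where M: "\<forall>z\<in>path_image ?c. cmod z \<le> M" by (auto simp: bounded_iff)
  have "cmod (g t) \<le> M" if "0 \<le> t" "t < 1" for t
  proof -
    have "?c t \<in> path_image ?c" unfolding path_image_def by (rule imageI) (use that in simp)
    then show ?thesis using M that by auto
  qed
  then show ?thesis by blast
qed

context holomorphic_tract begin

text \<open>Both curves have the asymptotic value \<open>a\<close>. If it were finite, then Koebe's lemma, applied to
  \<open>f - a\<close> with cross paths in ever smaller sets of the tract, would make \<open>f\<close> constant.\<close>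

lemma tract_value_not_finite:
  assumes \<Gamma>: "asymptotic_curve f a \<Gamma>1" "asymptotic_curve f a \<Gamma>2"
    and ends: "path_end \<Gamma>1 = {\<zeta>1}" "path_end \<Gamma>2 = {\<zeta>2}" "\<zeta>1 \<noteq> \<zeta>2"
    and meets: "meets \<Gamma>1" "meets \<Gamma>2" and nc: "\<not> f constant_on unit_disc"
  shows "a = None"
proof (rule ccontr)
  assume "a \<noteq> None"
  then obtain c where a: "a = Some c" by blast
  have bp: "boundary_path \<Gamma>1" "boundary_path \<Gamma>2" using \<Gamma> by (auto simp: asymptotic_curve_def)
  have cont: "continuous_on {0..<1} \<Gamma>1" "continuous_on {0..<1} \<Gamma>2" using bp unfolding boundary_path_def by blast+
  have lim1: "((\<lambda>t. cmod (\<Gamma>1 t)) \<longlongrightarrow> 1) (at_left 1)" "((\<lambda>t. cmod (\<Gamma>2 t)) \<longlongrightarrow> 1) (at_left 1)"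
    using bp unfolding boundary_path_def by blast+
  define c1 where "c1 t = (if t < 1 then \<Gamma>1 t else \<zeta>1)" for t
  define c2 where "c2 t = (if t < 1 then \<Gamma>2 t else \<zeta>2)" for t
  have pc: "path c1" "path c2"
    unfolding c1_def c2_def
    by (rule path_with_endpoint[OF cont(1) boundary_path_tendsto_end(2)[OF bp(1) ends(1)]])
       (rule path_with_endpoint[OF cont(2) boundary_path_tendsto_end(2)[OF bp(2) ends(2)]])
  have ci: "c1 ` {0..<1} = \<Gamma>1 ` {0..<1}" "c2 ` {0..<1} = \<Gamma>2 ` {0..<1}" by (auto simp: c1_def c2_def)
  have disc: "\<Gamma>1 ` {0..<1} \<subseteq> unit_disc" "\<Gamma>2 ` {0..<1} \<subseteq> unit_disc"
    using bp unfolding boundary_path_def by blast+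
  define h where "h z = f z - c" for z
  have "\<exists>d>0. d \<le> 1 / Suc n \<and> (\<forall>w. chordal_dist (Some c) (Some w) < d \<longrightarrow> cmod (w - c) < 1 / Suc n)" for n :: nat
  proof -
    have "1 / real (Suc n) > 0" by simp
    from chordal_small_Some[OF this, of c]
    obtain d where d: "d > 0" "\<forall>w. chordal_dist (Some c) (Some w) < d \<longrightarrow> cmod (w - c) < 1 / Suc n" by (elim exE conjE)
    show ?thesis
      by (intro exI[of _ "min d (1 / Suc n)"] conjI allI impI d(2)[rule_format]) (use d(1) in simp_all)
  qed
  then obtain d where "\<forall>n. d n > 0 \<and> d n \<le> 1 / real (Suc n) \<and>
      (\<forall>w. chordal_dist (Some c) (Some w) < d n \<longrightarrow> cmod (w - c) < 1 / real (Suc n))" by metis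
  then have d: "d n > 0" "d n \<le> 1 / real (Suc n)"
     "chordal_dist (Some c) (Some w) < d n \<Longrightarrow> cmod (w - c) < 1 / real (Suc n)" for n w by blast+
  have less1: "1 - 1 / real (Suc n) < 1" for n by simp
  have "\<exists>t. 0 \<le> t \<and> 1 - 1 / real (Suc n) < t \<and> t < 1 \<and> \<Gamma>1 t \<in> D (d n)" for n
    by (rule meets_late[OF bp(1) meets(1) less1 d(1)])
  then obtain t where t: "\<And>n. 0 \<le> t n \<and> 1 - 1 / real (Suc n) < t n \<and> t n < 1 \<and> \<Gamma>1 (t n) \<in> D (d n)" by metis
  have "\<exists>t. 0 \<le> t \<and> 1 - 1 / real (Suc n) < t \<and> t < 1 \<and> \<Gamma>2 t \<in> D (d n)" for n
    by (rule meets_late[OF bp(2) meets(2) less1 d(1)])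
  then obtain u where u: "\<And>n. 0 \<le> u n \<and> 1 - 1 / real (Suc n) < u n \<and> u n < 1 \<and> \<Gamma>2 (u n) \<in> D (d n)" by metis
  have "\<exists>g. path g \<and> path_image g \<subseteq> D (d n) \<and> pathstart g = \<Gamma>1 (t n) \<and> pathfinish g = \<Gamma>2 (u n)" for n
    using t[of n] u[of n] D_open[OF d(1)[of n]] D_connected[OF d(1)[of n]] connected_open_path_connected[of "D (d n)"]
    unfolding path_connected_def by blast
  then obtain \<alpha> where \<alpha>: "\<And>n. path (\<alpha> n) \<and> path_image (\<alpha> n) \<subseteq> D (d n) \<and> pathstart (\<alpha> n) = \<Gamma>1 (t n) \<and> pathfinish (\<alpha> n) = \<Gamma>2 (u n)"
    by metis
  define b where "b = linepath (c1 0) (c2 0)"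
  have c0: "c1 0 \<in> unit_disc" "c2 0 \<in> unit_disc"
    using disc by (auto simp: c1_def c2_def image_subset_iff simp del: mem_ball_0)
  have bim: "path_image b \<subseteq> unit_disc"
    unfolding b_def path_image_linepath by (rule closed_segment_subset[OF c0 convex_ball])
  have bound: "\<exists>M. \<forall>t. 0 \<le> t \<longrightarrow> t < 1 \<longrightarrow> cmod (h (\<Gamma> t)) \<le> M" if "asymptotic_curve f a \<Gamma>" for \<Gamma>
  proof (rule bounded_of_convergent_at_left)
    have "boundary_path \<Gamma>" "((\<lambda>t. f (\<Gamma> t)) \<longlongrightarrow> c) (at_left 1)"
      using that unfolding asymptotic_curve_def a tendsto_chordal_Some_iff by blast+
    then show "((\<lambda>t. h (\<Gamma> t)) \<longlongrightarrow> 0) (at_left 1)" unfolding h_def by (intro LIM_zero)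
    show "continuous_on {0..<1} (\<lambda>t. h (\<Gamma> t))" unfolding h_def
      using \<open>boundary_path \<Gamma>\<close> unfolding boundary_path_def
      by (intro continuous_intros continuous_on_compose2[OF contf]) blast+
  qed
  obtain M1 where M1: "\<forall>t. 0 \<le> t \<longrightarrow> t < 1 \<longrightarrow> cmod (h (\<Gamma>1 t)) \<le> M1" using bound[OF \<Gamma>(1)] by (elim exE)
  obtain M2 where M2: "\<forall>t. 0 \<le> t \<longrightarrow> t < 1 \<longrightarrow> cmod (h (\<Gamma>2 t)) \<le> M2" using bound[OF \<Gamma>(2)] by (elim exE)
  have ch: "continuous_on unit_disc h" unfolding h_def by (intro continuous_intros contf)
  have "compact (h ` path_image b)"
    by (intro compact_continuous_image continuous_on_subset[OF ch bim]) (simp add: b_def)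
  then obtain M3 where M3: "\<forall>z\<in>path_image b. cmod (h z) \<le> M3"
    using compact_imp_bounded[of "h ` path_image b"] unfolding bounded_iff by blast
  have beyond: "\<forall>\<^sub>F n in sequentially. \<tau> < t n \<and> \<tau> < u n" if "\<tau> < 1" for \<tau>
  proof -
    have "(\<lambda>n. 1 - inverse (real (Suc n))) \<longlonglongrightarrow> 1 - 0"
      by (intro tendsto_intros LIMSEQ_inverse_real_of_nat)
    then have "\<forall>\<^sub>F n in sequentially. \<tau> < 1 - inverse (real (Suc n))"
      by (rule order_tendstoD(1)) (use that in simp)
    then show ?thesis
    proof (rule eventually_mono)
      fix n assume "\<tau> < 1 - inverse (real (Suc n))"
      then show "\<tau> < t n \<and> \<tau> < u n" using t[of n] u[of n] by (simp add: inverse_eq_divide)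
    qed
  qed
  interpret K: koebe_curves unit_disc h c1 c2 b \<alpha> t u "\<lambda>n. inverse (real (Suc n))" "max M1 (max M2 M3)"
  proof
    show "h holomorphic_on unit_disc" unfolding h_def by (intro holomorphic_intros holf)
    show "path c1" "path c2" by fact+
    show "c1 ` {0..<1} \<subseteq> unit_disc" "c2 ` {0..<1} \<subseteq> unit_disc" using ci disc by simp_all
    show "cmod (c1 1) = 1" "cmod (c2 1) = 1"
      using boundary_path_tendsto_end(1)[OF bp(1) ends(1)] boundary_path_tendsto_end(1)[OF bp(2) ends(2)]
      by (simp_all add: c1_def c2_def)
    show "path b" "pathstart b = c1 0" "pathfinish b = c2 0" by (simp_all add: b_def)
    show "path_image b \<subseteq> unit_disc" by fact
    show "0 \<le> t n \<and> t n < 1" "0 \<le> u n \<and> u n < 1" for n using t[of n] u[of n] by blast+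
    show "path (\<alpha> n)" "pathstart (\<alpha> n) = c1 (t n)" "pathfinish (\<alpha> n) = c2 (u n)" for n
      using \<alpha>[of n] t[of n] u[of n] by (simp_all add: c1_def c2_def)
    show "path_image (\<alpha> n) \<subseteq> unit_disc" for n using \<alpha>[of n] D_subset[OF d(1)[of n]] by blast
    show "cmod (h z) \<le> max M1 (max M2 M3)" if z: "z \<in> c1 ` {0..<1} \<union> c2 ` {0..<1} \<union> path_image b" for z
    proof -
      consider s where "0 \<le> s" "s < 1" "z = \<Gamma>1 s" | s where "0 \<le> s" "s < 1" "z = \<Gamma>2 s" | "z \<in> path_image b"
        using z unfolding ci by fastforce
      then show ?thesis
      proof cases
        case 1 then show ?thesis using M1 by (simp add: le_max_iff_disj)
      next
        case 2 then show ?thesis using M2 by (simp add: le_max_iff_disj)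
      next
        case 3 then show ?thesis using M3 by (simp add: le_max_iff_disj)
      qed
    qed
    show "cmod (h z) \<le> inverse (real (Suc n))" if "z \<in> path_image (\<alpha> n)" for n z
    proof -
      have "z \<in> D (d n)" using that \<alpha>[of n] by blast
      then have "chordal_dist (Some c) (Some (f z)) < d n" using D_subset[OF d(1)[of n]] a by blast
      from d(3)[OF this] show ?thesis by (simp add: h_def inverse_eq_divide)
    qed
    show "(\<lambda>n. inverse (real (Suc n))) \<longlonglongrightarrow> 0" by (rule LIMSEQ_inverse_real_of_nat)
    fix \<rho> :: real assume \<rho>: "\<rho> < 1"
    obtain \<epsilon>0 where \<epsilon>0: "\<epsilon>0 > 0" "\<forall>\<epsilon> z. 0 < \<epsilon> \<longrightarrow> \<epsilon> \<le> \<epsilon>0 \<longrightarrow> z \<in> D \<epsilon> \<longrightarrow> \<rho> < cmod z"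
      using D_leaves_disc[OF \<rho>] by (elim exE conjE)
    obtain \<tau>1 where \<tau>1: "\<tau>1 < 1" "\<forall>s>\<tau>1. s < 1 \<longrightarrow> \<rho> < cmod (\<Gamma>1 s)"
      using near_circle_at_left[OF lim1(1) \<rho>] by (elim exE conjE)
    obtain \<tau>2 where \<tau>2: "\<tau>2 < 1" "\<forall>s>\<tau>2. s < 1 \<longrightarrow> \<rho> < cmod (\<Gamma>2 s)"
      using near_circle_at_left[OF lim1(2) \<rho>] by (elim exE conjE)
    have "\<forall>\<^sub>F n in sequentially. inverse (real (Suc n)) < \<epsilon>0"
      by (rule order_tendstoD(2)[OF LIMSEQ_inverse_real_of_nat \<epsilon>0(1)])
    with beyond[OF \<tau>1(1)] beyond[OF \<tau>2(1)]
    show "\<forall>\<^sub>F n in sequentially. \<forall>z \<in> path_image (\<alpha> n) \<union> c1 ` {t n..1} \<union> c2 ` {u n..1}. \<rho> < cmod z"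
    proof eventually_elim
      case (elim n)
      show ?case
      proof
        fix z assume "z \<in> path_image (\<alpha> n) \<union> c1 ` {t n..1} \<union> c2 ` {u n..1}"
        then consider "z \<in> path_image (\<alpha> n)" | s where "t n \<le> s" "s \<le> 1" "z = c1 s" | s where "u n \<le> s" "s \<le> 1" "z = c2 s"
          by fastforce
        then show "\<rho> < cmod z"
        proof cases
          case 1
          then have "z \<in> D (d n)" using \<alpha>[of n] by blast
          moreover have "d n \<le> \<epsilon>0" using d(2)[of n] elim(3) by (simp add: inverse_eq_divide)
          ultimately show ?thesis using \<epsilon>0(2) d(1)[of n] by blast
        next
          case 2
          show ?thesis
          proof (cases "s < 1")
            case True
            then show ?thesis using \<tau>1(2)[rule_format, of s] 2 elim by (simp add: c1_def)
          next
            case False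
            then show ?thesis using 2 \<rho> boundary_path_tendsto_end(1)[OF bp(1) ends(1)] by (simp add: c1_def)
          qed
        next
          case 3
          show ?thesis
          proof (cases "s < 1")
            case True
            then show ?thesis using \<tau>2(2)[rule_format, of s] 3 elim by (simp add: c2_def)
          next
            case False
            then show ?thesis using 3 \<rho> boundary_path_tendsto_end(1)[OF bp(2) ends(2)] by (simp add: c2_def)
          qed
        qed
      qed
    qed
  qed simp_all
  interpret K: koebe_arcs unit_disc h c1 c2 b \<alpha> t u "\<lambda>n. inverse (real (Suc n))" "max M1 (max M2 M3)"
    by unfold_locales (rule K.winding_circuit_outside_disc)
  obtain U where U: "open U" "U \<noteq> {}" "U \<subseteq> unit_disc" "\<forall>z\<in>U. h z = 0"
    using K.vanishes_on_open_set ends(3) by (auto simp: c1_def c2_def)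
  have "f z = c" if "z \<in> unit_disc" for z
  proof (rule analytic_continuation_open[OF U(1) open_ball U(2) _ U(3) holf holomorphic_on_const _ that])
    show "connected unit_disc" by simp
    show "f w = c" if "w \<in> U" for w using U(4) that by (simp add: h_def)
  qed
  then show False using nc unfolding constant_on_def by blast
qed

text \<open>Koebe's lemma for \<open>1 / f\<close>. Both ends of a segment in \<open>Q\<close> far to the right are joined inside a small
  tract set, so images of such segments serve as cross paths. The circuits are images of loops in the
  convex set \<open>Q\<close>; these are contractible, so the circuits wind only around points of the image of
  \<open>\<Phi>\<close>, where \<open>f\<close> has no zeros. The conclusion \<open>1 / f = 0\<close> is absurd.\<close>

lemma no_uniformised_pair_of_curves:
  fixes \<Phi> :: "complex \<Rightarrow> complex" and \<sigma>1 \<sigma>2 :: "real \<Rightarrow> complex"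
  assumes a: "a = None"
    and Q: "convex Q" "continuous_on Q \<Phi>" "\<Phi> ` Q \<subseteq> unit_disc" "\<And>q. q \<in> Q \<Longrightarrow> cmod (f (\<Phi> q)) = exp (Re q)"
      "\<And>q. q \<in> Q \<Longrightarrow> x0 \<le> Re q"
    and s1: "continuous_on {0..<1} \<sigma>1" "\<sigma>1 ` {0..<1} \<subseteq> Q" "filterlim (\<lambda>t. Re (\<sigma>1 t)) at_top (at_left 1)"
      "((\<lambda>t. \<Phi> (\<sigma>1 t)) \<longlongrightarrow> \<zeta>1) (at_left 1)" "cmod \<zeta>1 = 1"
    and s2: "continuous_on {0..<1} \<sigma>2" "\<sigma>2 ` {0..<1} \<subseteq> Q" "filterlim (\<lambda>t. Re (\<sigma>2 t)) at_top (at_left 1)"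
      "((\<lambda>t. \<Phi> (\<sigma>2 t)) \<longlongrightarrow> \<zeta>2) (at_left 1)" "cmod \<zeta>2 = 1"
    and ne: "\<zeta>1 \<noteq> \<zeta>2"
    and enter: "\<And>\<epsilon>. \<epsilon> > 0 \<Longrightarrow> \<forall>\<^sub>F t in at_left 1. \<Phi> (\<sigma>1 t) \<in> D \<epsilon>"
  shows False
proof -
  define G where "G = {z \<in> unit_disc. f z \<noteq> 0}"
  have oG: "open G"
  proof -
    have "open (unit_disc \<inter> f -` (- {0}))" by (rule continuous_open_preimage[OF contf]) auto
    then show ?thesis by (simp add: G_def vimage_def Int_def)
  qed
  have QG: "\<Phi> ` Q \<subseteq> G"
  proof (rule image_subsetI)
    fix q assume q: "q \<in> Q"
    have "cmod (f (\<Phi> q)) > 0" unfolding Q(4)[OF q] by simp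
    then have "f (\<Phi> q) \<noteq> 0" by auto
    then show "\<Phi> q \<in> G" unfolding G_def using Q(3) q by blast
  qed
  define h where "h z = 1 / f z" for z
  have hQ: "cmod (h (\<Phi> q)) = exp (- Re q)" if "q \<in> Q" for q
    using Q(4)[OF that] by (simp add: h_def norm_divide exp_minus inverse_eq_divide)
  define c1 where "c1 t = (if t < 1 then \<Phi> (\<sigma>1 t) else \<zeta>1)" for t
  define c2 where "c2 t = (if t < 1 then \<Phi> (\<sigma>2 t) else \<zeta>2)" for t
  have pc: "path c1" "path c2"
    unfolding c1_def c2_def
    by (rule path_with_endpoint[OF continuous_on_compose2[OF Q(2) s1(1,2)] s1(4)])
       (rule path_with_endpoint[OF continuous_on_compose2[OF Q(2) s2(1,2)] s2(4)])
  have far: "\<exists>X. \<forall>q\<in>Q. X \<le> Re q \<longrightarrow> \<Phi> q \<in> D \<epsilon>" if \<epsilon>: "\<epsilon> > 0" for \<epsilon>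
  proof -
    obtain B where B: "B > 0" "\<forall>w. B < cmod w \<longrightarrow> chordal_dist None (Some w) < \<epsilon>"
      using chordal_None_small_if_large[OF \<epsilon>] by (elim exE conjE)
    define X where "X = ln B + 1"
    define C where "C = \<Phi> ` (Q \<inter> {q. X \<le> Re q})"
    have "C \<subseteq> D \<epsilon>"
    proof (rule D_maximal[OF \<epsilon>])
      have "convex (Q \<inter> {q. X \<le> Re q})" using Q(1) convex_halfspace_Re_ge by (intro convex_Int)
      then show "connected C" unfolding C_def
        by (intro connected_continuous_image continuous_on_subset[OF Q(2)] convex_connected) auto
      show "C \<subseteq> unit_disc" unfolding C_def using Q(3) by blast
      show "chordal_dist a (Some (f z)) < \<epsilon>" if "z \<in> C" for z
      proof -
        obtain q where q: "q \<in> Q" "X \<le> Re q" "z = \<Phi> q" using \<open>z \<in> C\<close> unfolding C_def by blast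
        have "B < exp X" using B(1) by (simp add: X_def exp_add)
        also have "\<dots> \<le> cmod (f z)" unfolding q(3) Q(4)[OF q(1)] using q(2) by simp
        finally show ?thesis unfolding a using B(2) by blast
      qed
      have "\<forall>\<^sub>F t in at_left 1. X \<le> Re (\<sigma>1 t)" using s1(3) by (simp only: filterlim_at_top)
      moreover have "\<forall>\<^sub>F t in at_left (1::real). 0 < t \<and> t < 1"
        by (rule eventually_mono[OF eventually_at_left_real[of 0 1]]) auto
      ultimately have "\<forall>\<^sub>F t in at_left 1. X \<le> Re (\<sigma>1 t) \<and> (0 < t \<and> t < 1) \<and> \<Phi> (\<sigma>1 t) \<in> D \<epsilon>"
        using enter[OF \<epsilon>] by eventually_elim simp
      then obtain t where t: "X \<le> Re (\<sigma>1 t)" "0 < t" "t < 1" "\<Phi> (\<sigma>1 t) \<in> D \<epsilon>"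
        using eventually_happens[of _ "at_left (1::real)"] by auto
      have "\<sigma>1 t \<in> Q" using s1(2) t by (auto simp: image_subset_iff)
      then show "C \<inter> D \<epsilon> \<noteq> {}" unfolding C_def using t by blast
    qed
    then show ?thesis unfolding C_def by blast
  qed
  have "\<exists>X. real n \<le> X \<and> (\<forall>q\<in>Q. X \<le> Re q \<longrightarrow> \<Phi> q \<in> D (1 / real (Suc n)))" for n
  proof -
    have "1 / real (Suc n) > 0" by simp
    from far[OF this] obtain X where X: "\<forall>q\<in>Q. X \<le> Re q \<longrightarrow> \<Phi> q \<in> D (1 / real (Suc n))" by (elim exE)
    show ?thesis by (intro exI[of _ "max X (real n)"] conjI ballI impI X[rule_format]) simp_all
  qed
  then obtain X where X: "\<And>n. real n \<le> X n \<and> (\<forall>q\<in>Q. X n \<le> Re q \<longrightarrow> \<Phi> q \<in> D (1 / real (Suc n)))" by metis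
  have "\<exists>t. 0 \<le> t \<and> t < 1 \<and> (\<forall>s. t \<le> s \<longrightarrow> s < 1 \<longrightarrow> X n \<le> Re (\<sigma>1 s))" for n
    by (rule curve_eventually_beyond[OF s1(3)])
  then obtain t where t: "\<And>n. 0 \<le> t n \<and> t n < 1 \<and> (\<forall>s. t n \<le> s \<longrightarrow> s < 1 \<longrightarrow> X n \<le> Re (\<sigma>1 s))" by metis
  have "\<exists>t. 0 \<le> t \<and> t < 1 \<and> (\<forall>s. t \<le> s \<longrightarrow> s < 1 \<longrightarrow> X n \<le> Re (\<sigma>2 s))" for n
    by (rule curve_eventually_beyond[OF s2(3)])
  then obtain u where u: "\<And>n. 0 \<le> u n \<and> u n < 1 \<and> (\<forall>s. u n \<le> s \<longrightarrow> s < 1 \<longrightarrow> X n \<le> Re (\<sigma>2 s))" by metis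
  have in1: "\<sigma>1 s \<in> Q" if "0 \<le> s" "s < 1" for s using s1(2) that by (auto simp: image_subset_iff)
  have in2: "\<sigma>2 s \<in> Q" if "0 \<le> s" "s < 1" for s using s2(2) that by (auto simp: image_subset_iff)
  define seg where "seg n = linepath (\<sigma>1 (t n)) (\<sigma>2 (u n))" for n
  define \<alpha> where "\<alpha> n = \<Phi> \<circ> seg n" for n
  define \<beta> where "\<beta> = linepath (\<sigma>1 0) (\<sigma>2 0)"
  define b where "b = \<Phi> \<circ> \<beta>"
  have seg: "path_image (seg n) \<subseteq> Q \<inter> {q. X n \<le> Re q}" for n
    unfolding seg_def path_image_linepath
  proof (rule closed_segment_subset)
    show "convex (Q \<inter> {q. X n \<le> Re q})" using Q(1) convex_halfspace_Re_ge by (intro convex_Int)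
    show "\<sigma>1 (t n) \<in> Q \<inter> {q. X n \<le> Re q}" using in1[of "t n"] t[of n] by blast
    show "\<sigma>2 (u n) \<in> Q \<inter> {q. X n \<le> Re q}" using in2[of "u n"] u[of n] by blast
  qed
  have \<beta>: "path_image \<beta> \<subseteq> Q"
    unfolding \<beta>_def path_image_linepath
    by (rule closed_segment_subset[OF _ _ Q(1)]) (use in1[of 0] in2[of 0] in simp_all)
  have pcomp: "path (\<Phi> \<circ> p)" if "path p" "path_image p \<subseteq> Q" for p
    using path_continuous_image[OF that(1) continuous_on_subset[OF Q(2) that(2)]] .
  have imG: "path_image (\<Phi> \<circ> p) \<subseteq> G" if "path_image p \<subseteq> Q" for p
    using that QG unfolding path_image_compose by blast
  have segQ: "path_image (seg n) \<subseteq> Q" for n using seg[of n] by blast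
  have c1Q: "\<exists>q\<in>Q. z = \<Phi> q" if "z \<in> c1 ` {0..<1}" for z
    using that in1 by (auto simp: c1_def)
  have c2Q: "\<exists>q\<in>Q. z = \<Phi> q" if "z \<in> c2 ` {0..<1}" for z
    using that in2 by (auto simp: c2_def)
  have hle: "cmod (h (\<Phi> q)) \<le> exp (- x0)" if "q \<in> Q" for q
    unfolding hQ[OF that] using Q(5)[OF that] by simp
  interpret K: koebe_curves G h c1 c2 b \<alpha> t u "\<lambda>n. exp (- real n)" "exp (- x0)"
  proof
    show "open G" by fact
    show "G \<subseteq> unit_disc" by (auto simp: G_def)
    show "h holomorphic_on G" unfolding h_def
      by (intro holomorphic_intros holomorphic_on_subset[OF holf]) (auto simp: G_def)
    show "path c1" "path c2" by fact+
    show "c1 ` {0..<1} \<subseteq> G" "c2 ` {0..<1} \<subseteq> G" using c1Q c2Q QG by blast+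
    show "cmod (c1 1) = 1" "cmod (c2 1) = 1" using s1(5) s2(5) by (simp_all add: c1_def c2_def)
    show "path b" unfolding b_def by (rule pcomp[OF _ \<beta>]) (simp add: \<beta>_def)
    show "pathstart b = c1 0" "pathfinish b = c2 0"
      by (simp_all add: b_def \<beta>_def c1_def c2_def pathstart_compose pathfinish_compose)
    show "path_image b \<subseteq> G" unfolding b_def by (rule imG[OF \<beta>])
    show "0 \<le> t n \<and> t n < 1" "0 \<le> u n \<and> u n < 1" for n using t[of n] u[of n] by blast+
    show "path (\<alpha> n)" for n unfolding \<alpha>_def by (rule pcomp[OF _ segQ]) (simp add: seg_def)
    show "pathstart (\<alpha> n) = c1 (t n)" "pathfinish (\<alpha> n) = c2 (u n)" for n
      using t[of n] u[of n] by (simp_all add: \<alpha>_def seg_def c1_def c2_def pathstart_compose pathfinish_compose)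
    show "path_image (\<alpha> n) \<subseteq> G" for n unfolding \<alpha>_def by (rule imG[OF segQ])
    show "cmod (h z) \<le> exp (- x0)" if z: "z \<in> c1 ` {0..<1} \<union> c2 ` {0..<1} \<union> path_image b" for z
    proof -
      have "z \<in> \<Phi> ` Q" using z c1Q c2Q \<beta> unfolding b_def path_image_compose by blast
      then show ?thesis using hle by blast
    qed
    show "cmod (h z) \<le> exp (- real n)" if z: "z \<in> path_image (\<alpha> n)" for n z
    proof -
      obtain q where q: "q \<in> Q" "X n \<le> Re q" "z = \<Phi> q"
        using z seg[of n] unfolding \<alpha>_def path_image_compose by blast
      have "real n \<le> Re q" using X[of n] q(2) by linarith
      then show ?thesis unfolding q(3) hQ[OF q(1)] by simp
    qed
    show "(\<lambda>n. exp (- real n)) \<longlonglongrightarrow> 0"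
      by (rule filterlim_compose[OF exp_at_bot])
         (simp add: filterlim_uminus_at_bot filterlim_real_sequentially)
    fix \<rho> :: real assume \<rho>: "\<rho> < 1"
    obtain \<epsilon>0 where \<epsilon>0: "\<epsilon>0 > 0" "\<forall>\<epsilon> z. 0 < \<epsilon> \<longrightarrow> \<epsilon> \<le> \<epsilon>0 \<longrightarrow> z \<in> D \<epsilon> \<longrightarrow> \<rho> < cmod z"
      using D_leaves_disc[OF \<rho>] by (elim exE conjE)
    have "\<forall>\<^sub>F n in sequentially. inverse (real (Suc n)) < \<epsilon>0"
      by (rule order_tendstoD(2)[OF LIMSEQ_inverse_real_of_nat \<epsilon>0(1)])
    then show "\<forall>\<^sub>F n in sequentially. \<forall>z \<in> path_image (\<alpha> n) \<union> c1 ` {t n..1} \<union> c2 ` {u n..1}. \<rho> < cmod z"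
    proof (rule eventually_mono, intro ballI)
      fix n z assume n: "inverse (real (Suc n)) < \<epsilon>0"
      assume "z \<in> path_image (\<alpha> n) \<union> c1 ` {t n..1} \<union> c2 ` {u n..1}"
      then consider "z \<in> path_image (\<alpha> n)" | s where "t n \<le> s" "s \<le> 1" "z = c1 s" | s where "u n \<le> s" "s \<le> 1" "z = c2 s"
        by fastforce
      then have "cmod z = 1 \<or> (\<exists>q\<in>Q. X n \<le> Re q \<and> z = \<Phi> q)"
      proof cases
        case 1
        then show ?thesis using seg[of n] unfolding \<alpha>_def path_image_compose by blast
      next
        case 2
        show ?thesis
        proof (cases "s < 1")
          case True
          then have "\<sigma>1 s \<in> Q" "X n \<le> Re (\<sigma>1 s)" using 2(1) t[of n] in1[of s] by auto
          then show ?thesis using True 2(3) by (auto simp: c1_def)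
        qed (use 2 s1(5) in \<open>simp add: c1_def\<close>)
      next
        case 3
        show ?thesis
        proof (cases "s < 1")
          case True
          then have "\<sigma>2 s \<in> Q" "X n \<le> Re (\<sigma>2 s)" using 3(1) u[of n] in2[of s] by auto
          then show ?thesis using True 3(3) by (auto simp: c2_def)
        qed (use 3 s2(5) in \<open>simp add: c2_def\<close>)
      qed
      then show "\<rho> < cmod z"
      proof
        assume "\<exists>q\<in>Q. X n \<le> Re q \<and> z = \<Phi> q"
        then have "z \<in> D (1 / real (Suc n))" using X[of n] by blast
        moreover have "0 < 1 / real (Suc n)" "1 / real (Suc n) \<le> \<epsilon>0" using n by (simp_all add: inverse_eq_divide)
        ultimately show ?thesis using \<epsilon>0(2) by blast
      qed (use \<rho> in simp)
    qed
  qed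
  interpret K: koebe_arcs G h c1 c2 b \<alpha> t u "\<lambda>n. exp (- real n)" "exp (- x0)"
  proof
    fix n z assume z: "z \<notin> G"
    define lp where "lp = reversepath (subpath 0 (t n) \<sigma>1) +++ \<beta> +++ subpath 0 (u n) \<sigma>2 +++ reversepath (seg n)"
    have sub1: "{0..t n} \<subseteq> {0..<1}" and sub2: "{0..u n} \<subseteq> {0..<1}" using t[of n] u[of n] by auto
    have p1: "path (subpath 0 (t n) \<sigma>1)" "path_image (subpath 0 (t n) \<sigma>1) \<subseteq> Q"
    proof -
      have cs: "closed_segment 0 (t n) = {0..t n}" using t[of n] by (simp add: closed_segment_eq_real_ivl)
      have "continuous_on {0..t n} \<sigma>1" by (rule continuous_on_subset[OF s1(1) sub1])
      then show "path (subpath 0 (t n) \<sigma>1)"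
        unfolding path_def subpath_def
        by (rule continuous_on_compose2) (use t[of n] in \<open>auto intro!: continuous_intros simp: mult_left_le mult_left_le_one_le\<close>)
      show "path_image (subpath 0 (t n) \<sigma>1) \<subseteq> Q"
        unfolding path_image_subpath_gen cs using s1(2) sub1 by blast
    qed
    have p2: "path (subpath 0 (u n) \<sigma>2)" "path_image (subpath 0 (u n) \<sigma>2) \<subseteq> Q"
    proof -
      have cs: "closed_segment 0 (u n) = {0..u n}" using u[of n] by (simp add: closed_segment_eq_real_ivl)
      have "continuous_on {0..u n} \<sigma>2" by (rule continuous_on_subset[OF s2(1) sub2])
      then show "path (subpath 0 (u n) \<sigma>2)"
        unfolding path_def subpath_def
        by (rule continuous_on_compose2) (use u[of n] in \<open>auto intro!: continuous_intros simp: mult_left_le mult_left_le_one_le\<close>)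
      show "path_image (subpath 0 (u n) \<sigma>2) \<subseteq> Q"
        unfolding path_image_subpath_gen cs using s2(2) sub2 by blast
    qed
    have ss: "path (seg n)" "pathstart (seg n) = \<sigma>1 (t n)" "pathfinish (seg n) = \<sigma>2 (u n)"
      and bb: "path \<beta>" "pathstart \<beta> = \<sigma>1 0" "pathfinish \<beta> = \<sigma>2 0"
      by (simp_all add: seg_def \<beta>_def)
    have lp: "path lp" "path_image lp \<subseteq> Q" "pathfinish lp = pathstart lp"
      unfolding lp_def using p1 p2 \<beta> segQ[of n] by (simp_all add: path_image_join ss bb)
    have q0: "\<sigma>1 0 \<in> Q" by (rule in1) simp_all
    have "homotopic_loops Q lp (linepath (\<sigma>1 0) (\<sigma>1 0))"
      by (rule convex_imp_simply_connected[OF Q(1), unfolded simply_connected_eq_contractible_loop_any, rule_format])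
         (intro conjI lp q0)
    then have "homotopic_loops (- {z}) (\<Phi> \<circ> lp) (\<Phi> \<circ> linepath (\<sigma>1 0) (\<sigma>1 0))"
      by (rule homotopic_loops_continuous_image[OF _ Q(2)]) (use QG z in blast)
    then have "winding_number (\<Phi> \<circ> lp) z = winding_number (\<Phi> \<circ> linepath (\<sigma>1 0) (\<sigma>1 0)) z"
      by (rule winding_number_homotopic_loops)
    also have "\<dots> = 0"
    proof (rule winding_number_constI)
      show "\<Phi> (\<sigma>1 0) \<noteq> z" using q0 QG z by blast
    qed (simp add: linepath_refl)
    also have "winding_number (\<Phi> \<circ> lp) z = winding_number (K.circuit n) z"
    proof (rule winding_number_cong)
      fix x :: real assume x: "0 \<le> x" "x \<le> 1"
      have lt: "t n * y < 1" "u n * y < 1" if "0 \<le> y" "y \<le> 1" for y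
      proof -
        have "t n * y \<le> t n" "u n * y \<le> u n" using that t[of n] u[of n] by (simp_all add: mult_left_le)
        then show "t n * y < 1" "u n * y < 1" using t[of n] u[of n] by linarith+
      qed
      show "(\<Phi> \<circ> lp) x = K.circuit n x"
        unfolding K.circuit_def unfolding lp_def b_def \<alpha>_def path_compose_join path_compose_reversepath joinpaths_def
        using x lt[of "1 - 2 * x"] lt[of "2 * (2 * (2 * x - 1) - 1)"]
        by (simp add: reversepath_def subpath_def c1_def c2_def)
    qed
    finally show "winding_number (K.circuit n) z = 0" .
  qed
  obtain U where U: "U \<noteq> {}" "U \<subseteq> G" "\<forall>z\<in>U. h z = 0"
    using K.vanishes_on_open_set ne by (auto simp: c1_def c2_def)
  then obtain z where "z \<in> G" "h z = 0" by blast
  then show False by (simp add: h_def G_def)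
qed

end

section \<open>Bounded asymptotic values\<close>

lemma continuous_logarithm_from:
  fixes w :: "real \<Rightarrow> complex"
  assumes "convex S" "t0 \<in> S" "continuous_on S w" "\<And>t. t \<in> S \<Longrightarrow> w t \<noteq> 0" "exp s0 = w t0"
  obtains \<sigma> where "continuous_on S \<sigma>" "\<sigma> t0 = s0" "\<And>t. t \<in> S \<Longrightarrow> exp (\<sigma> t) = w t"
proof -
  obtain g where g: "continuous_on S g" "\<And>t. t \<in> S \<Longrightarrow> w t = exp (g t)"
    using continuous_logarithm_on_contractible[OF assms(3) convex_imp_contractible[OF assms(1)] assms(4)] by blast
  show ?thesis
  proof (rule that)
    show "continuous_on S (\<lambda>t. g t + (s0 - g t0))" by (intro continuous_intros g)
    show "exp (g t + (s0 - g t0)) = w t" if "t \<in> S" for t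
      using g(2)[OF that] g(2)[OF assms(2)] assms(5) by (simp add: exp_add exp_diff)
  qed simp
qed

context holomorphic_tract begin

lemma tail_of_meeting_curve:
  assumes a: "a = None" and \<Gamma>: "asymptotic_curve f None \<Gamma>" "path_end \<Gamma> = {\<zeta>}" "meets \<Gamma>" and d: "d > 0"
  shows "\<exists>c :: real \<Rightarrow> complex. continuous_on {0..<1} c \<and> c ` {0..<1} \<subseteq> D d \<and> (c \<longlongrightarrow> \<zeta>) (at_left 1) \<and> cmod \<zeta> = 1 \<and>
    filterlim (\<lambda>t. cmod (f (c t))) at_top (at_left 1) \<and> (\<forall>\<epsilon>>0. \<forall>\<^sub>F t in at_left 1. c t \<in> D \<epsilon>)"
proof -
  have bp: "boundary_path \<Gamma>" using \<Gamma> by (simp add: asymptotic_curve_def)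
  have asy: "asymptotic_curve f a \<Gamma>" using \<Gamma> a by simp
  obtain \<tau> where \<tau>: "0 \<le> \<tau>" "\<tau> < 1" "\<Gamma> ` {\<tau>..<1} \<subseteq> D d"
    by (rule tail_in_D[OF asy \<Gamma>(3) d])
  define s where "s t = \<tau> + (1 - \<tau>) * t" for t :: real
  have sran: "s t \<in> {\<tau>..<1}" if "t \<in> {0..<1}" for t
  proof -
    have "0 \<le> (1 - \<tau>) * t" using \<tau> that by simp
    moreover have "(1 - \<tau>) * t < (1 - \<tau>) * 1" using \<tau>(2) that by (intro mult_strict_left_mono) auto
    ultimately show ?thesis by (simp add: s_def)
  qed
  have slim: "filterlim s (at_left 1) (at_left 1)"
    unfolding filterlim_at
  proof
    have "\<forall>\<^sub>F t in at_left (1::real). 0 < t \<and> t < 1"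
      by (rule eventually_mono[OF eventually_at_left_real[of 0 1]]) auto
    then show "\<forall>\<^sub>F t in at_left 1. s t \<in> {..<1} \<and> s t \<noteq> 1"
    proof (rule eventually_mono)
      fix t :: real assume "0 < t \<and> t < 1"
      then show "s t \<in> {..<1} \<and> s t \<noteq> 1" using sran[of t] by simp
    qed
    have "(s \<longlongrightarrow> \<tau> + (1 - \<tau>) * 1) (at_left 1)" unfolding s_def by (intro tendsto_intros)
    then show "(s \<longlongrightarrow> 1) (at_left 1)" by simp
  qed
  show ?thesis
  proof (intro exI[of _ "\<lambda>t. \<Gamma> (s t)"] conjI allI impI)
    have "continuous_on {0..<1} \<Gamma>" using bp unfolding boundary_path_def by blast
    then show "continuous_on {0..<1} (\<lambda>t. \<Gamma> (s t))"
    proof (rule continuous_on_compose2)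
      show "continuous_on {0..<1} s" unfolding s_def by (intro continuous_intros)
      show "s ` {0..<1} \<subseteq> {0..<1}" using sran \<tau>(1) by fastforce
    qed
    show "(\<lambda>t. \<Gamma> (s t)) ` {0..<1} \<subseteq> D d" using sran \<tau>(3) by blast
    show "((\<lambda>t. \<Gamma> (s t)) \<longlongrightarrow> \<zeta>) (at_left 1)"
      by (rule filterlim_compose[OF boundary_path_tendsto_end(2)[OF bp \<Gamma>(2)] slim])
    show "cmod \<zeta> = 1" by (rule boundary_path_tendsto_end(1)[OF bp \<Gamma>(2)])
    have "filterlim (\<lambda>t. f (\<Gamma> t)) at_infinity (at_left 1)"
      using \<Gamma>(1) unfolding asymptotic_curve_def tendsto_chordal_None_iff by blast
    then have "filterlim (\<lambda>t. cmod (f (\<Gamma> t))) at_top (at_left 1)"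
      by (simp add: filterlim_at_infinity_conv_norm_at_top)
    from filterlim_compose[OF this slim]
    show "filterlim (\<lambda>t. cmod (f (\<Gamma> (s t)))) at_top (at_left 1)" .
    fix \<epsilon> :: real assume \<epsilon>: "\<epsilon> > 0"
    obtain \<tau>' where \<tau>': "0 \<le> \<tau>'" "\<tau>' < 1" "\<Gamma> ` {\<tau>'..<1} \<subseteq> D \<epsilon>"
      by (rule tail_in_D[OF asy \<Gamma>(3) \<epsilon>])
    have "\<forall>\<^sub>F t in at_left 1. \<Gamma> t \<in> D \<epsilon>"
      by (rule eventually_mono[OF eventually_at_left_real[OF \<tau>'(2)]]) (use \<tau>'(3) in auto)
    then show "\<forall>\<^sub>F t in at_left 1. \<Gamma> (s t) \<in> D \<epsilon>"
      using slim by (rule eventually_compose_filterlim)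
  qed
qed

end

text \<open>A lift that escapes in finite time is, after rescaling time, an asymptotic curve.\<close>

lemma (in regular_over) finite_asymptotic_value_of_escape:
  fixes \<psi> w :: "real \<Rightarrow> complex"
  assumes "T > 0" "lifts \<psi> w {0..<T}" "((\<lambda>t. cmod (\<psi> t)) \<longlongrightarrow> 1) (at_left T)" "continuous_on {0..T} w"
  shows "w T \<in> finite_asymptotic_values f"
proof -
  define \<Gamma> where "\<Gamma> t = \<psi> (T * t)" for t
  have slim: "filterlim (\<lambda>t. T * t) (at_left T) (at_left 1)"
    unfolding filterlim_at
  proof
    have "\<forall>\<^sub>F t in at_left (1::real). 0 < t \<and> t < 1"
      by (rule eventually_mono[OF eventually_at_left_real[of 0 1]]) auto
    then show "\<forall>\<^sub>F t in at_left 1. T * t \<in> {..<T} \<and> T * t \<noteq> T"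
      by (rule eventually_mono) (use assms(1) in auto)
    have "((\<lambda>t. T * t) \<longlongrightarrow> T * 1) (at_left 1)" by (intro tendsto_intros)
    then show "((\<lambda>t. T * t) \<longlongrightarrow> T) (at_left 1)" by simp
  qed
  have ran: "T * t \<in> {0..<T}" if "t \<in> {0..<1}" for t using that assms(1) by simp
  have \<psi>: "continuous_on {0..<T} \<psi>" "\<psi> ` {0..<T} \<subseteq> unit_disc" "\<forall>t\<in>{0..<T}. f (\<psi> t) = w t"
    using assms(2) unfolding lifts_def by blast+
  have "boundary_path \<Gamma>"
    unfolding boundary_path_def
  proof (intro conjI)
    show "continuous_on {0..<1} \<Gamma>" unfolding \<Gamma>_def
      by (rule continuous_on_compose2[OF \<psi>(1)]) (use ran in \<open>auto intro!: continuous_intros\<close>)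
    show "\<Gamma> ` {0..<1} \<subseteq> unit_disc" unfolding \<Gamma>_def using ran \<psi>(2) by blast
    show "((\<lambda>t. cmod (\<Gamma> t)) \<longlongrightarrow> 1) (at_left 1)" unfolding \<Gamma>_def
      by (rule filterlim_compose[OF assms(3) slim])
  qed
  moreover have "((\<lambda>t. f (\<Gamma> t)) \<longlongrightarrow> w T) (at_left 1)"
  proof (rule Lim_transform_eventually)
    have "(w \<longlongrightarrow> w T) (at_left T)"
    proof -
      have "(w \<longlongrightarrow> w T) (at T within {0..T})" using assms(1,4) by (simp add: continuous_on_def)
      then show ?thesis using assms(1) by (simp add: at_within_Icc_at_left)
    qed
    from filterlim_compose[OF this slim] show "((\<lambda>t. w (T * t)) \<longlongrightarrow> w T) (at_left 1)" .
    have "\<forall>\<^sub>F t in at_left (1::real). 0 < t \<and> t < 1"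
      by (rule eventually_mono[OF eventually_at_left_real[of 0 1]]) auto
    then show "\<forall>\<^sub>F t in at_left 1. w (T * t) = f (\<Gamma> t)"
    proof (rule eventually_mono)
      fix t :: real assume "0 < t \<and> t < 1"
      then show "w (T * t) = f (\<Gamma> t)" using ran[of t] \<psi>(3) by (simp add: \<Gamma>_def)
    qed
  qed
  ultimately show ?thesis
    unfolding finite_asymptotic_values_def asymptotic_value_def asymptotic_curve_def tendsto_chordal_Some_iff by blast
qed

lemma regular_over_large_values:
  assumes "f holomorphic_on unit_disc" "\<And>v. v \<in> critical_values f \<Longrightarrow> cmod v \<le> R"
  shows "regular_over f {w. R < cmod w}"
proof
  show "f holomorphic_on unit_disc" by fact
  fix z assume "z \<in> unit_disc" "f z \<in> {w. R < cmod w}"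
  then show "deriv f z \<noteq> 0" using assms(2)[of "f z"] by (fastforce simp: critical_values_def)
qed

text \<open>Choose \<open>R\<close> above all critical values and all finite asymptotic values. Then no lift of a path in
  \<open>R < cmod w\<close> escapes in finite time, and lifting \<open>exp\<close> along the segments that start at \<open>s0\<close> defines
  \<open>\<Phi>\<close> with \<open>f (\<Phi> q) = exp q\<close> on a whole half-plane. The two curves and a path in the tract between
  them are the \<open>\<Phi>\<close>-images of logarithms of their \<open>f\<close>-images.\<close>

lemma (in holomorphic_tract) bounded_asymptotic_values_contradiction:
  assumes a: "a = None" and \<Gamma>: "asymptotic_curve f None \<Gamma>1" "asymptotic_curve f None \<Gamma>2"
    and ends: "path_end \<Gamma>1 = {\<zeta>1}" "path_end \<Gamma>2 = {\<zeta>2}" "\<zeta>1 \<noteq> \<zeta>2"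
    and meets: "meets \<Gamma>1" "meets \<Gamma>2"
    and CV: "bounded (critical_values f)" and AV: "bounded (finite_asymptotic_values f)"
  shows False
proof -
  obtain R1 where R1: "\<And>v. v \<in> critical_values f \<Longrightarrow> cmod v \<le> R1" using CV unfolding bounded_iff by blast
  obtain R2 where R2: "\<And>v. v \<in> finite_asymptotic_values f \<Longrightarrow> cmod v \<le> R2" using AV unfolding bounded_iff by blast
  define R where "R = max 1 (max R1 R2)"
  have R: "R > 0" "\<And>v. v \<in> critical_values f \<Longrightarrow> cmod v \<le> R" "\<And>v. v \<in> finite_asymptotic_values f \<Longrightarrow> cmod v \<le> R"
    using R1 R2 by (auto simp: R_def le_max_iff_disj)
  interpret regular_over f "{w. R < cmod w}" by (rule regular_over_large_values[OF holf R(2)])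
  define x where "x = ln R + 1"
  have x: "R < exp x" using R(1) by (simp add: x_def exp_add)
  obtain d where d: "d > 0" "\<forall>w. chordal_dist None (Some w) < d \<longrightarrow> exp x < cmod w"
    using chordal_small_None by blast
  have Dd: "z \<in> unit_disc" "exp x < cmod (f z)" if "z \<in> D d" for z
    using D_subset[OF d(1) that] d(2) a by blast+
  obtain c1 :: "real \<Rightarrow> complex" where c1: "continuous_on {0..<1} c1" "c1 ` {0..<1} \<subseteq> D d" "(c1 \<longlongrightarrow> \<zeta>1) (at_left 1)" "cmod \<zeta>1 = 1"
    "filterlim (\<lambda>t. cmod (f (c1 t))) at_top (at_left 1)" "\<forall>\<epsilon>>0. \<forall>\<^sub>F t in at_left 1. c1 t \<in> D \<epsilon>"
    using tail_of_meeting_curve[OF a \<Gamma>(1) ends(1) meets(1) d(1)] by (elim exE conjE)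
  obtain c2 :: "real \<Rightarrow> complex" where c2: "continuous_on {0..<1} c2" "c2 ` {0..<1} \<subseteq> D d" "(c2 \<longlongrightarrow> \<zeta>2) (at_left 1)" "cmod \<zeta>2 = 1"
    "filterlim (\<lambda>t. cmod (f (c2 t))) at_top (at_left 1)" "\<forall>\<epsilon>>0. \<forall>\<^sub>F t in at_left 1. c2 t \<in> D \<epsilon>"
    using tail_of_meeting_curve[OF a \<Gamma>(2) ends(2) meets(2) d(1)] by (elim exE conjE)
  have c10: "c1 0 \<in> D d" and c20: "c2 0 \<in> D d" using c1(2) c2(2) by (auto simp: image_subset_iff)
  obtain p where p: "path p" "path_image p \<subseteq> D d" "pathstart p = c1 0" "pathfinish p = c2 0"
    by (rule D_joins[OF d(1) c10 c20])
  define Q where "Q = {q. x \<le> Re q}"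
  define s0 where "s0 = Ln (f (c1 0))"
  have nz: "f z \<noteq> 0" if "z \<in> D d" for z
  proof -
    have "0 < exp x" by simp
    also have "\<dots> < cmod (f z)" by (rule Dd(2)[OF that])
    finally show ?thesis by auto
  qed
  have s0: "exp s0 = f (c1 0)" using nz[OF c10] by (simp add: s0_def)
  have Re_in_Q: "s \<in> Q" "Re s = ln (cmod (f z))" if "exp s = f z" "z \<in> D d" for s z
  proof -
    have e: "exp (Re s) = cmod (f z)" using that(1) norm_exp_eq_Re[of s] by simp
    then have "exp x < exp (Re s)" using Dd(2)[OF that(2)] by simp
    then show "s \<in> Q" by (simp add: Q_def)
    show "Re s = ln (cmod (f z))" unfolding e[symmetric] by simp
  qed
  have cQ: "convex Q" unfolding Q_def by (rule convex_halfspace_Re_ge)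
  have s0Q: "s0 \<in> Q" by (rule Re_in_Q(1)[OF s0 c10])
  define w where "w = (\<lambda>(q, t). exp (s0 + of_real t * (q - s0)))"
  have wQ: "w (q, t) \<in> {w. R < cmod w}" if "q \<in> Q" "0 \<le> t" "t \<le> 1" for q t
  proof -
    have "s0 + of_real t * (q - s0) = (1 - t) *\<^sub>R s0 + t *\<^sub>R q" by (simp add: scaleR_conv_of_real algebra_simps)
    also have "\<dots> \<in> Q" using cQ s0Q that unfolding convex_alt by blast
    finally have "exp x \<le> cmod (w (q, t))" by (simp add: w_def Q_def)
    then show ?thesis using x by simp
  qed
  have "\<exists>\<psi>. lifts \<psi> (\<lambda>t. w (q, t)) {0..1} \<and> \<psi> 0 = c1 0" if q: "q \<in> Q" for q
  proof -
    \<comment> \<open>Constant after time 1, to have a path defined for all times.\<close>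
    define v where "v t = w (q, min t 1)" for t
    have cv: "continuous_on S v" for S unfolding v_def w_def by (auto intro!: continuous_intros)
    have v\<Omega>: "v ` {0..} \<subseteq> {w. R < cmod w}"
    proof (rule image_subsetI)
      fix t :: real assume "t \<in> {0..}"
      then show "v t \<in> {w. R < cmod w}" unfolding v_def by (intro wQ[OF q]) auto
    qed
    have v0: "f (c1 0) = v 0" by (simp add: v_def w_def s0)
    show ?thesis
    proof (rule lift_dichotomy[OF cv v\<Omega> Dd(1)[OF c10] v0])
      fix \<psi> assume \<psi>: "lifts \<psi> v {0..}" "\<psi> 0 = c1 0"
      have "lifts \<psi> v {0..1}" by (rule lifts_subset[OF \<psi>(1)]) auto
      then have "lifts \<psi> (\<lambda>t. w (q, t)) {0..1}" unfolding lifts_def v_def by (simp add: image_subset_iff)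
      then show ?thesis using \<psi>(2) by blast
    next
      fix \<psi> T assume T: "T > 0" "lifts \<psi> v {0..<T}" "((\<lambda>t. cmod (\<psi> t)) \<longlongrightarrow> 1) (at_left T)"
      have "v T \<in> finite_asymptotic_values f" by (rule finite_asymptotic_value_of_escape[OF T cv])
      then have "cmod (v T) \<le> R" by (rule R(3))
      moreover have "v T \<in> v ` {0..}" using T(1) by (intro imageI) simp
      then have "R < cmod (v T)" using v\<Omega> by blast
      ultimately show ?thesis by simp
    qed
  qed
  then obtain \<Psi> where \<Psi>: "\<And>q. q \<in> Q \<Longrightarrow> lifts (\<Psi> q) (\<lambda>t. w (q, t)) {0..1} \<and> \<Psi> q 0 = c1 0" by metis
  have "lifts (\<lambda>(q, t). \<Psi> q t) w (Q \<times> {0..1})"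
  proof (rule lifts_jointly_continuous)
    show "continuous_on (Q \<times> {0..1}) w" unfolding w_def split_beta by (intro continuous_intros)
    show "lifts (\<lambda>t. case (q, t) of (q, t) \<Rightarrow> \<Psi> q t) (\<lambda>t. w (q, t)) {0..1}" if "q \<in> Q" for q
      using \<Psi>[OF that] by simp
    show "continuous_on Q (\<lambda>q. case (q, 0) of (q, t) \<Rightarrow> \<Psi> q t)"
      by (subst continuous_on_cong[OF refl, of _ _ "\<lambda>_. c1 0"]) (use \<Psi> in auto)
  qed simp
  then have joint: "continuous_on (Q \<times> {0..1}) (\<lambda>(q, t). \<Psi> q t)" unfolding lifts_def by blast
  define \<Phi> where "\<Phi> q = \<Psi> q 1" for q
  have c\<Phi>: "continuous_on Q \<Phi>"
  proof -
    have "continuous_on Q (\<lambda>q. (\<lambda>(q, t). \<Psi> q t) (q, 1))"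
      by (rule continuous_on_compose2[OF joint]) (auto intro!: continuous_intros)
    then show ?thesis by (simp add: \<Phi>_def)
  qed
  have \<Phi>d: "\<Phi> q \<in> unit_disc" and f\<Phi>: "f (\<Phi> q) = exp q" if "q \<in> Q" for q
  proof -
    have "\<Psi> q ` {0..1} \<subseteq> unit_disc" "\<forall>t\<in>{0..1}. f (\<Psi> q t) = w (q, t)"
      using \<Psi>[OF that] unfolding lifts_def by blast+
    then show "\<Phi> q \<in> unit_disc" "f (\<Phi> q) = exp q" unfolding \<Phi>_def by (auto simp: w_def image_subset_iff)
  qed
  have \<Phi>s0: "\<Phi> s0 = c1 0"
  proof -
    have "R < cmod (f (c1 0))" using Dd(2)[OF c10] x by linarith
    moreover have "w (s0, t) = f (c1 0)" for t by (simp add: w_def s0)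
    ultimately have const: "lifts (\<lambda>_::real. c1 0) (\<lambda>t. w (s0, t)) {0..1}"
      unfolding lifts_def using Dd(1)[OF c10] by (simp add: image_subset_iff)
    have "lifts (\<Psi> s0) (\<lambda>t. w (s0, t)) {0..1}" "\<Psi> s0 0 = c1 0" using \<Psi>[OF s0Q] by blast+
    from lift_unique[OF connected_Icc this(1) const _ this(2)] show ?thesis unfolding \<Phi>_def by simp
  qed
  have follow: "\<Phi> (\<sigma> t) = g t"
    if g: "convex S" "0 \<in> S" "continuous_on S g" "g ` S \<subseteq> D d" and \<sigma>: "continuous_on S \<sigma>"
      "\<And>t. t \<in> S \<Longrightarrow> exp (\<sigma> t) = f (g t)" "\<Phi> (\<sigma> 0) = g 0" and t: "t \<in> S" for S g and \<sigma> :: "real \<Rightarrow> complex" and t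
  proof (rule lift_unique[of S "\<lambda>t. \<Phi> (\<sigma> t)" "\<lambda>t. f (g t)" g 0 t])
    have gD: "g t \<in> D d" if "t \<in> S" for t using g(4) that by blast
    have \<sigma>Q: "\<sigma> t \<in> Q" if "t \<in> S" for t by (rule Re_in_Q(1)[OF \<sigma>(2)[OF that] gD[OF that]])
    have \<Omega>: "R < cmod (f (g t))" if "t \<in> S" for t using Dd(2)[OF gD[OF that]] x by linarith
    show "lifts g (\<lambda>t. f (g t)) S" unfolding lifts_def
      using g(3) gD Dd(1) \<Omega> by blast
    show "lifts (\<lambda>t. \<Phi> (\<sigma> t)) (\<lambda>t. f (g t)) S" unfolding lifts_def
    proof (intro conjI ballI)
      show "continuous_on S (\<lambda>t. \<Phi> (\<sigma> t))" by (rule continuous_on_compose2[OF c\<Phi> \<sigma>(1)]) (use \<sigma>Q in blast)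
      show "(\<lambda>t. \<Phi> (\<sigma> t)) ` S \<subseteq> unit_disc" using \<Phi>d \<sigma>Q by blast
      show "f (\<Phi> (\<sigma> t)) = f (g t)" if "t \<in> S" for t using f\<Phi>[OF \<sigma>Q[OF that]] \<sigma>(2)[OF that] by simp
      show "(\<lambda>t. f (g t)) ` S \<subseteq> {w. R < cmod w}" using \<Omega> by blast
    qed
    show "connected S" by (rule convex_connected[OF g(1)])
  qed fact+
  have fg: "continuous_on S (\<lambda>t. f (g t))" if "continuous_on S g" "g ` S \<subseteq> D d" for S and g :: "real \<Rightarrow> complex"
    by (rule continuous_on_compose2[OF contf that(1)]) (use that(2) Dd(1) in blast)
  have nzg: "f (g t) \<noteq> 0" if "g ` S \<subseteq> D d" "t \<in> S" for S and g :: "real \<Rightarrow> complex" and t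
    using nz that by blast
  obtain \<sigma>1 where \<sigma>1: "continuous_on {0..<1} \<sigma>1" "\<sigma>1 0 = s0" "\<And>t. t \<in> {0..<1} \<Longrightarrow> exp (\<sigma>1 t) = f (c1 t)"
    using continuous_logarithm_from[of "{0..<1::real}" 0 "\<lambda>t. f (c1 t)" s0, OF _ _ fg[OF c1(1,2)] nzg[OF c1(2)] s0]
    by auto
  have im_p: "p ` {0..1} \<subseteq> D d" "continuous_on {0..1} p" using p(1,2) by (simp_all add: path_def path_image_def)
  have p0: "p 0 = c1 0" "p 1 = c2 0" using p(3,4) by (simp_all add: pathstart_def pathfinish_def)
  obtain \<mu> where \<mu>: "continuous_on {0..1} \<mu>" "\<mu> 0 = s0" "\<And>t. t \<in> {0..1} \<Longrightarrow> exp (\<mu> t) = f (p t)"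
    using continuous_logarithm_from[of "{0..1::real}" 0 "\<lambda>t. f (p t)" s0, OF _ _ fg[OF im_p(2,1)] nzg[OF im_p(1)]] s0 p0
    by auto
  have \<mu>1: "\<Phi> (\<mu> 1) = c2 0" "exp (\<mu> 1) = f (c2 0)"
    using follow[of "{0..1}" p \<mu> 1] im_p \<mu> \<Phi>s0 p0 by auto
  obtain \<sigma>2 where \<sigma>2: "continuous_on {0..<1} \<sigma>2" "\<sigma>2 0 = \<mu> 1" "\<And>t. t \<in> {0..<1} \<Longrightarrow> exp (\<sigma>2 t) = f (c2 t)"
    using continuous_logarithm_from[of "{0..<1::real}" 0 "\<lambda>t. f (c2 t)" "\<mu> 1", OF _ _ fg[OF c2(1,2)] nzg[OF c2(2)] \<mu>1(2)]
    by auto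
  have f1: "\<Phi> (\<sigma>1 t) = c1 t" if "t \<in> {0..<1}" for t
    by (rule follow[OF _ _ c1(1,2) \<sigma>1(1,3) _ that]) (simp_all add: \<sigma>1(2) \<Phi>s0)
  have f2: "\<Phi> (\<sigma>2 t) = c2 t" if "t \<in> {0..<1}" for t
    by (rule follow[OF _ _ c2(1,2) \<sigma>2(1,3) _ that]) (simp_all add: \<sigma>2(2) \<mu>1)
  have near1: "\<forall>\<^sub>F t in at_left (1::real). t \<in> {0..<1}"
    by (rule eventually_mono[OF eventually_at_left_real[of 0 1]]) auto
  have Re_top: "filterlim (\<lambda>t. Re (\<sigma> t)) at_top (at_left 1)"
    if "filterlim (\<lambda>t. cmod (f (c t))) at_top (at_left 1)" "c ` {0..<1} \<subseteq> D d"
      "\<And>t. t \<in> {0..<1} \<Longrightarrow> exp (\<sigma> t) = f (c t)" for c \<sigma> :: "real \<Rightarrow> complex"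
  proof -
    have "\<forall>\<^sub>F t in at_left 1. ln (cmod (f (c t))) = Re (\<sigma> t)"
      using near1
    proof (rule eventually_mono)
      fix t :: real assume t: "t \<in> {0..<1}"
      then have "c t \<in> D d" using that(2) by blast
      from Re_in_Q(2)[OF that(3)[OF t] this] show "ln (cmod (f (c t))) = Re (\<sigma> t)" by simp
    qed
    from filterlim_cong[OF refl refl this] filterlim_compose[OF ln_at_top that(1)]
    show ?thesis by simp
  qed
  have inQ: "\<sigma> ` {0..<1} \<subseteq> Q" if "c ` {0..<1} \<subseteq> D d" "\<And>t. t \<in> {0..<1} \<Longrightarrow> exp (\<sigma> t) = f (c t)"
    for c \<sigma> :: "real \<Rightarrow> complex"
  proof (rule image_subsetI)
    fix t :: real assume t: "t \<in> {0..<1}"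
    then have "c t \<in> D d" using that(1) by blast
    from Re_in_Q(1)[OF that(2)[OF t] this] show "\<sigma> t \<in> Q" .
  qed
  show False
  proof (rule no_uniformised_pair_of_curves[OF a cQ c\<Phi>])
    show "\<Phi> ` Q \<subseteq> unit_disc" using \<Phi>d by blast
    show "cmod (f (\<Phi> q)) = exp (Re q)" if "q \<in> Q" for q unfolding f\<Phi>[OF that] by simp
    show "x \<le> Re q" if "q \<in> Q" for q using that by (simp add: Q_def)
    show "continuous_on {0..<1} \<sigma>1" "continuous_on {0..<1} \<sigma>2" by fact+
    show "\<sigma>1 ` {0..<1} \<subseteq> Q" by (rule inQ[OF c1(2) \<sigma>1(3)])
    show "\<sigma>2 ` {0..<1} \<subseteq> Q" by (rule inQ[OF c2(2) \<sigma>2(3)])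
    show "filterlim (\<lambda>t. Re (\<sigma>1 t)) at_top (at_left 1)" by (rule Re_top[OF c1(5,2) \<sigma>1(3)])
    show "filterlim (\<lambda>t. Re (\<sigma>2 t)) at_top (at_left 1)" by (rule Re_top[OF c2(5,2) \<sigma>2(3)])
    show "((\<lambda>t. \<Phi> (\<sigma>1 t)) \<longlongrightarrow> \<zeta>1) (at_left 1)"
      by (rule Lim_transform_eventually[OF c1(3)]) (rule eventually_mono[OF near1], simp add: f1)
    show "((\<lambda>t. \<Phi> (\<sigma>2 t)) \<longlongrightarrow> \<zeta>2) (at_left 1)"
      by (rule Lim_transform_eventually[OF c2(3)]) (rule eventually_mono[OF near1], simp add: f2)
    show "cmod \<zeta>1 = 1" "cmod \<zeta>2 = 1" "\<zeta>1 \<noteq> \<zeta>2" by fact+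
    show "\<forall>\<^sub>F t in at_left 1. \<Phi> (\<sigma>1 t) \<in> D \<epsilon>" if "\<epsilon> > 0" for \<epsilon>
      using c1(6)[rule_format, OF that] near1 by eventually_elim (simp add: f1)
  qed
qed

section \<open>Curves with monotonic image\<close>

text \<open>A locally injective continuous function has no interior extremum.\<close>

lemma locally_injective_endpoints_differ:
  fixes m :: "real \<Rightarrow> real"
  assumes cont: "continuous_on {0..1} m"
    and loc: "\<And>u. u \<in> {0..1} \<Longrightarrow> \<exists>\<delta>>0. inj_on m ({0..1} \<inter> ball u \<delta>)"
  shows "m 0 \<noteq> m 1"
proof
  assume eq: "m 0 = m 1"
  have no_ext: "m u = m 0" if u: "u \<in> {0..1}" and ext: "(\<forall>v\<in>{0..1}. m v \<le> m u) \<or> (\<forall>v\<in>{0..1}. m u \<le> m v)" for u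
  proof (rule ccontr)
    assume "m u \<noteq> m 0"
    then have "u \<noteq> 0" "u \<noteq> 1" using eq by auto
    then have u01: "0 < u" "u < 1" using u by auto
    obtain \<delta> where \<delta>: "\<delta> > 0" "inj_on m ({0..1} \<inter> ball u \<delta>)" using loc[OF u] by blast
    define r where "r = min (\<delta> / 2) (min u (1 - u))"
    have r: "r > 0" "r < \<delta>" "r \<le> u" "r \<le> 1 - u" using \<delta>(1) u01 by (auto simp: r_def)
    have sub: "{u - r..u + r} \<subseteq> {0..1} \<inter> ball u \<delta>" using r by (auto simp: dist_real_def)
    have "(m (u - r) < m u \<and> m u < m (u + r)) \<or> (m (u + r) < m u \<and> m u < m (u - r))"
    proof (rule continuous_inj_imp_mono[of "u - r" u "u + r" m])
      show "continuous_on {u - r..u + r} m" by (rule continuous_on_subset[OF cont]) (use sub in blast)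
      show "inj_on m {u - r..u + r}" by (rule inj_on_subset[OF \<delta>(2) sub])
    qed (use r in auto)
    moreover have "u - r \<in> {0..1}" "u + r \<in> {0..1}" using r u01 by auto
    ultimately show False using ext by fastforce
  qed
  \<comment> \<open>So maximum and minimum agree, and \<open>m\<close> would be constant.\<close>
  obtain p where p: "p \<in> {0..1}" "\<forall>v\<in>{0..1}. m v \<le> m p"
    using continuous_attains_sup[OF compact_Icc _ cont] by fastforce
  obtain q where q: "q \<in> {0..1}" "\<forall>v\<in>{0..1}. m q \<le> m v"
    using continuous_attains_inf[OF compact_Icc _ cont] by fastforce
  have "m p = m 0" "m q = m 0" using no_ext p q by blast+
  then have const: "m v = m 0" if "v \<in> {0..1}" for v using p(2) q(2) that by (metis order_antisym)
  obtain \<delta> where \<delta>: "\<delta> > 0" "inj_on m ({0..1} \<inter> ball 0 \<delta>)" using loc[of 0] by auto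
  define v where "v = min (\<delta> / 2) 1"
  have v: "v \<noteq> 0" "v \<in> {0..1} \<inter> ball 0 \<delta>" "(0::real) \<in> {0..1} \<inter> ball 0 \<delta>" using \<delta>(1) by (auto simp: v_def)
  then have "m v = m 0" using const by blast
  then show False using inj_onD[OF \<delta>(2) _ v(2,3)] v(1) by blast
qed

locale regular_at_large_values = regular_over f "{w. R < cmod w}" for f R +
  assumes R_pos: "R > 0"
begin

text \<open>Monotonicity concerns the image as a set: the curve \<open>\<Gamma>\<close> may run back and forth. It can only retrace its
  own steps, though. Otherwise there is an arc inside its trace whose ends have the same modulus under
  \<open>f\<close>, while that modulus is locally injective along the arc.\<close>

lemma monotonic_image_injective:
  fixes \<Gamma> :: "real \<Rightarrow> complex"
  assumes cont: "continuous_on S \<Gamma>" "\<Gamma> ` S \<subseteq> unit_disc" "\<And>t. t \<in> S \<Longrightarrow> R < cmod (f (\<Gamma> t))"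
    and mono: "\<And>s t. s \<in> S \<Longrightarrow> t \<in> S \<Longrightarrow> cmod (f (\<Gamma> s)) = cmod (f (\<Gamma> t)) \<Longrightarrow> f (\<Gamma> s) = f (\<Gamma> t)"
    and S: "is_interval S" and st: "s \<in> S" "t \<in> S" "cmod (f (\<Gamma> s)) = cmod (f (\<Gamma> t))"
  shows "\<Gamma> s = \<Gamma> t"
proof (rule ccontr)
  assume ne: "\<Gamma> s \<noteq> \<Gamma> t"
  have pc: "path_connected (\<Gamma> ` S)"
    using S cont(1) by (intro path_connected_continuous_image convex_imp_path_connected) (simp_all add: is_interval_convex)
  have "\<exists>a. arc a \<and> path_image a \<subseteq> \<Gamma> ` S \<and> pathstart a = \<Gamma> s \<and> pathfinish a = \<Gamma> t"
    by (rule path_connected_arcwise[THEN iffD1, rule_format, OF pc imageI imageI ne]) (rule st(1,2))+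
  then obtain a where a: "arc a" "path_image a \<subseteq> \<Gamma> ` S" "pathstart a = \<Gamma> s" "pathfinish a = \<Gamma> t"
    by (elim exE conjE)
  have pa: "continuous_on {0..1} a" "inj_on a {0..1}" using a(1) by (auto simp: arc_def path_def)
  have aS: "\<exists>r\<in>S. a u = \<Gamma> r" if u: "u \<in> {0..1}" for u
  proof -
    have "a u \<in> path_image a" unfolding path_image_def by (rule imageI[OF u])
    from subsetD[OF a(2) this] show ?thesis by (elim imageE) (rule bexI)
  qed
  have ad: "a u \<in> unit_disc \<and> R < cmod (f (a u))" if u: "u \<in> {0..1}" for u
  proof -
    obtain r where r: "r \<in> S" "a u = \<Gamma> r" using aS[OF u] by (elim bexE)
    show ?thesis unfolding r(2) using subsetD[OF cont(2) imageI[OF r(1)]] cont(3)[OF r(1)] by (rule conjI)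
  qed
  define m where "m u = cmod (f (a u))" for u
  have "m 0 \<noteq> m 1"
  proof (rule locally_injective_endpoints_differ)
    show "continuous_on {0..1} m" unfolding m_def
      by (intro continuous_on_norm continuous_on_compose2[OF contf pa(1)]) (use ad in blast)
    fix u :: real assume u: "u \<in> {0..1}"
    have "f (a u) \<in> {w. R < cmod w}" using ad[OF u] by simp
    then obtain V where V: "open V" "a u \<in> V" "inj_on f V" by (rule local_inverse[OF conjunct1[OF ad[OF u]]])
    have "\<forall>\<^sub>F v in at u within {0..1}. a v \<in> V"
      using pa(1) u V(1,2) unfolding continuous_on_def by (blast intro: topological_tendstoD)
    then obtain \<delta> where \<delta>: "\<delta> > 0" "\<forall>v\<in>{0..1}. v \<noteq> u \<and> dist v u < \<delta> \<longrightarrow> a v \<in> V"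
      unfolding eventually_at by blast
    have aV: "a v \<in> V" if "v \<in> {0..1} \<inter> ball u \<delta>" for v
      using \<delta>(2) that V(2) by (cases "v = u") (auto simp: dist_commute)
    have "inj_on m ({0..1} \<inter> ball u \<delta>)"
    proof (rule inj_onI)
      fix v v' assume v: "v \<in> {0..1} \<inter> ball u \<delta>" "v' \<in> {0..1} \<inter> ball u \<delta>" and eq: "m v = m v'"
      obtain r r' where r: "r \<in> S" "r' \<in> S" "a v = \<Gamma> r" "a v' = \<Gamma> r'" using aS[of v] aS[of v'] v by blast
      have "f (a v) = f (a v')" using mono[OF r(1,2)] eq unfolding m_def r(3,4) by blast
      then have "a v = a v'" by (rule inj_onD[OF V(3) _ aV[OF v(1)] aV[OF v(2)]])
      then show "v = v'" using inj_onD[OF pa(2)] v by blast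
    qed
    then show "\<exists>\<delta>>0. inj_on m ({0..1} \<inter> ball u \<delta>)" using \<delta>(1) by blast
  qed
  then show False using a(3,4) st(3) by (simp add: m_def pathstart_def pathfinish_def)
qed

text \<open>By the previous lemma the point of the tail at which \<open>f\<close> has modulus \<open>exp x\<close> is unique. It depends
  continuously on \<open>x\<close> because the graph is the continuous image of a compact set of times.\<close>

lemma monotonic_curve_reparametrised_by_modulus:
  assumes bp: "boundary_path \<Gamma>" and top: "filterlim (\<lambda>t. cmod (f (\<Gamma> t))) at_top (at_left 1)"
    and mono: "monotonic_curve (f ` \<Gamma> ` {0..<1})"
  shows "\<exists>X g. continuous_on {X..} g \<and> g ` {X..} \<subseteq> unit_disc \<and> R < exp X \<and> (\<forall>x\<ge>X. cmod (f (g x)) = exp x) \<and>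
    (\<forall>\<tau><1. \<forall>\<^sub>F x in at_top. \<exists>t. \<tau> < t \<and> t < 1 \<and> g x = \<Gamma> t)"
proof -
  have cont: "continuous_on {0..<1} \<Gamma>" "\<Gamma> ` {0..<1} \<subseteq> unit_disc" using bp unfolding boundary_path_def by blast+
  obtain R' where R': "\<forall>r>R'. \<exists>!z. z \<in> f ` \<Gamma> ` {0..<1} \<and> cmod z = r"
    using mono unfolding monotonic_curve_def by blast
  define M where "M = max R R'"
  define m where "m t = cmod (f (\<Gamma> t))" for t
  have beyond: "\<exists>t0. 0 \<le> t0 \<and> t0 < 1 \<and> (\<forall>t. t0 \<le> t \<longrightarrow> t < 1 \<longrightarrow> B \<le> m t)" for B
    unfolding m_def by (rule curve_eventually_beyond[OF top])
  obtain t1 where t1: "0 \<le> t1" "t1 < 1" "\<forall>t. t1 \<le> t \<longrightarrow> t < 1 \<longrightarrow> M + 1 \<le> m t"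
    using beyond[of "M + 1"] by (elim exE conjE)
  have big: "M < m t" if "t \<in> {t1..<1}" for t using t1(3)[rule_format, of t] that by simp
  have c1: "continuous_on {t1..<1} \<Gamma>" by (rule continuous_on_subset[OF cont(1)]) (use t1(1) in auto)
  have d1: "\<Gamma> ` {t1..<1} \<subseteq> unit_disc" using cont(2) t1(1) by fastforce
  have cm: "continuous_on {t1..<1} m" unfolding m_def
    by (intro continuous_on_norm continuous_on_compose2[OF contf c1 d1])
  have inj: "\<Gamma> s = \<Gamma> t" if "s \<in> {t1..<1}" "t \<in> {t1..<1}" "m s = m t" for s t
  proof (rule monotonic_image_injective[OF c1 d1 _ _ _ that(1,2)])
    show "R < cmod (f (\<Gamma> t))" if "t \<in> {t1..<1}" for t using big[OF that] by (simp add: m_def M_def)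
    show "is_interval {t1..<1}" by (simp add: is_interval_convex_1)
    show "cmod (f (\<Gamma> s)) = cmod (f (\<Gamma> t))" using that(3) by (simp add: m_def)
    show "f (\<Gamma> s) = f (\<Gamma> t)" if st: "s \<in> {t1..<1}" "t \<in> {t1..<1}" "cmod (f (\<Gamma> s)) = cmod (f (\<Gamma> t))" for s t
    proof -
      have "R' < cmod (f (\<Gamma> s))" using big[OF st(1)] by (simp add: m_def M_def)
      moreover have "f (\<Gamma> s) \<in> f ` \<Gamma> ` {0..<1}" "f (\<Gamma> t) \<in> f ` \<Gamma> ` {0..<1}" using st t1(1) by auto
      ultimately show ?thesis using R' st(3) by metis
    qed
  qed
  \<comment> \<open>The lowest level that the tail from \<open>t1\<close> is certain to cover.\<close>
  define X where "X = ln (m t1)"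
  have mpos: "m t > 0" if "t \<in> {t1..<1}" for t using big[OF that] R_pos by (simp add: M_def)
  have eX: "exp X = m t1" unfolding X_def using mpos[of t1] t1 by simp
  have ex: "\<exists>t. t \<in> {t1..<1} \<and> m t = exp x" if "X \<le> x" for x
  proof -
    obtain t2 where t2: "0 \<le> t2" "t2 < 1" "\<forall>t. t2 \<le> t \<longrightarrow> t < 1 \<longrightarrow> exp x \<le> m t"
      using beyond[of "exp x"] by (elim exE conjE)
    define t3 where "t3 = max t1 t2"
    have "\<exists>t\<ge>t1. t \<le> t3 \<and> m t = exp x"
    proof (rule IVT')
      show "m t1 \<le> exp x" using that eX by (metis exp_le_cancel_iff)
      show "exp x \<le> m t3" using t1(2) t2(2) by (intro t2(3)[rule_format]) (simp_all add: t3_def)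
      show "continuous_on {t1..t3} m" by (rule continuous_on_subset[OF cm]) (use t1 t2 in \<open>auto simp: t3_def\<close>)
    qed (simp add: t3_def)
    then obtain t where "t1 \<le> t" "t \<le> t3" "m t = exp x" by blast
    moreover have "t3 < 1" using t1(2) t2(2) by (simp add: t3_def)
    ultimately show ?thesis by (intro exI[of _ t]) simp
  qed
  then obtain \<tau> where \<tau>: "\<And>x. X \<le> x \<Longrightarrow> \<tau> x \<in> {t1..<1} \<and> m (\<tau> x) = exp x" by metis
  define g where "g x = \<Gamma> (\<tau> x)" for x
  have g_eq: "g x = \<Gamma> t" if "X \<le> x" "t \<in> {t1..<1}" "m t = exp x" for x t
    unfolding g_def using inj[of "\<tau> x" t] \<tau>[OF that(1)] that by simp
  have gd: "g ` {X..} \<subseteq> unit_disc" unfolding g_def using \<tau> d1 by blast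
  have late: "\<forall>\<^sub>F x in at_top. \<exists>t. t0 < t \<and> t < 1 \<and> g x = \<Gamma> t" if t0: "t0 < 1" for t0
  proof -
    define t0' where "t0' = max t1 t0"
    have t0': "t1 \<le> t0'" "t0' < 1" "t0 \<le> t0'" using t1 t0 by (auto simp: t0'_def)
    have c0: "continuous_on {t1..t0'} m" by (rule continuous_on_subset[OF cm]) (use t0' in auto)
    have ne: "{t1..t0'} \<noteq> {}" using t0'(1) by simp
    obtain p where p: "p \<in> {t1..t0'}" "\<forall>t\<in>{t1..t0'}. m t \<le> m p"
      using continuous_attains_sup[OF compact_Icc ne c0] by (elim bexE)
    show ?thesis
      unfolding eventually_at_top_linorder
    proof (rule exI[of _ "max X (m p)"], intro allI impI)
      fix x assume x: "max X (m p) \<le> x"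
      have "m p < exp x" using x exp_ge_add_one_self[of x] by linarith
      moreover have "m (\<tau> x) = exp x" using \<tau>[of x] x by simp
      ultimately have "\<tau> x \<notin> {t1..t0'}" using p(2) by (metis not_le)
      then have "t0 < \<tau> x" "\<tau> x < 1" using \<tau>[of x] x t0' by auto
      then show "\<exists>t. t0 < t \<and> t < 1 \<and> g x = \<Gamma> t" unfolding g_def by blast
    qed
  qed
  have cg: "continuous_on {X..} g"
  proof (rule continuous_on_if_locally_continuous)
    fix x assume x: "x \<in> {X..}"
    obtain t2 where t2: "0 \<le> t2" "t2 < 1" "\<forall>t. t2 \<le> t \<longrightarrow> t < 1 \<longrightarrow> exp (x + 1) + 1 \<le> m t"
      using beyond[of "exp (x + 1) + 1"] by (elim exE conjE)
    define t3 where "t3 = max t1 t2"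
    have t3: "t1 \<le> t3" "t3 < 1" using t1 t2 by (auto simp: t3_def)
    have c3: "continuous_on {t1..t3} \<Gamma>" by (rule continuous_on_subset[OF c1]) (use t3 in auto)
    have cl: "continuous_on {t1..t3} (\<lambda>t. ln (m t))"
      by (intro continuous_on_ln continuous_on_subset[OF cm]) (use t3 mpos in fastforce)+
    have \<tau>3: "\<tau> y \<in> {t1..t3}" if "y \<in> {X..x + 1}" for y
    proof -
      have "\<not> t3 < \<tau> y"
      proof
        assume "t3 < \<tau> y"
        then have "exp (x + 1) + 1 \<le> m (\<tau> y)" using t2(3)[rule_format, of "\<tau> y"] \<tau>[of y] that by (simp add: t3_def)
        also have "m (\<tau> y) = exp y" using \<tau>[of y] that by simp
        also have "exp y \<le> exp (x + 1)" using that by simp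
        finally show False by simp
      qed
      then show ?thesis using \<tau>[of y] that by auto
    qed
    define C where "C = {t1..t3} \<inter> (\<lambda>t. ln (m t)) -` {X..x + 1}"
    have "closed C" unfolding C_def by (rule continuous_closed_preimage[OF cl]) auto
    moreover have "bounded C" unfolding C_def by (rule bounded_subset[OF bounded_closed_interval[of t1 t3]]) auto
    ultimately have "compact C" by (simp add: compact_eq_bounded_closed)
    then have "compact ((\<lambda>t. (ln (m t), \<Gamma> t)) ` C)"
      by (rule compact_continuous_image[rotated])
         (intro continuous_on_Pair continuous_on_subset[OF cl] continuous_on_subset[OF c3]; simp add: C_def)
    also have "(\<lambda>t. (ln (m t), \<Gamma> t)) ` C = (\<lambda>y. (y, g y)) ` {X..x + 1}"
    proof (intro equalityI subsetI)
      fix p assume "p \<in> (\<lambda>t. (ln (m t), \<Gamma> t)) ` C"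
      then obtain t where t: "t \<in> {t1..t3}" "ln (m t) \<in> {X..x + 1}" "p = (ln (m t), \<Gamma> t)" unfolding C_def by blast
      have "t \<in> {t1..<1}" using t(1) t3 by simp
      moreover have "m t = exp (ln (m t))" using mpos[OF calculation] by simp
      ultimately have "g (ln (m t)) = \<Gamma> t" using t(2) by (intro g_eq) auto
      then show "p \<in> (\<lambda>y. (y, g y)) ` {X..x + 1}" using t by (intro image_eqI[of _ _ "ln (m t)"]) auto
    next
      fix p assume "p \<in> (\<lambda>y. (y, g y)) ` {X..x + 1}"
      then obtain y where y: "y \<in> {X..x + 1}" "p = (y, g y)" by blast
      have "m (\<tau> y) = exp y" using \<tau>[of y] y(1) by simp
      then have "ln (m (\<tau> y)) = y" by simp
      then show "p \<in> (\<lambda>t. (ln (m t), \<Gamma> t)) ` C"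
        using \<tau>3[OF y(1)] y by (intro image_eqI[of _ _ "\<tau> y"]) (simp_all add: C_def g_def)
    qed
    finally have clo: "closed ((\<lambda>y. (y, g y)) ` {X..x + 1})" by (rule compact_imp_closed)
    have "continuous_on {X..x + 1} g"
    proof (rule continuous_from_closed_graph[OF _ _ clo])
      show "compact (\<Gamma> ` {t1..t3})" by (rule compact_continuous_image[OF c3 compact_Icc])
      show "g \<in> {X..x + 1} \<rightarrow> \<Gamma> ` {t1..t3}" unfolding g_def using \<tau>3 by blast
    qed
    then have "continuous_on ({X..} \<inter> {..<x + 1}) g" by (rule continuous_on_subset) auto
    then show "\<exists>U. open U \<and> x \<in> U \<and> continuous_on ({X..} \<inter> U) g" by (intro exI[of _ "{..<x + 1}"]) simp
  qed
  show ?thesis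
  proof (intro exI conjI allI impI)
    show "R < exp X" unfolding eX using big[of t1] t1 by (simp add: M_def)
    show "cmod (f (g x)) = exp x" if "X \<le> x" for x using \<tau>[OF that] by (simp add: g_def m_def)
  qed (fact cg gd | erule late)+
qed

end

section \<open>Level curves and Jordan loops\<close>

lemma connected_off_Jordan_curve:
  fixes c :: "real \<Rightarrow> complex"
  assumes c: "simple_path c" "pathfinish c = pathstart c" and S: "connected S" "S \<inter> path_image c = {}"
  shows "S \<subseteq> inside (path_image c) \<or> S \<subseteq> outside (path_image c)"
proof -
  note J = Jordan_inside_outside[OF c]
  have "S \<subseteq> inside (path_image c) \<union> outside (path_image c)" using J S(2) by blast
  then show ?thesis using connectedD[OF S(1), of "inside (path_image c)" "outside (path_image c)"] J by blast
qed

context regular_at_large_values begin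

text \<open>The level curve of \<open>f\<close> through \<open>z\<close>, followed in the direction \<open>\<sigma>\<close> (which is \<open>1\<close> or \<open>-1\<close>) of the
  argument of \<open>f\<close>, passes from the outside of \<open>L\<close> to its inside.\<close>

definition turns_into :: "real \<Rightarrow> complex set \<Rightarrow> complex \<Rightarrow> bool" where
  "turns_into \<sigma> L z \<longleftrightarrow> (\<exists>\<delta>>0. \<exists>\<psi>. lifts \<psi> (\<lambda>t. f z * cis (\<sigma> * t)) {-\<delta><..<\<delta>} \<and> \<psi> 0 = z \<and>
     (\<forall>t. 0 < t \<longrightarrow> t < \<delta> \<longrightarrow> \<psi> t \<in> inside L) \<and> (\<forall>t. - \<delta> < t \<longrightarrow> t < 0 \<longrightarrow> \<psi> t \<in> outside L))"

text \<open>Followed in the direction \<open>\<sigma>\<close>, the level curve through \<open>z1\<close> hits \<open>z2\<close>, for the first time at \<open>\<tau>\<close>.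
  The lift is required to exist a little longer, so that nearby level curves reach the time \<open>\<tau>\<close> as well.\<close>

definition level_arc :: "real \<Rightarrow> complex \<Rightarrow> complex \<Rightarrow> bool" where
  "level_arc \<sigma> z1 z2 \<longleftrightarrow> (\<exists>\<tau>>0. \<exists>\<kappa>>0. \<exists>\<psi>. lifts \<psi> (\<lambda>t. f z1 * cis (\<sigma> * t)) {0..\<tau> + \<kappa>} \<and> \<psi> 0 = z1 \<and> \<psi> \<tau> = z2 \<and>
     (\<forall>t. 0 \<le> t \<longrightarrow> t < \<tau> \<longrightarrow> \<psi> t \<noteq> z2))"

lemma turns_into_exclusive:
  assumes "turns_into 1 L z" "turns_into (-1) L z"
  shows False
proof -
  obtain d p where p: "d > 0" "lifts p (\<lambda>t. f z * cis (1 * t)) {-d<..<d}" "p 0 = z"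
    "\<forall>t. 0 < t \<longrightarrow> t < d \<longrightarrow> p t \<in> inside L" using assms(1) unfolding turns_into_def by (elim exE conjE)
  obtain e q where q: "e > 0" "lifts q (\<lambda>t. f z * cis (-1 * t)) {-e<..<e}" "q 0 = z"
    "\<forall>t. - e < t \<longrightarrow> t < 0 \<longrightarrow> q t \<in> outside L" using assms(2) unfolding turns_into_def by (elim exE conjE)
  define m where "m = min d e / 2"
  have m: "m > 0" "m < d" "m < e" using p(1) q(1) by (auto simp: m_def)
  have sub: "{0..m} \<subseteq> {-d<..<d}" "{- m..0} \<subseteq> {-e<..<e}" using m p(1) q(1) by auto
  have "p m = q (- m)"
  proof (rule lift_unique[of "{0..m}" p "\<lambda>t. f z * cis t" "\<lambda>t. q (- t)" 0 m])
    show "lifts p (\<lambda>t. f z * cis t) {0..m}"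
      using lifts_subset[OF p(2) sub(1)] by simp
    have q': "lifts q (\<lambda>t. f z * cis (- t)) {- m..0}"
      using lifts_subset[OF q(2) sub(2)] by simp
    then have qc: "continuous_on {- m..0} q" "q ` {- m..0} \<subseteq> unit_disc" "\<forall>t\<in>{- m..0}. f (q t) = f z * cis (- t)"
      "(\<lambda>t. f z * cis (- t)) ` {- m..0} \<subseteq> {w. R < cmod w}" unfolding lifts_def by blast+
    have neg: "- t \<in> {- m..0}" if "t \<in> {0..m}" for t using that by simp
    show "lifts (\<lambda>t. q (- t)) (\<lambda>t. f z * cis t) {0..m}"
      unfolding lifts_def
    proof (intro conjI ballI)
      show "continuous_on {0..m} (\<lambda>t. q (- t))"
        by (rule continuous_on_compose2[OF qc(1)]) (use neg in \<open>auto intro!: continuous_intros\<close>)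
      show "(\<lambda>t. q (- t)) ` {0..m} \<subseteq> unit_disc" using qc(2) neg by blast
      show "f (q (- t)) = f z * cis t" if "t \<in> {0..m}" for t using qc(3)[rule_format, OF neg[OF that]] by simp
      show "(\<lambda>t. f z * cis t) ` {0..m} \<subseteq> {w. R < cmod w}"
      proof (rule image_subsetI)
        fix t assume "t \<in> {0..m}"
        from subsetD[OF qc(4) imageI[OF neg[OF this]]] show "f z * cis t \<in> {w. R < cmod w}" by simp
      qed
    qed
  qed (use m p(3) q(3) in auto)
  moreover have "p m \<in> inside L" "q (- m) \<in> outside L" using m p(4) q(4) by simp_all
  ultimately show False using inside_Int_outside[of L] by (metis IntI empty_iff)
qed

text \<open>Near \<open>g x\<close> the coordinates \<open>(y, t)\<close> with value \<open>f (g y) * cis t\<close> straighten the Jordan curve to \<open>t = 0\<close>.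
  Each of the half-boxes \<open>up\<close> and \<open>dn\<close> lies on one side of the curve, and they lie on different sides
  because every point of a Jordan curve is on the boundary of both.\<close>

lemma turns_into_locally_constant:
  assumes c: "simple_path c" "pathfinish c = pathstart c"
    and g: "continuous_on {xa<..<xb} g" "g ` {xa<..<xb} \<subseteq> unit_disc" "\<And>x. x \<in> {xa<..<xb} \<Longrightarrow> cmod (f (g x)) = exp x"
      "R < exp xa"
    and L: "g ` {xa<..<xb} \<subseteq> path_image c" "path_image c \<subseteq> g ` {xa<..<xb} \<union> K" "closed K" "K \<inter> g ` {xa<..<xb} = {}"
    and x: "x \<in> {xa<..<xb}"
  shows "\<exists>\<delta>>0. \<exists>\<sigma>\<in>{1,-1}. \<forall>y. \<bar>y - x\<bar> < \<delta> \<longrightarrow> y \<in> {xa<..<xb} \<and> turns_into \<sigma> (path_image c) (g y)"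
proof -
  define z where "z = g x"
  have zd: "z \<in> unit_disc" unfolding z_def by (rule subsetD[OF g(2) imageI[OF x]])
  have big: "R < cmod (f (g y))" if "y \<in> {xa<..<xb}" for y
    unfolding g(3)[OF that] using g(4) that by (meson exp_less_cancel_iff greaterThanLessThan_iff less_trans)
  have fz: "f z \<in> {w. R < cmod w}" using big[OF x] by (simp add: z_def)
  obtain V h where V: "open V" "z \<in> V" "V \<subseteq> unit_disc" "inj_on f V" "open (f ` V)" "continuous_on (f ` V) h"
    and h: "\<And>v. v \<in> V \<Longrightarrow> h (f v) = v" using local_inverse[OF zd fz] by metis
  have zK: "z \<notin> K" using L(4) x unfolding z_def by blast
  define N where "N = f ` V \<inter> h -` (V - K)"
  have oN: "open N" unfolding N_def by (rule continuous_open_preimage[OF V(6,5)]) (rule open_Diff[OF V(1) L(3)])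
  have fzN: "f z \<in> N" unfolding N_def using V(2) h[OF V(2)] zK by simp
  \<comment> \<open>The values that the straightening coordinates have to realise.\<close>
  define k where "k = (\<lambda>(y, t). f (g y) * cis t)"
  have ck: "continuous_on ({xa<..<xb} \<times> UNIV) k"
  proof -
    have "continuous_on {xa<..<xb} (\<lambda>y. f (g y))" by (rule continuous_on_compose2[OF contf g(1,2)])
    then have "continuous_on ({xa<..<xb} \<times> UNIV) (\<lambda>p. f (g (fst p)))"
      by (rule continuous_on_compose2) (auto intro!: continuous_intros)
    then show ?thesis unfolding k_def split_beta by (intro continuous_intros)
  qed
  have "open (({xa<..<xb} \<times> UNIV) \<inter> k -` N)"
    by (rule continuous_open_preimage[OF ck _ oN]) (simp add: open_Times)
  moreover have "(x, 0) \<in> ({xa<..<xb} \<times> UNIV) \<inter> k -` N" using x fzN by (simp add: k_def z_def)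
  ultimately obtain A B where AB: "open A" "open B" "(x, 0) \<in> A \<times> B" "A \<times> B \<subseteq> ({xa<..<xb} \<times> UNIV) \<inter> k -` N"
    by (rule open_prod_elim)
  have "open ({xa<..<xb} \<inter> g -` V)" by (rule continuous_open_preimage[OF g(1) _ V(1)]) simp
  then have "open (A \<inter> ({xa<..<xb} \<inter> g -` V))" using AB(1) by blast
  moreover have "x \<in> A \<inter> ({xa<..<xb} \<inter> g -` V)" using AB(3) x V(2) by (simp add: z_def)
  ultimately obtain d1 where d1: "d1 > 0" "ball x d1 \<subseteq> A \<inter> ({xa<..<xb} \<inter> g -` V)" unfolding open_contains_ball by blast
  have "0 \<in> B" using AB(3) by simp
  then obtain d2 where d2: "d2 > 0" "ball 0 d2 \<subseteq> B" using AB(2) unfolding open_contains_ball by blast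
  define \<delta> where "\<delta> = min 1 (min d1 d2)"
  have \<delta>: "\<delta> > 0" "\<delta> \<le> 1" using d1(1) d2(1) by (auto simp: \<delta>_def)
  define X where "X = ball x \<delta>"
  have X: "y \<in> {xa<..<xb} \<and> g y \<in> V" if "y \<in> X" for y
  proof -
    have "y \<in> ball x d1" using that by (simp add: X_def \<delta>_def)
    then show ?thesis using d1(2) by blast
  qed
  have kN: "k (y, t) \<in> N" if "y \<in> X" "\<bar>t\<bar> < \<delta>" for y t
  proof -
    have "y \<in> ball x d1" "t \<in> ball 0 d2" using that by (simp_all add: X_def \<delta>_def)
    then have "(y, t) \<in> A \<times> B" using d1(2) d2(2) by blast
    then show ?thesis using AB(4) by blast
  qed
  define \<Psi> where "\<Psi> p = h (k p)" for p
  have \<Psi>: "\<Psi> (y, t) \<in> V - K \<and> f (\<Psi> (y, t)) = k (y, t)" if "y \<in> X" "\<bar>t\<bar> < \<delta>" for y t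
  proof -
    have "k (y, t) \<in> f ` V" "\<Psi> (y, t) \<in> V - K" using kN[OF that] unfolding N_def \<Psi>_def by blast+
    moreover from this(1) obtain v where v: "v \<in> V" "k (y, t) = f v" by blast
    ultimately show ?thesis using h[OF v(1)] by (simp add: \<Psi>_def)
  qed
  have \<Psi>0: "\<Psi> (y, 0) = g y" if "y \<in> X" for y using h X[OF that] by (simp add: \<Psi>_def k_def)
  have ck': "continuous_on (X \<times> {-\<delta><..<\<delta>}) k"
    by (rule continuous_on_subset[OF ck]) (use X in blast)
  have c\<Psi>: "continuous_on (X \<times> {-\<delta><..<\<delta>}) \<Psi>"
    unfolding \<Psi>_def
  proof (rule continuous_on_compose2[OF V(6) ck'])
    show "k ` (X \<times> {-\<delta><..<\<delta>}) \<subseteq> f ` V" using kN unfolding N_def by fastforce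
  qed
  have mod_k: "cmod (k (y, t)) = exp y" if "y \<in> X" for y t
    using g(3)[of y] X[OF that] by (simp add: k_def norm_mult)
  have offL: "t = 0" if yt: "y \<in> X" "\<bar>t\<bar> < \<delta>" and inL: "\<Psi> (y, t) \<in> path_image c" for y t
  proof -
    have "\<Psi> (y, t) \<notin> K" using \<Psi>[OF yt] by blast
    then obtain y' where y': "y' \<in> {xa<..<xb}" "\<Psi> (y, t) = g y'" using L(2) inL by blast
    have "exp y' = exp y" using \<Psi>[OF yt] mod_k[OF yt(1), of t] g(3)[OF y'(1)] y'(2) by simp
    then have "y' = y" by simp
    then have "f (g y) = f (g y) * cis t" using \<Psi>[OF yt] y'(2) by (simp add: k_def)
    moreover have "f (g y) \<noteq> 0" using big[of y] X[OF yt(1)] R_pos by auto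
    ultimately have "cis t = cis 0" by simp
    moreover have "\<bar>t - 0\<bar> < 2 * pi" using yt(2) \<delta>(2) pi_gt3 by linarith
    ultimately show ?thesis by (rule cis_eq_imp_eq)
  qed
  define up where "up = \<Psi> ` (X \<times> {0<..<\<delta>})"
  define dn where "dn = \<Psi> ` (X \<times> {-\<delta><..<0})"
  have side: "S \<subseteq> inside (path_image c) \<or> S \<subseteq> outside (path_image c)"
    if S: "S = \<Psi> ` (X \<times> I)" "convex I" "I \<subseteq> {-\<delta><..<\<delta>}" "0 \<notin> I" for S I
  proof (rule connected_off_Jordan_curve[OF c])
    have "convex (X \<times> I)" unfolding X_def by (intro convex_Times convex_ball S(2))
    moreover have "continuous_on (X \<times> I) \<Psi>" by (rule continuous_on_subset[OF c\<Psi>]) (use S(3) in blast)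
    ultimately show "connected S" unfolding S(1) by (intro connected_continuous_image convex_connected)
    have "\<Psi> (y, t) \<notin> path_image c" if "y \<in> X" "t \<in> I" for y t
    proof
      assume i: "\<Psi> (y, t) \<in> path_image c"
      have "t \<in> {-\<delta><..<\<delta>}" using S(3) that(2) by blast
      then have "\<bar>t\<bar> < \<delta>" by auto
      from offL[OF that(1) this i] show False using S(4) that(2) by blast
    qed
    then show "S \<inter> path_image c = {}" unfolding S(1) by blast
  qed
  have sup: "up \<subseteq> inside (path_image c) \<or> up \<subseteq> outside (path_image c)"
    by (rule side[OF up_def]) (use \<delta>(1) in auto)
  have sdn: "dn \<subseteq> inside (path_image c) \<or> dn \<subseteq> outside (path_image c)"
    by (rule side[OF dn_def]) (use \<delta>(1) in auto)
  define Y where "Y v = ln (cmod (f v))" for v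
  \<comment> \<open>The inverse coordinates are \<open>Y\<close> and \<open>T\<close>.\<close>
  define T where "T v = Arg (f v / f (g (Y v)))" for v
  have fz0: "f z \<noteq> 0" using fz R_pos by auto
  have Yz: "Y z = x" using g(3)[OF x] by (simp add: Y_def z_def)
  have isf: "isCont f z" using contf zd by (simp add: continuous_on_eq_continuous_at)
  have isY: "isCont Y z" unfolding Y_def using isf fz0 by (intro continuous_intros) auto
  have isg: "isCont g (Y z)" using g(1) x Yz by (simp add: continuous_on_eq_continuous_at)
  have gY: "g (Y z) = z" unfolding Yz by (rule z_def[symmetric])
  have isfg: "isCont (\<lambda>v. f (g (Y v))) z"
  proof -
    have "isCont (\<lambda>v. g (Y v)) z" by (rule isCont_o2[OF isY isg])
    moreover have "isCont f (g (Y z))" unfolding gY by (rule isf)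
    ultimately show ?thesis by (rule isCont_o2)
  qed
  have gYz: "f (g (Y z)) = f z" unfolding gY ..
  have isT: "isCont T z"
  proof -
    have "isCont (\<lambda>v. f v / f (g (Y v))) z" by (intro continuous_intros isf isfg) (simp add: gYz fz0)
    moreover have "isCont Arg (f z / f (g (Y z)))" by (rule continuous_at_Arg) (simp add: gYz fz0)
    ultimately show ?thesis unfolding T_def by (rule isCont_o2)
  qed
  have Tz: "T z = 0" using fz0 by (simp add: T_def gYz)
  have "\<forall>\<^sub>F v in nhds z. v \<in> V" by (rule eventually_nhds_in_open[OF V(1,2)])
  moreover have "\<forall>\<^sub>F v in nhds z. dist (Y v) x < \<delta>"
    using isY[unfolded isCont_def tendsto_at_iff_tendsto_nhds, unfolded Yz] \<delta>(1) by (rule tendstoD)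
  moreover have "\<forall>\<^sub>F v in nhds z. dist (T v) 0 < \<delta>"
    using isT[unfolded isCont_def tendsto_at_iff_tendsto_nhds, unfolded Tz] \<delta>(1) by (rule tendstoD)
  moreover have "\<forall>\<^sub>F v in nhds z. dist (f v) (f z) < cmod (f z)"
    by (rule tendstoD[OF isf[unfolded isCont_def tendsto_at_iff_tendsto_nhds]]) (simp add: fz0)
  ultimately have "\<forall>\<^sub>F v in nhds z. v \<in> \<Psi> ` (X \<times> {-\<delta><..<\<delta>})"
  proof eventually_elim
    case (elim v)
    have yX: "Y v \<in> X" using elim(2) by (simp add: X_def dist_commute)
    have fgy: "cmod (f (g (Y v))) = exp (Y v)" using g(3) X[OF yX] by blast
    have fv0: "f v \<noteq> 0" using elim(4) by auto
    have fgy0: "f (g (Y v)) \<noteq> 0" using fgy exp_gt_zero[of "Y v"] by (metis norm_zero less_irrefl)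
    have "exp (Y v) = cmod (f v)" using fv0 by (simp add: Y_def)
    then have "cmod (f v / f (g (Y v))) = 1" using fgy fgy0 fv0 by (simp add: norm_divide)
    then have "cis (T v) = f v / f (g (Y v))"
      unfolding T_def by (subst cis_Arg) (auto simp: sgn_eq)
    then have "k (Y v, T v) = f v" using fgy0 by (simp add: k_def)
    then have "\<Psi> (Y v, T v) = v" using h[OF elim(1)] by (simp add: \<Psi>_def)
    moreover have "(Y v, T v) \<in> X \<times> {-\<delta><..<\<delta>}" using yX elim(3) by (simp add: dist_real_def abs_less_iff)
    ultimately show ?case by (metis imageI)
  qed
  then obtain W where W: "open W" "z \<in> W" "\<forall>v\<in>W. v \<in> \<Psi> ` (X \<times> {-\<delta><..<\<delta>})"
    unfolding eventually_nhds by blast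
  have hit: "\<exists>v\<in>up \<union> dn. v \<in> S"
    if S: "S \<inter> path_image c = {}" "path_image c \<subseteq> closure S" for S
  proof -
    have "z \<in> closure S" using S(2) L(1) x unfolding z_def by blast
    then obtain v where v: "v \<in> W" "v \<in> S" using W(1,2) unfolding closure_iff_nhds_not_empty by (metis Int_iff all_not_in_conv open_subset_interior subset_refl interior_open)
    then obtain y t where yt: "y \<in> X" "t \<in> {-\<delta><..<\<delta>}" "v = \<Psi> (y, t)" using W(3) by blast
    have "t \<noteq> 0"
    proof
      assume "t = 0"
      then have "v = g y" using \<Psi>0[OF yt(1)] yt(3) by simp
      then have "v \<in> path_image c" using L(1) X[OF yt(1)] by blast
      then show False using S(1) v(2) by blast
    qed
    then have "v \<in> up \<union> dn" using yt unfolding up_def dn_def by (cases "t > 0") auto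
    then show ?thesis using v(2) by blast
  qed
  note J = Jordan_inside_outside[OF c]
  have cl: "path_image c \<subseteq> closure (inside (path_image c))" "path_image c \<subseteq> closure (outside (path_image c))"
  proof -
    have fr: "frontier (inside (path_image c)) = path_image c" "frontier (outside (path_image c)) = path_image c"
      using J by simp_all
    show "path_image c \<subseteq> closure (inside (path_image c))" "path_image c \<subseteq> closure (outside (path_image c))"
      using fr[unfolded frontier_def] by blast+
  qed
  have "\<exists>v\<in>up \<union> dn. v \<in> inside (path_image c)" by (rule hit[OF inside_no_overlap cl(1)])
  moreover have "\<exists>v\<in>up \<union> dn. v \<in> outside (path_image c)" by (rule hit[OF outside_no_overlap cl(2)])
  ultimately have "(up \<subseteq> inside (path_image c) \<and> dn \<subseteq> outside (path_image c)) \<or>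
      (up \<subseteq> outside (path_image c) \<and> dn \<subseteq> inside (path_image c))"
    using sup sdn inside_Int_outside[of "path_image c"] by blast
  then obtain \<sigma> :: real where \<sigma>: "\<sigma> \<in> {1,-1}" "\<And>y t. y \<in> X \<Longrightarrow> 0 < t \<Longrightarrow> t < \<delta> \<Longrightarrow> \<Psi> (y, \<sigma> * t) \<in> inside (path_image c)"
     "\<And>y t. y \<in> X \<Longrightarrow> - \<delta> < t \<Longrightarrow> t < 0 \<Longrightarrow> \<Psi> (y, \<sigma> * t) \<in> outside (path_image c)"
  proof (elim disjE conjE)
    assume s: "up \<subseteq> inside (path_image c)" "dn \<subseteq> outside (path_image c)"
    show thesis
      by (rule that[of 1]) (use s in \<open>force simp: up_def dn_def\<close>)+
  next
    assume s: "up \<subseteq> outside (path_image c)" "dn \<subseteq> inside (path_image c)"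
    show thesis
      by (rule that[of "-1"]) (use s in \<open>force simp: up_def dn_def\<close>)+
  qed
  have abs\<sigma>: "\<bar>\<sigma> * t\<bar> = \<bar>t\<bar>" for t using \<sigma>(1) by (auto simp: abs_mult)
  have "turns_into \<sigma> (path_image c) (g y)" if y: "y \<in> X" for y
    unfolding turns_into_def
  proof (intro exI[of _ \<delta>] exI[of _ "\<lambda>t. \<Psi> (y, \<sigma> * t)"] conjI allI impI)
    have st: "\<bar>\<sigma> * t\<bar> < \<delta>" "\<sigma> * t \<in> {-\<delta><..<\<delta>}" if "t \<in> {-\<delta><..<\<delta>}" for t
      using that abs\<sigma>[of t] by (auto simp: abs_less_iff)
    show "lifts (\<lambda>t. \<Psi> (y, \<sigma> * t)) (\<lambda>t. f (g y) * cis (\<sigma> * t)) {-\<delta><..<\<delta>}"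
      unfolding lifts_def
    proof (intro conjI ballI)
      show "continuous_on {-\<delta><..<\<delta>} (\<lambda>t. \<Psi> (y, \<sigma> * t))"
        by (rule continuous_on_compose2[OF c\<Psi>]) (use st(2) y in \<open>auto intro!: continuous_intros simp del: greaterThanLessThan_iff\<close>)
      show "(\<lambda>t. \<Psi> (y, \<sigma> * t)) ` {-\<delta><..<\<delta>} \<subseteq> unit_disc" using \<Psi>[OF y st(1)] V(3) by blast
      show "f (\<Psi> (y, \<sigma> * t)) = f (g y) * cis (\<sigma> * t)" if "t \<in> {-\<delta><..<\<delta>}" for t
        using \<Psi>[OF y st(1)[OF that]] by (simp add: k_def)
      show "(\<lambda>t. f (g y) * cis (\<sigma> * t)) ` {-\<delta><..<\<delta>} \<subseteq> {w. R < cmod w}"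
        using big[of y] X[OF y] by (simp add: norm_mult image_subset_iff)
    qed
    show "\<Psi> (y, \<sigma> * 0) = g y" using \<Psi>0[OF y] by simp
  qed (use \<delta>(1) \<sigma>(2,3)[OF y] in auto)
  moreover have "y \<in> X" if "\<bar>y - x\<bar> < \<delta>" for y using that by (simp add: X_def dist_real_def abs_minus_commute)
  ultimately show ?thesis using \<delta>(1) \<sigma>(1) X by blast
qed

lemma turns_into_constant:
  assumes c: "simple_path c" "pathfinish c = pathstart c"
    and g: "continuous_on {xa<..<xb} g" "g ` {xa<..<xb} \<subseteq> unit_disc" "\<And>x. x \<in> {xa<..<xb} \<Longrightarrow> cmod (f (g x)) = exp x"
      "R < exp xa"
    and L: "g ` {xa<..<xb} \<subseteq> path_image c" "path_image c \<subseteq> g ` {xa<..<xb} \<union> K" "closed K" "K \<inter> g ` {xa<..<xb} = {}"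
    and ab: "xa < xb"
  shows "\<exists>\<sigma>\<in>{1,-1}. \<forall>x\<in>{xa<..<xb}. turns_into \<sigma> (path_image c) (g x)"
proof -
  define x0 where "x0 = (xa + xb) / 2"
  have x0: "x0 \<in> {xa<..<xb}" using ab by (simp add: x0_def)
  have ex: "\<exists>\<delta>>0. \<exists>\<sigma>\<in>{1,-1}. \<forall>y. \<bar>y - x\<bar> < \<delta> \<longrightarrow> y \<in> {xa<..<xb} \<and> turns_into \<sigma> (path_image c) (g y)"
    if "x \<in> {xa<..<xb}" for x
    by (rule turns_into_locally_constant[OF c g L that])
  obtain \<sigma> where \<sigma>: "\<sigma> \<in> {1,-1::real}" "turns_into \<sigma> (path_image c) (g x0)"
  proof -
    from ex[OF x0] obtain d \<sigma> where "d > 0" "\<sigma> \<in> {1,-1::real}" "\<forall>y. \<bar>y - x0\<bar> < d \<longrightarrow> y \<in> {xa<..<xb} \<and> turns_into \<sigma> (path_image c) (g y)"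
      by (elim exE conjE bexE)
    then show thesis using that[of \<sigma>] by simp
  qed
  have "turns_into \<sigma> (path_image c) (g x)" if x: "x \<in> {xa<..<xb}" for x
  proof (rule connected_induction_simple[of "{xa<..<xb}" x0 x "\<lambda>x. turns_into \<sigma> (path_image c) (g x)"])
    fix y assume y: "y \<in> {xa<..<xb}"
    from ex[OF y] obtain d \<sigma>' where d: "d > 0" "\<sigma>' \<in> {1,-1::real}" "\<forall>y'. \<bar>y' - y\<bar> < d \<longrightarrow> y' \<in> {xa<..<xb} \<and> turns_into \<sigma>' (path_image c) (g y')"
      by (elim exE conjE bexE)
    show "\<exists>T. openin (top_of_set {xa<..<xb}) T \<and> y \<in> T \<and>
        (\<forall>x\<in>T. \<forall>y\<in>T. turns_into \<sigma> (path_image c) (g x) \<longrightarrow> turns_into \<sigma> (path_image c) (g y))"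
    proof (intro exI[of _ "{xa<..<xb} \<inter> ball y d"] conjI ballI impI)
      fix u v assume u: "u \<in> {xa<..<xb} \<inter> ball y d" and v: "v \<in> {xa<..<xb} \<inter> ball y d" and tu: "turns_into \<sigma> (path_image c) (g u)"
      have uv: "\<bar>u - y\<bar> < d" "\<bar>v - y\<bar> < d" using u v by (auto simp: dist_real_def)
      have t': "turns_into \<sigma>' (path_image c) (g u)" "turns_into \<sigma>' (path_image c) (g v)" using d(3) uv by blast+
      have "\<sigma>' = \<sigma>"
      proof (rule ccontr)
        assume "\<sigma>' \<noteq> \<sigma>"
        then have "(\<sigma> = 1 \<and> \<sigma>' = -1) \<or> (\<sigma> = -1 \<and> \<sigma>' = 1)" using \<sigma>(1) d(2) by auto
        then show False using turns_into_exclusive tu t'(1) by blast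
      qed
      then show "turns_into \<sigma> (path_image c) (g v)" using t'(2) by simp
    qed (use y d(1) in auto)
  qed (use x0 x \<sigma> in auto)
  then show ?thesis using \<sigma>(1) by blast
qed

lemma finite_level_points:
  assumes C: "compact C" "C \<subseteq> unit_disc" and w: "R < cmod w"
  shows "finite {z \<in> C. f z = w}"
proof -
  define A where "A = {z \<in> C. f z = w}"
  have "closed (C \<inter> f -` {w})"
    by (rule continuous_closed_preimage[OF continuous_on_subset[OF contf C(2)] compact_imp_closed[OF C(1)]]) simp
  then have "compact (C \<inter> (C \<inter> f -` {w}))" by (rule compact_Int_closed[OF C(1)])
  moreover have "C \<inter> (C \<inter> f -` {w}) = A" by (auto simp: A_def)
  ultimately have cA: "compact A" by simp
  have "finite (A \<inter> A)"
  proof (rule finite_not_islimpt_in_compact[OF cA])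
    fix z assume z: "z \<in> A"
    then have "z \<in> unit_disc" "f z \<in> {w. R < cmod w}" using C(2) w by (auto simp: A_def)
    then obtain V where V: "open V" "z \<in> V" "inj_on f V" using local_inverse by metis
    show "\<not> z islimpt A"
    proof
      assume "z islimpt A"
      then obtain y where y: "y \<in> A" "y \<in> V" "y \<noteq> z" using V(1,2) unfolding islimpt_def by blast
      have "f y = f z" using y(1) z by (simp add: A_def)
      then show False using inj_onD[OF V(3) _ y(2) V(2)] y(3) by blast
    qed
  qed
  then show ?thesis by (simp add: A_def)
qed

text \<open>Suppose that the level curve entering the inside of the loop at \<open>z1\<close> never meets the loop again. Then
  it stays in a compact subset of the disc, so it can be followed forever, and it returns to one
  of finitely many points after each turn of the argument. Hence it is periodic and does come
  back to \<open>z1\<close>. So there is a first return to the loop. It does not happen at \<open>z1\<close>, where the level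
  curve arrives from the outside; the only other point of the loop on this level is \<open>z2\<close>.\<close>

lemma level_arc_from_turn:
  assumes c: "simple_path c" "pathfinish c = pathstart c" "path_image c \<subseteq> unit_disc"
    and z1: "z1 \<in> path_image c" "R < cmod (f z1)" "z1 \<noteq> z2"
    and turn: "turns_into \<sigma> (path_image c) z1"
    and level: "\<And>z. z \<in> path_image c \<Longrightarrow> cmod (f z) = cmod (f z1) \<Longrightarrow> z = z1 \<or> z = z2"
    and \<sigma>: "\<sigma> \<in> {1,-1}"
  shows "level_arc \<sigma> z1 z2"
proof -
  define L where "L = path_image c"
  define w where "w t = f z1 * cis (\<sigma> * t)" for t
  have cw: "continuous_on S w" for S unfolding w_def by (intro continuous_intros)
  have w\<Omega>: "w ` S \<subseteq> {w. R < cmod w}" for S using z1(2) by (auto simp: w_def norm_mult)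
  have nw: "cmod (w t) = cmod (f z1)" for t by (simp add: w_def norm_mult)
  obtain \<delta> p where \<delta>: "\<delta> > 0" and p: "lifts p w {-\<delta><..<\<delta>}" "p 0 = z1"
    "\<forall>t. 0 < t \<longrightarrow> t < \<delta> \<longrightarrow> p t \<in> inside L" "\<forall>t. - \<delta> < t \<longrightarrow> t < 0 \<longrightarrow> p t \<in> outside L"
    using turn unfolding turns_into_def w_def[symmetric] L_def[symmetric] by (elim exE conjE)
  have cL: "compact L" unfolding L_def using c(1) by (intro compact_path_image simple_path_imp_path)
  have Ldisj: "inside L \<inter> L = {}" "outside L \<inter> L = {}" "inside L \<inter> outside L = {}"
    by (rule inside_no_overlap outside_no_overlap inside_Int_outside)+
  have insd: "inside L \<union> L \<subseteq> unit_disc"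
  proof -
    have "inside L \<subseteq> unit_disc"
    proof
      fix z assume z: "z \<in> inside L"
      show "z \<in> unit_disc"
      proof (rule ccontr)
        assume nz: "z \<notin> unit_disc"
        have "z \<in> outside unit_disc" by (rule convex_in_outside[OF convex_ball nz])
        then have "z \<in> outside L" using outside_mono[OF c(3)] unfolding L_def by blast
        then show False using Ldisj(3) z by blast
      qed
    qed
    then show ?thesis using c(3) by (simp add: L_def)
  qed
  have compIn: "compact (inside L \<union> L)"
  proof -
    have "closed (path_image c \<union> inside (path_image c))"
      by (rule closed_path_image_Un_inside[OF simple_path_imp_path[OF c(1)]])
    moreover have "bounded (inside L \<union> L)" by (rule bounded_subset[OF bounded_ball insd])
    ultimately show ?thesis unfolding L_def by (simp add: compact_eq_bounded_closed Un_commute)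
  qed
  have init: "\<psi> t = p t" if I: "lifts \<psi> w {0..t}" "\<psi> 0 = z1" and t: "0 \<le> t" "t < \<delta>" for \<psi> t
  proof (rule lift_unique[of "{0..t}" \<psi> w p 0 t])
    show "lifts p w {0..t}" by (rule lifts_subset[OF p(1)]) (use t \<delta> in auto)
  qed (use I t p(2) in auto)
  have stays: "\<psi> ` {0<..<s} \<subseteq> inside L"
    if \<psi>: "\<And>t. 0 \<le> t \<Longrightarrow> t < s \<Longrightarrow> lifts \<psi> w {0..t}" "\<psi> 0 = z1" "s > 0" and off: "\<And>t. 0 < t \<Longrightarrow> t < s \<Longrightarrow> \<psi> t \<notin> L" for \<psi> s
  proof -
    have "continuous_on {0<..<s} \<psi>"
    proof (rule continuous_on_if_locally_continuous)
      fix t assume t: "t \<in> {0<..<s}"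
      have "lifts \<psi> w {0..(t + s) / 2}" by (rule \<psi>(1)) (use t in auto)
      then have "continuous_on {0..(t + s) / 2} \<psi>" unfolding lifts_def by blast
      then have "continuous_on ({0<..<s} \<inter> {..<(t + s) / 2}) \<psi>" by (rule continuous_on_subset) auto
      then show "\<exists>U. open U \<and> t \<in> U \<and> continuous_on ({0<..<s} \<inter> U) \<psi>"
        using t by (intro exI[of _ "{..<(t + s) / 2}"]) simp
    qed
    then have "connected (\<psi> ` {0<..<s})" by (intro connected_continuous_image) simp_all
    moreover have "\<psi> ` {0<..<s} \<inter> path_image c = {}" using off unfolding L_def[symmetric] by fastforce
    ultimately have io: "\<psi> ` {0<..<s} \<subseteq> inside L \<or> \<psi> ` {0<..<s} \<subseteq> outside L"
      unfolding L_def by (rule connected_off_Jordan_curve[OF c(1,2)])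
    define m where "m = min \<delta> s / 2"
    have m: "0 < m" "m < \<delta>" "m < s" using \<delta> that(3) by (auto simp: m_def)
    have "\<psi> m = p m" by (rule init[OF \<psi>(1) \<psi>(2)]) (use m in auto)
    then have "\<psi> m \<in> inside L" using p(3) m by simp
    moreover have "\<psi> m \<in> \<psi> ` {0<..<s}" using m by simp
    ultimately show ?thesis using io Ldisj(3) by blast
  qed
  have core: "level_arc \<sigma> z1 z2"
    if \<psi>: "lifts \<psi> w {0..t1 + \<kappa>}" "\<psi> 0 = z1" and t1: "t1 > 0" "\<kappa> > 0" "\<psi> t1 \<in> L" for \<psi> t1 \<kappa>
  proof -
    define \<delta>' where "\<delta>' = min (\<delta> / 2) t1"
    have \<delta>': "0 < \<delta>'" "\<delta>' < \<delta>" "\<delta>' \<le> t1" using \<delta> t1 by (auto simp: \<delta>'_def)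
    have lift: "lifts \<psi> w {0..t}" if "t \<le> t1 + \<kappa>" for t by (rule lifts_subset[OF \<psi>(1)]) (use that in auto)
    have c\<psi>: "continuous_on {\<delta>'..t1} \<psi>"
      by (rule continuous_on_subset[of "{0..t1 + \<kappa>}"]) (use \<psi>(1) \<delta>' t1 in \<open>auto simp: lifts_def\<close>)
    define H where "H = {\<delta>'..t1} \<inter> \<psi> -` L"
    have "closed H" unfolding H_def
      by (rule continuous_closed_preimage[OF c\<psi> _ compact_imp_closed[OF cL]]) simp
    moreover have "bounded H" unfolding H_def by (rule bounded_subset[OF bounded_closed_interval[of \<delta>' t1]]) auto
    ultimately have cH: "compact H" by (simp add: compact_eq_bounded_closed)
    have "t1 \<in> H" using \<delta>' t1 by (simp add: H_def)
    then have "H \<noteq> {}" by blast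
    from compact_attains_inf[OF cH this] obtain \<tau> where \<tau>H: "\<tau> \<in> H" and leastH: "\<forall>s\<in>H. \<tau> \<le> s" by (elim bexE)
    have \<tau>: "\<tau> \<in> {\<delta>'..t1}" "\<psi> \<tau> \<in> L" using \<tau>H by (simp_all add: H_def)
    have least: "\<tau> \<le> s" if "s \<in> {\<delta>'..t1}" "\<psi> s \<in> L" for s
      using leastH[rule_format, of s] that by (simp add: H_def)
    have off: "\<psi> t \<notin> L" if t: "0 < t" "t < \<tau>" for t
    proof (cases "t < \<delta>'")
      case True
      have "\<psi> t = p t" by (rule init[OF lift \<psi>(2)]) (use t True \<delta>' \<tau>(1) t1 in auto)
      then have "\<psi> t \<in> inside L" using p(3) t(1) True \<delta>' by simp
      then show ?thesis using Ldisj(1) by blast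
    next
      case False
      then have "t \<in> {\<delta>'..t1}" using t \<tau>(1) by simp
      then show ?thesis using least[of t] t(2) by fastforce
    qed
    have \<tau>0: "\<tau> > 0" using \<tau>(1) \<delta>'(1) by simp
    have ins: "\<psi> ` {0<..<\<tau>} \<subseteq> inside L"
      by (rule stays[OF lift \<psi>(2) \<tau>0 off]) (use \<tau>(1) t1(2) in auto)
    have "cmod (f (\<psi> \<tau>)) = cmod (f z1)"
    proof -
      have "f (\<psi> \<tau>) = w \<tau>" using \<psi>(1) \<tau>(1) \<delta>' t1 unfolding lifts_def by auto
      then show ?thesis using nw by simp
    qed
    then have "\<psi> \<tau> = z1 \<or> \<psi> \<tau> = z2" using level \<tau>(2) by (simp add: L_def)
    moreover have "\<psi> \<tau> \<noteq> z1"
    proof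
      assume ret: "\<psi> \<tau> = z1"
      have "f (\<psi> \<tau>) = w \<tau>" using \<psi>(1) \<tau>(1) \<delta>' t1 unfolding lifts_def by auto
      then have "f z1 = f z1 * cis (\<sigma> * \<tau>)" using ret by (simp add: w_def)
      moreover have "f z1 \<noteq> 0" using z1(2) R_pos by auto
      ultimately have c1: "cis (\<sigma> * \<tau>) = 1" by simp
      have per: "w (\<tau> - u) = w (- u)" for u
      proof -
        have "cis (\<sigma> * (\<tau> - u)) = cis (\<sigma> * \<tau>) * cis (\<sigma> * (- u))" unfolding cis_mult by (simp add: algebra_simps)
        then show ?thesis by (simp add: w_def c1)
      qed
      define m where "m = min \<delta> \<tau> / 2"
      have m: "0 < m" "m < \<delta>" "m < \<tau>" using \<delta> \<tau>0 by (auto simp: m_def)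
      have "\<psi> (\<tau> - m) = p (- m)"
      proof (rule lift_unique[of "{0..m}" "\<lambda>u. \<psi> (\<tau> - u)" "\<lambda>u. w (- u)" "\<lambda>u. p (- u)" 0 m])
        have r1: "\<tau> - u \<in> {0..t1 + \<kappa>}" if "u \<in> {0..m}" for u using that m \<tau>(1) t1(2) by auto
        have r2: "- u \<in> {-\<delta><..<\<delta>}" if "u \<in> {0..m}" for u using that m \<delta> by auto
        have l1: "continuous_on {0..t1 + \<kappa>} \<psi>" "\<psi> ` {0..t1 + \<kappa>} \<subseteq> unit_disc" "\<forall>t\<in>{0..t1 + \<kappa>}. f (\<psi> t) = w t"
          using \<psi>(1) unfolding lifts_def by blast+
        have l2: "continuous_on {-\<delta><..<\<delta>} p" "p ` {-\<delta><..<\<delta>} \<subseteq> unit_disc" "\<forall>t\<in>{-\<delta><..<\<delta>}. f (p t) = w t"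
          using p(1) unfolding lifts_def by blast+
        have \<Omega>: "(\<lambda>u. w (- u)) ` {0..m} \<subseteq> {w. R < cmod w}" using nw z1(2) by (simp add: image_subset_iff)
        show "lifts (\<lambda>u. \<psi> (\<tau> - u)) (\<lambda>u. w (- u)) {0..m}"
          unfolding lifts_def
        proof (intro conjI ballI \<Omega>)
          show "continuous_on {0..m} (\<lambda>u. \<psi> (\<tau> - u))"
          proof (rule continuous_on_compose2[OF l1(1)])
            show "continuous_on {0..m} (\<lambda>u. \<tau> - u)" by (intro continuous_intros)
            show "(\<lambda>u. \<tau> - u) ` {0..m} \<subseteq> {0..t1 + \<kappa>}" using r1 by blast
          qed
          show "(\<lambda>u. \<psi> (\<tau> - u)) ` {0..m} \<subseteq> unit_disc" using l1(2) r1 by blast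
          show "f (\<psi> (\<tau> - u)) = w (- u)" if "u \<in> {0..m}" for u using l1(3)[rule_format, OF r1[OF that]] per by simp
        qed
        show "lifts (\<lambda>u. p (- u)) (\<lambda>u. w (- u)) {0..m}"
          unfolding lifts_def
        proof (intro conjI ballI \<Omega>)
          show "continuous_on {0..m} (\<lambda>u. p (- u))"
          proof (rule continuous_on_compose2[OF l2(1)])
            show "continuous_on {0..m} (\<lambda>u. - u)" by (intro continuous_intros)
            show "(\<lambda>u. - u) ` {0..m} \<subseteq> {-\<delta><..<\<delta>}" using r2 by blast
          qed
          show "(\<lambda>u. p (- u)) ` {0..m} \<subseteq> unit_disc" using l2(2) r2 by blast
          show "f (p (- u)) = w (- u)" if "u \<in> {0..m}" for u by (rule l2(3)[rule_format, OF r2[OF that]])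
        qed
      qed (use m p(2) ret in simp_all)
      moreover have "p (- m) \<in> outside L" using p(4) m by simp
      moreover have "\<psi> (\<tau> - m) \<in> \<psi> ` {0<..<\<tau>}" using m by (intro imageI) simp
      then have "\<psi> (\<tau> - m) \<in> inside L" using ins by blast
      ultimately show False using Ldisj(3) by (metis IntI empty_iff)
    qed
    ultimately have z2: "\<psi> \<tau> = z2" by blast
    have "\<psi> t \<noteq> z2" if "0 \<le> t" "t < \<tau>" for t
    proof (cases "t = 0")
      case False
      then have "\<psi> t \<notin> L" using off that by simp
      then show ?thesis using z2 \<tau>(2) by metis
    qed (use \<psi>(2) z1(3) in simp)
    moreover have "lifts \<psi> w {0..\<tau> + \<kappa>}" by (rule lift) (use \<tau>(1) in simp)
    ultimately show ?thesis
      unfolding level_arc_def w_def[symmetric] using \<tau>0 t1(2) \<psi>(2) z2 by blast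
  qed
  have z1d: "z1 \<in> unit_disc" using c(3) z1(1) by blast
  have w0: "f z1 = w 0" by (simp add: w_def)
  show ?thesis
  proof (rule lift_dichotomy[OF cw w\<Omega> z1d w0])
    fix \<psi> assume \<psi>: "lifts \<psi> w {0..}" "\<psi> 0 = z1"
    have lift: "lifts \<psi> w {0..t}" for t by (rule lifts_subset[OF \<psi>(1)]) auto
    show ?thesis
    proof (cases "\<exists>t>0. \<psi> t \<in> L")
      case True
      then obtain t where "t > 0" "\<psi> t \<in> L" by blast
      then show ?thesis using core[of \<psi> t 1, OF lift \<psi>(2)] by simp
    next
      case False
      have inn: "\<psi> t \<in> inside L \<union> L" if t: "0 \<le> t" for t
      proof (cases "t = 0")
        case False
        have "\<psi> ` {0<..<t + 1} \<subseteq> inside L"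
          by (rule stays[OF lift \<psi>(2)]) (use \<open>\<not> (\<exists>t>0. \<psi> t \<in> L)\<close> t in auto)
        moreover have "\<psi> t \<in> \<psi> ` {0<..<t + 1}" using False t by (intro imageI) simp
        ultimately show ?thesis by blast
      qed (use \<psi>(2) z1(1) in \<open>simp add: L_def\<close>)
      \<comment> \<open>All these points have the value \<open>f z1\<close>.\<close>
      define s where "s n = \<psi> (2 * pi * real n)" for n
      have f\<psi>: "f (\<psi> t) = w t" if "0 \<le> t" for t using lift[of t] that unfolding lifts_def by simp
      have per: "w (t + 2 * pi * real n) = w t" for t and n :: nat
      proof -
        have c1: "cis (\<sigma> * (2 * pi * real n)) = 1"
          using \<sigma> cis_multiple_2pi[of "real n"] cis_multiple_2pi[of "- real n"] by (auto simp: mult.commute)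
        have "cis (\<sigma> * (t + 2 * pi * real n)) = cis (\<sigma> * t) * cis (\<sigma> * (2 * pi * real n))"
          unfolding cis_mult by (simp add: algebra_simps)
        then show ?thesis by (simp add: w_def c1)
      qed
      have "range s \<subseteq> {z \<in> inside L \<union> L. f z = f z1}"
      proof (rule image_subsetI)
        fix n
        have "f (s n) = f z1" using f\<psi>[of "2 * pi * real n"] per[of 0 n] w0 by (simp add: s_def)
        then show "s n \<in> {z \<in> inside L \<union> L. f z = f z1}" using inn[of "2 * pi * real n"] by (simp add: s_def)
      qed
      then have "finite (range s)"
        by (rule finite_subset) (rule finite_level_points[OF compIn insd z1(2)])
      then have "\<not> inj s" using finite_imageD[of s UNIV] by auto
      then obtain n m where nm: "n < m" "s n = s m" unfolding inj_def by (metis linorder_neqE_nat)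
      define q where "q = 2 * pi * real (m - n)"
      have q: "q > 0" using nm(1) by (simp add: q_def)
      have "\<psi> 0 = \<psi> (0 + q)"
      proof (rule lift_unique[of "{0..}" \<psi> w "\<lambda>t. \<psi> (t + q)" "2 * pi * real n" 0])
        have l1: "continuous_on {0..} \<psi>" "\<psi> ` {0..} \<subseteq> unit_disc" using \<psi>(1) unfolding lifts_def by blast+
        show "lifts (\<lambda>t. \<psi> (t + q)) w {0..}"
          unfolding lifts_def
        proof (intro conjI ballI w\<Omega>)
          show "continuous_on {0..} (\<lambda>t. \<psi> (t + q))"
            by (rule continuous_on_compose2[OF l1(1)]) (use q in \<open>auto intro!: continuous_intros\<close>)
          show "(\<lambda>t. \<psi> (t + q)) ` {0..} \<subseteq> unit_disc"
          proof (rule image_subsetI)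
            fix t :: real assume "t \<in> {0..}"
            then have "\<psi> (t + q) \<in> \<psi> ` {0..}" using q by (intro imageI) simp
            then show "\<psi> (t + q) \<in> unit_disc" using l1(2) by blast
          qed
          show "f (\<psi> (t + q)) = w t" if "t \<in> {0..}" for t
            using f\<psi>[of "t + q"] that q per[of t "m - n"] by (simp add: q_def)
        qed
        have "2 * pi * real n + q = 2 * pi * real m" using nm(1) by (simp add: q_def of_nat_diff algebra_simps)
        then show "\<psi> (2 * pi * real n) = \<psi> (2 * pi * real n + q)" using nm(2) by (simp add: s_def)
      qed (use \<psi> in auto)
      then have "\<psi> q \<in> L" using \<psi>(2) z1(1) by (simp add: L_def)
      then show ?thesis using False q by blast
    qed
  next
    fix \<psi> T assume T: "T > 0" and \<psi>: "lifts \<psi> w {0..<T}" "\<psi> 0 = z1" and lim: "((\<lambda>t. cmod (\<psi> t)) \<longlongrightarrow> 1) (at_left T)"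
    have lift: "lifts \<psi> w {0..t}" if "t < T" for t by (rule lifts_subset[OF \<psi>(1)]) (use that in auto)
    show ?thesis
    proof (cases "\<exists>t>0. t < T \<and> \<psi> t \<in> L")
      case True
      then obtain t where t: "t > 0" "t < T" "\<psi> t \<in> L" by blast
      have "lifts \<psi> w {0..t + (T - t) / 2}" by (rule lift) (use t in \<open>simp add: field_simps\<close>)
      then show ?thesis using core[of \<psi> t "(T - t) / 2", OF _ \<psi>(2)] t by simp
    next
      case False
      have "\<psi> ` {0<..<T} \<subseteq> inside L"
        by (rule stays[OF lift \<psi>(2) T]) (use False in auto)
      then have inn: "\<psi> t \<in> inside L \<union> L" if "0 < t" "t < T" for t using that by auto
      have "inside L \<union> L \<noteq> {}" using z1(1) by (auto simp: L_def)
      then obtain m where m: "m \<in> inside L \<union> L" "\<forall>z\<in>inside L \<union> L. cmod z \<le> cmod m"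
        using continuous_attains_sup[OF compIn _ continuous_on_norm_id] by blast
      have "cmod m < 1" using insd m(1) by auto
      then have "\<forall>\<^sub>F t in at_left T. cmod m < cmod (\<psi> t)" by (rule order_tendstoD(1)[OF lim])
      moreover have "\<forall>\<^sub>F t in at_left T. 0 < t \<and> t < T"
        by (rule eventually_mono[OF eventually_at_left_real[OF T]]) auto
      ultimately have "\<forall>\<^sub>F t in at_left T. False"
        by eventually_elim (use inn m(2) in \<open>meson not_le\<close>)
      then show ?thesis by simp
    qed
  qed
qed

text \<open>The Jordan loop consists of the piece of \<open>g1\<close> between the levels \<open>xa\<close> and \<open>xb\<close> and an arc in the compact
  set \<open>K\<close> made of the rest of \<open>g1\<close>, the path \<open>\<alpha>\<close> on higher levels, \<open>g2\<close>, and the path \<open>b\<close> on lower levels.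
  It attains each level strictly between \<open>xa\<close> and \<open>xb\<close> on \<open>g1\<close> and possibly on \<open>g2\<close>, and nowhere else.\<close>

lemma level_arcs_between_marked_levels:
  assumes g1: "continuous_on {X..} g1" "g1 ` {X..} \<subseteq> unit_disc" "\<And>x. X \<le> x \<Longrightarrow> cmod (f (g1 x)) = exp x"
    and g2: "continuous_on {X..} g2" "g2 ` {X..} \<subseteq> unit_disc" "\<And>x. X \<le> x \<Longrightarrow> cmod (f (g2 x)) = exp x"
    and R: "R < exp X" and ne: "\<And>x. X \<le> x \<Longrightarrow> g1 x \<noteq> g2 x"
    and b: "path b" "pathstart b = g1 X" "pathfinish b = g2 X" "path_image b \<subseteq> unit_disc" "\<And>z. z \<in> path_image b \<Longrightarrow> cmod (f z) \<le> exp xa"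
    and ab: "X \<le> xa" "xa < xb"
    and \<alpha>: "path \<alpha>" "pathstart \<alpha> = g1 x1" "pathfinish \<alpha> = g2 x2" "X \<le> x1" "X \<le> x2" "path_image \<alpha> \<subseteq> unit_disc"
      "\<And>z. z \<in> path_image \<alpha> \<Longrightarrow> exp xb \<le> cmod (f z)"
  shows "\<exists>\<sigma>\<in>{1,-1}. \<forall>x\<in>{xa<..<xb}. level_arc \<sigma> (g1 x) (g2 x)"
proof -
  have sub: "g1 ` S \<subseteq> unit_disc" "g2 ` S \<subseteq> unit_disc" "continuous_on S g1" "continuous_on S g2" if "S \<subseteq> {X..}" for S
    using g1(1,2) g2(1,2) that by (meson continuous_on_subset image_mono order_trans)+
  have x12: "xb \<le> x1" "xb \<le> x2"
  proof -
    have "g1 x1 \<in> path_image \<alpha>" "g2 x2 \<in> path_image \<alpha>"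
      using \<alpha>(2,3) pathstart_in_path_image[of \<alpha>] pathfinish_in_path_image[of \<alpha>] by simp_all
    then have "exp xb \<le> exp x1" "exp xb \<le> exp x2"
      using \<alpha>(7)[of "g1 x1"] \<alpha>(7)[of "g2 x2"] g1(3)[OF \<alpha>(4)] g2(3)[OF \<alpha>(5)] by simp_all
    then show "xb \<le> x1" "xb \<le> x2" by simp_all
  qed
  define P where "P = {xa<..<xb}"
  define K where "K = g1 ` {xb..x1} \<union> (path_image \<alpha> \<union> (g2 ` {X..x2} \<union> (path_image b \<union> g1 ` {X..xa})))"
  have Kd: "K \<subseteq> unit_disc"
    unfolding K_def using \<alpha>(6) b(4) sub(1)[of "{xb..x1}"] sub(2)[of "{X..x2}"] sub(1)[of "{X..xa}"] ab by simp
  have cK: "compact K"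
    unfolding K_def by (intro compact_Un compact_path_image \<alpha>(1) b(1) compact_continuous_image compact_Icc sub) (use ab in auto)
  have pcK: "path_connected K"
  proof -
    have p1: "path_connected (path_image b \<union> g1 ` {X..xa})"
    proof (rule path_connected_Un)
      show "path_connected (g1 ` {X..xa})" by (intro path_connected_continuous_image sub) auto
      have "g1 X \<in> path_image b" using b(2) pathstart_in_path_image[of b] by simp
      moreover have "g1 X \<in> g1 ` {X..xa}" using ab by simp
      ultimately show "path_image b \<inter> g1 ` {X..xa} \<noteq> {}" by blast
    qed (rule path_connected_path_image[OF b(1)])
    have p2: "path_connected (g2 ` {X..x2} \<union> (path_image b \<union> g1 ` {X..xa}))"
    proof (rule path_connected_Un[OF _ p1])
      show "path_connected (g2 ` {X..x2})" by (intro path_connected_continuous_image sub) auto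
      have "g2 X \<in> path_image b" using b(3) pathfinish_in_path_image[of b] by simp
      moreover have "g2 X \<in> g2 ` {X..x2}" using \<alpha>(5) by simp
      ultimately show "g2 ` {X..x2} \<inter> (path_image b \<union> g1 ` {X..xa}) \<noteq> {}" by blast
    qed
    have p3: "path_connected (path_image \<alpha> \<union> (g2 ` {X..x2} \<union> (path_image b \<union> g1 ` {X..xa})))"
    proof (rule path_connected_Un[OF path_connected_path_image[OF \<alpha>(1)] p2])
      have "g2 x2 \<in> path_image \<alpha>" using \<alpha>(3) pathfinish_in_path_image[of \<alpha>] by simp
      moreover have "g2 x2 \<in> g2 ` {X..x2}" using \<alpha>(5) by simp
      ultimately show "path_image \<alpha> \<inter> (g2 ` {X..x2} \<union> (path_image b \<union> g1 ` {X..xa})) \<noteq> {}" by blast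
    qed
    show ?thesis unfolding K_def
    proof (rule path_connected_Un[OF _ p3])
      show "path_connected (g1 ` {xb..x1})" by (intro path_connected_continuous_image sub) (use ab in auto)
      have "g1 x1 \<in> path_image \<alpha>" using \<alpha>(2) pathstart_in_path_image[of \<alpha>] by simp
      moreover have "g1 x1 \<in> g1 ` {xb..x1}" using x12 by simp
      ultimately show "g1 ` {xb..x1} \<inter> (path_image \<alpha> \<union> (g2 ` {X..x2} \<union> (path_image b \<union> g1 ` {X..xa}))) \<noteq> {}" by blast
    qed
  qed
  \<comment> \<open>On \<open>K\<close>, the levels strictly between the two marked ones are attained only along \<open>g2\<close>.\<close>
  have level_K: "z = g2 x" if z: "z \<in> K" "cmod (f z) = exp x" and x: "x \<in> P" for z x
  proof -
    have xx: "xa < x" "x < xb" using x by (auto simp: P_def)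
    from z(1) consider y where "y \<in> {xb..x1}" "z = g1 y" | "z \<in> path_image \<alpha>" | y where "y \<in> {X..x2}" "z = g2 y"
      | "z \<in> path_image b" | y where "y \<in> {X..xa}" "z = g1 y" unfolding K_def by blast
    then show ?thesis
    proof cases
      case 1
      then have "exp y = exp x" using g1(3)[of y] z(2) ab by simp
      then show ?thesis using 1 xx by simp
    next
      case 2
      then have "exp xb \<le> exp x" using \<alpha>(7) z(2) by metis
      then show ?thesis using xx by simp
    next
      case 3
      then have "exp y = exp x" using g2(3)[of y] z(2) by simp
      then show ?thesis using 3 by simp
    next
      case 4
      then have "exp x \<le> exp xa" using b(5) z(2) by metis
      then show ?thesis using xx by simp
    next
      case 5
      then have "exp y = exp x" using g1(3)[of y] z(2) by simp
      then show ?thesis using 5 xx by simp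
    qed
  qed
  have PX: "P \<subseteq> {X..}" unfolding P_def using ab by auto
  have KP: "K \<inter> g1 ` P = {}"
  proof (rule ccontr)
    assume "K \<inter> g1 ` P \<noteq> {}"
    then obtain x where x: "x \<in> P" "g1 x \<in> K" by blast
    have xX: "X \<le> x" using subsetD[OF PX x(1)] by simp
    show False using level_K[OF x(2) g1(3)[OF xX] x(1)] ne[OF xX] by simp
  qed
  have ends: "g1 xb \<in> K" "g1 xa \<in> K"
  proof -
    have "g1 xb \<in> g1 ` {xb..x1}" by (rule imageI) (simp add: x12(1))
    then show "g1 xb \<in> K" unfolding K_def by (rule UnI1)
    have "g1 xa \<in> g1 ` {X..xa}" by (rule imageI) (simp add: ab(1))
    then show "g1 xa \<in> K" unfolding K_def by (intro UnI2)
  qed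
  have inj1: "x = y" if "g1 x = g1 y" "X \<le> x" "X \<le> y" for x y
  proof -
    have "exp x = cmod (f (g1 x))" by (rule g1(3)[OF that(2), symmetric])
    also have "\<dots> = cmod (f (g1 y))" by (simp only: that(1))
    also have "\<dots> = exp y" by (rule g1(3)[OF that(3)])
    finally show ?thesis by (rule exp_inj_iff[THEN iffD1])
  qed
  have "g1 xb \<noteq> g1 xa"
  proof
    assume "g1 xb = g1 xa"
    then have "xb = xa" by (rule inj1) (use ab in auto)
    then show False using ab by simp
  qed
  then have "\<exists>h. arc h \<and> path_image h \<subseteq> K \<and> pathstart h = g1 xb \<and> pathfinish h = g1 xa"
    by (rule path_connected_arcwise[THEN iffD1, rule_format, OF pcK ends])
  then obtain h where h: "arc h" "path_image h \<subseteq> K" "pathstart h = g1 xb" "pathfinish h = g1 xa" by (elim exE conjE)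
  define k where "k = (\<lambda>s. g1 (xa + s * (xb - xa)))"
  have kran: "xa + s * (xb - xa) \<in> {xa..xb}" if "s \<in> {0..1}" for s
  proof -
    have "0 \<le> s * (xb - xa)" using that ab by simp
    moreover have "s * (xb - xa) \<le> 1 * (xb - xa)" using that ab by (intro mult_right_mono) auto
    ultimately show ?thesis by simp
  qed
  have imk: "path_image k = g1 ` {xa..xb}"
  proof -
    have "(\<lambda>s. xa + s * (xb - xa)) ` {0..1} = {xa..xb}"
    proof (intro equalityI subsetI)
      fix x assume x: "x \<in> {xa..xb}"
      have "x = xa + (x - xa) / (xb - xa) * (xb - xa)" using ab by simp
      moreover have "(x - xa) / (xb - xa) \<in> {0..1}" using x ab by (simp add: divide_le_eq)
      ultimately show "x \<in> (\<lambda>s. xa + s * (xb - xa)) ` {0..1}" by blast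
    qed (use kran in blast)
    then show ?thesis unfolding path_image_def k_def by (metis image_image)
  qed
  have k: "arc k"
    unfolding arc_def path_def
  proof
    show "continuous_on {0..1} k" unfolding k_def
    proof (rule continuous_on_compose2[OF sub(3)])
      show "continuous_on {0..1} (\<lambda>s. xa + s * (xb - xa))" by (intro continuous_intros)
      show "(\<lambda>s. xa + s * (xb - xa)) ` {0..1} \<subseteq> {xa..xb}" using kran by blast
      show "{xa..xb} \<subseteq> {X..}" using ab by auto
    qed
    show "inj_on k {0..1}"
    proof (rule inj_onI)
      fix s t assume s: "s \<in> {0..1}" and t: "t \<in> {0..1}" and st: "k s = k t"
      have "xa \<le> xa + s * (xb - xa)" "xa \<le> xa + t * (xb - xa)"
        using kran[OF s] kran[OF t] unfolding atLeastAtMost_iff by blast+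
      then have "X \<le> xa + s * (xb - xa)" "X \<le> xa + t * (xb - xa)" using ab(1) by linarith+
      then have "xa + s * (xb - xa) = xa + t * (xb - xa)" by (rule inj1[OF st[unfolded k_def]])
      then show "s = t" using ab by simp
    qed
  qed
  have k01: "pathstart k = g1 xa" "pathfinish k = g1 xb" by (simp_all add: k_def pathstart_def pathfinish_def)
  have split: "{xa..xb} = P \<union> {xa, xb}" unfolding P_def using ab by auto
  define c where "c = k +++ h"
  have c: "simple_path c" "pathfinish c = pathstart c"
  proof -
    show "simple_path c" unfolding c_def
    proof (rule simple_path_join_loop[OF k h(1)])
      show "path_image k \<inter> path_image h \<subseteq> {pathstart k, pathstart h}"
        unfolding imk split k01 h(3) using h(2) KP by blast
    qed (simp_all add: k01 h)
    show "pathfinish c = pathstart c" by (simp add: c_def k01 h)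
  qed
  have imc: "path_image c = g1 ` {xa..xb} \<union> path_image h"
    unfolding c_def by (simp add: path_image_join k01 h imk)
  have cP: "g1 ` P \<subseteq> path_image c" "path_image c \<subseteq> g1 ` P \<union> K"
    unfolding imc split using h(2) ends by blast+
  have cd: "path_image c \<subseteq> unit_disc" using cP(2) Kd sub(1)[OF PX] by blast
  have Rxa: "R < exp xa" using R ab(1) by (meson exp_le_cancel_iff less_le_trans)
  have gP: "cmod (f (g1 x)) = exp x" if "x \<in> {xa<..<xb}" for x
    using g1(3)[of x] subsetD[OF PX, of x] that unfolding P_def by simp
  have "\<exists>\<sigma>\<in>{1,-1}. \<forall>x\<in>{xa<..<xb}. turns_into \<sigma> (path_image c) (g1 x)"
  proof (rule turns_into_constant[of c xa xb g1 K])
    show "continuous_on {xa<..<xb} g1" "g1 ` {xa<..<xb} \<subseteq> unit_disc"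
      using sub(3)[OF PX] sub(1)[OF PX] by (simp_all only: P_def)
    show "g1 ` {xa<..<xb} \<subseteq> path_image c" "path_image c \<subseteq> g1 ` {xa<..<xb} \<union> K" "K \<inter> g1 ` {xa<..<xb} = {}"
      using cP KP by (simp_all only: P_def)
    show "closed K" by (rule compact_imp_closed[OF cK])
  qed (fact c gP Rxa ab)+
  then obtain \<sigma> where \<sigma>: "\<sigma> \<in> {1,-1}" "\<forall>x\<in>{xa<..<xb}. turns_into \<sigma> (path_image c) (g1 x)"
    by (elim bexE)
  have "level_arc \<sigma> (g1 x) (g2 x)" if x: "x \<in> P" for x
  proof (rule level_arc_from_turn[OF c cd])
    have xX: "X \<le> x" using subsetD[OF PX x] by simp
    have x': "x \<in> {xa<..<xb}" using x by (simp add: P_def)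
    show "g1 x \<in> path_image c" using cP(1) x by blast
    show "g1 x \<noteq> g2 x" by (rule ne[OF xX])
    have "exp xa < exp x" using x' by simp
    then show "R < cmod (f (g1 x))" unfolding g1(3)[OF xX] using Rxa by (rule less_trans[rotated])
    show "turns_into \<sigma> (path_image c) (g1 x)" using \<sigma>(2) x' by blast
    show "\<sigma> \<in> {1,-1}" by (rule \<sigma>(1))
    show "z = g1 x \<or> z = g2 x" if z: "z \<in> path_image c" "cmod (f z) = cmod (f (g1 x))" for z
    proof -
      have lz: "cmod (f z) = exp x" using z(2) g1(3)[OF xX] by simp
      from z(1) cP(2) consider y where "y \<in> P" "z = g1 y" | "z \<in> K" by blast
      then show ?thesis
      proof cases
        case 1
        then have "exp y = exp x" using g1(3)[of y] subsetD[OF PX 1(1)] lz by simp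
        then show ?thesis using 1 by simp
      next
        case 2
        then show ?thesis using level_K[OF _ lz x] by blast
      qed
    qed
  qed
  then show ?thesis using \<sigma>(1) unfolding P_def by blast
qed

end

section \<open>The half-strip of level arcs\<close>

context regular_at_large_values begin

text \<open>Near \<open>x0\<close> there is a continuous branch \<open>h\<close> of times at which the level curve from \<open>g1\<close> is on \<open>g2\<close>, so
  the first hitting time is at most \<open>h\<close>. It cannot be much smaller: up to a little before \<open>\<eta> x0\<close> the
  level curve at \<open>x0\<close> keeps a positive distance from \<open>g2 x0\<close>, and by compactness so do its neighbours
  from the corresponding points of \<open>g2\<close>.\<close>

lemma first_hit_continuous:
  fixes \<eta> :: "real \<Rightarrow> real"
  assumes g1: "continuous_on {A<..} g1" "g1 ` {A<..} \<subseteq> unit_disc" "\<And>x. A < x \<Longrightarrow> cmod (f (g1 x)) = exp x"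
    and g2: "continuous_on {A<..} g2" "g2 ` {A<..} \<subseteq> unit_disc" "\<And>x. A < x \<Longrightarrow> cmod (f (g2 x)) = exp x"
    and R: "R < exp A" and \<sigma>: "\<sigma> \<in> {1,-1}"
    and arcs: "\<And>x. A < x \<Longrightarrow> \<eta> x > 0 \<and> \<kappa> x > 0 \<and> lifts (\<psi> x) (\<lambda>t. f (g1 x) * cis (\<sigma> * t)) {0..\<eta> x + \<kappa> x} \<and>
       \<psi> x 0 = g1 x \<and> \<psi> x (\<eta> x) = g2 x \<and> (\<forall>t. 0 \<le> t \<longrightarrow> t < \<eta> x \<longrightarrow> \<psi> x t \<noteq> g2 x)"
  shows "continuous_on {A<..} \<eta>"
  unfolding continuous_on_eq_continuous_at[OF open_greaterThan]
proof
  fix x0 assume "x0 \<in> {A<..}"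
  then have x0: "A < x0" by simp
  define w where "w = (\<lambda>(x, t). f (g1 x) * cis (\<sigma> * t))"
  have big: "R < cmod (w (x, t))" if "A < x" for x t
  proof -
    have "exp A < exp x" using that by simp
    with R have "R < exp x" by (rule less_trans)
    then show ?thesis using g1(3)[OF that] by (simp add: w_def norm_mult)
  qed
  have cfg: "continuous_on {A<..} (\<lambda>x. f (g1 x))" by (rule continuous_on_compose2[OF contf g1(1,2)])
  have cw: "continuous_on ({A<..} \<times> S) w" for S
  proof -
    have "continuous_on ({A<..} \<times> S) (\<lambda>p. f (g1 (fst p)))"
      by (rule continuous_on_compose2[OF cfg]) (auto intro!: continuous_intros)
    then show ?thesis unfolding w_def split_beta by (intro continuous_intros)
  qed
  note a0 = arcs[OF x0]
  define T where "T = \<eta> x0 + \<kappa> x0"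
  have T: "0 \<le> T" "\<eta> x0 < T" using a0 by (simp_all add: T_def)
  obtain U \<Phi> where U: "open U" "x0 \<in> U" and \<Phi>: "lifts \<Phi> w (({A<..} \<inter> U) \<times> {0..T})"
    "\<And>x. x \<in> {A<..} \<inter> U \<Longrightarrow> \<Phi> (x, 0) = g1 x" "\<And>t. t \<in> {0..T} \<Longrightarrow> \<Phi> (x0, t) = \<psi> x0 t"
  proof (rule lift_near[of "{A<..}" T w g1 x0 "\<psi> x0"])
    show "continuous_on ({A<..} \<times> {0..T}) w" by (rule cw)
    show "w ` ({A<..} \<times> {0..T}) \<subseteq> {w. R < cmod w}" using big by fastforce
    show "continuous_on {A<..} g1" "g1 ` {A<..} \<subseteq> unit_disc" by fact+
    show "f (g1 x) = w (x, 0)" if "x \<in> {A<..}" for x by (simp add: w_def)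
    show "x0 \<in> {A<..}" using x0 by simp
    show "lifts (\<psi> x0) (\<lambda>t. w (x0, t)) {0..T}" using a0 by (simp add: w_def T_def)
    show "\<psi> x0 0 = g1 x0" using a0 by blast
    show "0 \<le> T" by (rule T(1))
  qed (rule that)
  define N where "N = {A<..} \<inter> U"
  have oN: "open N" "x0 \<in> N" using U x0 by (simp_all add: N_def open_Int)
  have NA: "A < x" if "x \<in> N" for x using that by (simp add: N_def)
  have c\<Phi>: "continuous_on (N \<times> {0..T}) \<Phi>" using \<Phi>(1) unfolding lifts_def N_def by blast
  have f\<Phi>: "f (\<Phi> (x, t)) = w (x, t)" if "x \<in> N" "t \<in> {0..T}" for x t
    using \<Phi>(1) that unfolding lifts_def N_def by blast
  have agree: "\<Phi> (x, t) = \<psi> x t" if x: "x \<in> N" and t: "0 \<le> t" "t \<le> T" "t \<le> \<eta> x" for x t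
  proof (rule lift_unique[of "{0..t}" "\<lambda>s. \<Phi> (x, s)" "\<lambda>s. w (x, s)" "\<psi> x" 0 t])
    have ax: "lifts (\<psi> x) (\<lambda>s. w (x, s)) {0..\<eta> x + \<kappa> x}" "\<psi> x 0 = g1 x" "\<kappa> x > 0"
      using arcs[OF NA[OF x]] by (simp_all add: w_def)
    show "lifts (\<psi> x) (\<lambda>s. w (x, s)) {0..t}" by (rule lifts_subset[OF ax(1)]) (use t ax(3) in auto)
    have "lifts \<Phi> w ({x} \<times> {0..t})" by (rule lifts_subset[OF \<Phi>(1)]) (use x t in \<open>auto simp: N_def\<close>)
    then have l: "continuous_on ({x} \<times> {0..t}) \<Phi>" "\<Phi> ` ({x} \<times> {0..t}) \<subseteq> unit_disc"
      "\<forall>p\<in>{x} \<times> {0..t}. f (\<Phi> p) = w p" "w ` ({x} \<times> {0..t}) \<subseteq> {w. R < cmod w}" unfolding lifts_def by blast+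
    show "lifts (\<lambda>s. \<Phi> (x, s)) (\<lambda>s. w (x, s)) {0..t}" unfolding lifts_def
    proof (intro conjI ballI)
      show "continuous_on {0..t} (\<lambda>s. \<Phi> (x, s))"
        by (rule continuous_on_compose2[OF l(1)]) (auto intro!: continuous_intros)
      show "(\<lambda>s. \<Phi> (x, s)) ` {0..t} \<subseteq> unit_disc" "(\<lambda>s. w (x, s)) ` {0..t} \<subseteq> {w. R < cmod w}" using l(2,4) by blast+
      show "f (\<Phi> (x, s)) = w (x, s)" if "s \<in> {0..t}" for s using l(3) that by blast
    qed
    show "\<Phi> (x, 0) = \<psi> x 0" using \<Phi>(2)[of x] x ax(2) by (simp add: N_def)
  qed (use t in auto)
  have is1: "isCont (\<lambda>x. f (g1 x)) x0" using cfg x0 by (simp add: continuous_on_eq_continuous_at)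
  have isg2: "isCont g2 x0" using g2(1) x0 by (simp add: continuous_on_eq_continuous_at)
  have cfg2: "continuous_on {A<..} (\<lambda>x. f (g2 x))" by (rule continuous_on_compose2[OF contf g2(1,2)])
  have is2: "isCont (\<lambda>x. f (g2 x)) x0" using cfg2 x0 by (simp add: continuous_on_eq_continuous_at)
  have nz: "f (g1 x) \<noteq> 0" "f (g2 x) \<noteq> 0" if "A < x" for x
    using g1(3)[OF that] g2(3)[OF that] exp_gt_zero[of x] by (metis norm_zero less_irrefl)+
  have hit0: "f (g2 x0) = f (g1 x0) * cis (\<sigma> * \<eta> x0)"
  proof -
    have "\<forall>t\<in>{0..\<eta> x0 + \<kappa> x0}. f (\<psi> x0 t) = f (g1 x0) * cis (\<sigma> * t)" using a0 unfolding lifts_def by blast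
    from this[rule_format, of "\<eta> x0"]
    have "f (\<psi> x0 (\<eta> x0)) = f (g1 x0) * cis (\<sigma> * \<eta> x0)" using a0 by simp
    then show ?thesis using a0 by simp
  qed
  \<comment> \<open>The continuous branch of the hitting time that starts from \<open>\<eta> x0\<close>.\<close>
  define q where "q x = f (g2 x) / (f (g1 x) * cis (\<sigma> * \<eta> x0))" for x
  define h where "h x = \<eta> x0 + \<sigma> * Arg (q x)" for x
  have q0: "q x0 = 1" using nz[OF x0] by (simp add: q_def hit0)
  have isq: "isCont q x0" unfolding q_def by (intro continuous_intros is1 is2) (simp add: nz[OF x0])
  have ish: "isCont h x0"
  proof -
    have "isCont Arg (q x0)" by (rule continuous_at_Arg) (simp add: q0)
    then have "isCont (\<lambda>x. Arg (q x)) x0" by (rule isCont_o2[OF isq])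
    then show ?thesis unfolding h_def by (intro continuous_intros)
  qed
  have h0: "h x0 = \<eta> x0" by (simp add: h_def q0)
  have wh: "w (x, h x) = f (g2 x)" if "A < x" for x
  proof -
    have "cmod (q x) = 1" using g1(3)[OF that] g2(3)[OF that] by (simp add: q_def norm_divide norm_mult)
    then have cq: "cis (Arg (q x)) = q x" by (subst cis_Arg) (auto simp: sgn_eq)
    have "\<sigma> * h x = \<sigma> * \<eta> x0 + Arg (q x)" using \<sigma> by (auto simp: h_def algebra_simps)
    then have "cis (\<sigma> * h x) = cis (\<sigma> * \<eta> x0) * q x" by (simp add: cis_mult[symmetric] cq)
    then show ?thesis using nz[OF that] by (simp add: w_def q_def)
  qed
  have g2d: "g2 x0 \<in> unit_disc" using g2(2) x0 by blast
  have "f (g2 x0) \<in> {w. R < cmod w}" using wh[OF x0] big[OF x0, of "h x0"] by simp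
  then obtain V where V: "open V" "g2 x0 \<in> V" "inj_on f V" using local_inverse[OF g2d] by metis
  have evN: "\<forall>\<^sub>F x in nhds x0. x \<in> N" by (rule eventually_nhds_in_open[OF oN])
  have evh: "\<forall>\<^sub>F x in nhds x0. dist (h x) (\<eta> x0) < e" if "e > 0" for e
    using ish[unfolded isCont_def tendsto_at_iff_tendsto_nhds, unfolded h0] that by (rule tendstoD)
  have \<Phi>0: "\<Phi> (x0, \<eta> x0) = g2 x0" using \<Phi>(3)[of "\<eta> x0"] a0 T by simp
  \<comment> \<open>Along that branch the lift runs on \<open>g2\<close>.\<close>
  have hits: "\<forall>\<^sub>F x in nhds x0. \<Phi> (x, h x) = g2 x"
  proof -
    have "open (N \<times> {0<..<T})" using oN by (intro open_Times) auto
    moreover have "(x0, \<eta> x0) \<in> N \<times> {0<..<T}" using oN(2) a0 T by simp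
    moreover have "continuous_on (N \<times> {0<..<T}) \<Phi>" by (rule continuous_on_subset[OF c\<Phi>]) auto
    ultimately have "isCont \<Phi> (x0, \<eta> x0)" by (simp add: continuous_on_eq_continuous_at)
    moreover have "isCont (\<lambda>x. (x, h x)) x0" by (intro continuous_intros ish)
    ultimately have "isCont (\<lambda>x. \<Phi> (x, h x)) x0" using isCont_o2[of x0 "\<lambda>x. (x, h x)" \<Phi>] h0 by simp
    then have "((\<lambda>x. \<Phi> (x, h x)) \<longlongrightarrow> \<Phi> (x0, h x0)) (nhds x0)"
      using tendsto_at_iff_tendsto_nhds[of "\<lambda>x. \<Phi> (x, h x)" x0] by (simp add: isCont_def)
    then have evV: "\<forall>\<^sub>F x in nhds x0. \<Phi> (x, h x) \<in> V"
      by (rule topological_tendstoD[OF _ V(1)]) (simp add: h0 \<Phi>0 V(2))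
    have evg: "\<forall>\<^sub>F x in nhds x0. g2 x \<in> V"
      using isg2[unfolded isCont_def tendsto_at_iff_tendsto_nhds] V(1,2) by (rule topological_tendstoD)
    have "min (\<eta> x0) (\<kappa> x0) > 0" using a0 by simp
    from evh[OF this] evV evg evN show ?thesis
    proof eventually_elim
      case (elim x)
      have "h x \<in> {0..T}" using elim(1) by (auto simp: dist_real_def T_def)
      then have "f (\<Phi> (x, h x)) = f (g2 x)" using f\<Phi>[OF elim(4)] wh[OF NA[OF elim(4)]] by simp
      then show ?case using inj_onD[OF V(3)] elim(2,3) by blast
    qed
  qed
  show "isCont \<eta> x0"
    unfolding isCont_def tendsto_at_iff_tendsto_nhds
  proof (rule tendstoI)
    fix e :: real assume e: "e > 0"
    define d where "d = min (e / 2) (min (\<eta> x0 / 2) (\<kappa> x0))"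
    have d: "0 < d" "d < e" "d < \<eta> x0" "d \<le> \<kappa> x0" using e a0 by (auto simp: d_def)
    define I where "I = {0..\<eta> x0 - d}"
    have IT: "I \<subseteq> {0..T}" using T d by (auto simp: I_def)
    define G where "G p = \<Phi> (snd p, fst p) - g2 (snd p)" for p :: "real \<times> real"
    have "continuous_on (I \<times> N) (\<lambda>p. \<Phi> (snd p, fst p))"
      by (rule continuous_on_compose2[OF c\<Phi>]) (use IT in \<open>auto intro!: continuous_intros\<close>)
    moreover have "continuous_on (I \<times> N) (\<lambda>p. g2 (snd p))"
      by (rule continuous_on_compose2[OF g2(1)]) (use NA in \<open>auto intro!: continuous_intros\<close>)
    ultimately have cG: "continuous_on (I \<times> N) G" unfolding G_def by (rule continuous_on_diff)
    have ope: "openin (top_of_set (I \<times> N)) (I \<times> N \<inter> G -` (- {0}))"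
      by (rule continuous_openin_preimage_gen[OF cG]) (simp add: open_Compl)
    have "(\<lambda>t. (t, x0)) ` I \<subseteq> I \<times> N \<inter> G -` (- {0})"
    proof (rule image_subsetI)
      fix t assume t: "t \<in> I"
      have "t \<in> {0..T}" using t IT by blast
      then have "\<Phi> (x0, t) = \<psi> x0 t" by (rule \<Phi>(3))
      moreover have "0 \<le> t" "t < \<eta> x0" using t d(1) by (auto simp: I_def)
      then have "\<psi> x0 t \<noteq> g2 x0" using a0 by blast
      ultimately show "(t, x0) \<in> I \<times> N \<inter> G -` (- {0})" using t oN(2) by (simp add: G_def)
    qed
    then obtain W where W: "openin (top_of_set N) W" "x0 \<in> W" "I \<times> W \<subseteq> I \<times> N \<inter> G -` (- {0})"
    proof (rule tube_lemma[rotated 2])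
      show "compact I" "I \<noteq> {}" using d by (auto simp: I_def)
    qed (rule ope)
    have "open W" using W(1) oN(1) by (rule openin_open_trans)
    then have "\<forall>\<^sub>F x in nhds x0. x \<in> W" using W(2) by (rule eventually_nhds_in_open)
    then show "\<forall>\<^sub>F x in nhds x0. dist (\<eta> x) (\<eta> x0) < e"
      using evN evh[OF d(1)] hits
    proof eventually_elim
      case (elim x)
      note ax = arcs[OF NA[OF elim(2)]]
      have no: "\<Phi> (x, t) \<noteq> g2 x" if "t \<in> I" for t
      proof -
        have "(t, x) \<in> I \<times> N \<inter> G -` (- {0})" using W(3) that elim(1) by blast
        then show ?thesis by (simp add: G_def)
      qed
      have hd: "h x < \<eta> x0 + d" "0 \<le> h x" "h x \<le> T"
        using elim(3) d by (auto simp: dist_real_def abs_less_iff T_def)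
      have "\<not> \<eta> x \<le> \<eta> x0 - d"
      proof
        assume le: "\<eta> x \<le> \<eta> x0 - d"
        have "\<Phi> (x, \<eta> x) = \<psi> x (\<eta> x)" by (rule agree[OF elim(2)]) (use ax le T d in auto)
        moreover have "\<eta> x \<in> I" using ax le by (simp add: I_def)
        ultimately show False using no ax by metis
      qed
      moreover have "\<not> h x < \<eta> x"
      proof
        assume lt: "h x < \<eta> x"
        have "\<Phi> (x, h x) = \<psi> x (h x)" by (rule agree[OF elim(2)]) (use hd lt in auto)
        then show False using elim(4) ax hd(2) lt by metis
      qed
      ultimately show ?case using hd d by (simp add: dist_real_def abs_less_iff)
    qed
  qed
qed

text \<open>The level arcs, with time rescaled to the unit interval, sweep out a half-strip.\<close>

lemma level_strip:
  assumes g1: "continuous_on {A<..} g1" "g1 ` {A<..} \<subseteq> unit_disc" "\<And>x. A < x \<Longrightarrow> cmod (f (g1 x)) = exp x"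
    and g2: "continuous_on {A<..} g2" "g2 ` {A<..} \<subseteq> unit_disc" "\<And>x. A < x \<Longrightarrow> cmod (f (g2 x)) = exp x"
    and R: "R < exp A" and \<sigma>: "\<sigma> \<in> {1,-1}" and arcs: "\<And>x. A < x \<Longrightarrow> level_arc \<sigma> (g1 x) (g2 x)"
  shows "\<exists>\<Phi> :: real \<times> real \<Rightarrow> complex. lifts \<Phi> (\<lambda>p. f (\<Phi> p)) ({A<..} \<times> {0..1}) \<and>
    (\<forall>x>A. \<Phi> (x, 0) = g1 x \<and> \<Phi> (x, 1) = g2 x \<and> (\<forall>t\<in>{0..1}. cmod (f (\<Phi> (x, t))) = exp x))"
proof -
  have "\<forall>x. \<exists>\<eta> \<kappa> \<psi>. A < x \<longrightarrow> \<eta> > 0 \<and> \<kappa> > 0 \<and> lifts \<psi> (\<lambda>t. f (g1 x) * cis (\<sigma> * t)) {0..\<eta> + \<kappa>} \<and>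
       \<psi> 0 = g1 x \<and> \<psi> \<eta> = g2 x \<and> (\<forall>t. 0 \<le> t \<longrightarrow> t < \<eta> \<longrightarrow> \<psi> t \<noteq> g2 x)"
    using arcs unfolding level_arc_def by meson
  then obtain \<eta> \<kappa> \<psi> where arcs: "\<And>x. A < x \<Longrightarrow> \<eta> x > 0 \<and> \<kappa> x > 0 \<and> lifts (\<psi> x) (\<lambda>t. f (g1 x) * cis (\<sigma> * t)) {0..\<eta> x + \<kappa> x} \<and>
       \<psi> x 0 = g1 x \<and> \<psi> x (\<eta> x) = g2 x \<and> (\<forall>t. 0 \<le> t \<longrightarrow> t < \<eta> x \<longrightarrow> \<psi> x t \<noteq> g2 x)"
    by metis
  have c\<eta>: "continuous_on {A<..} \<eta>" by (rule first_hit_continuous[OF g1 g2 R \<sigma> arcs])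
  define w where "w = (\<lambda>(x, t). f (g1 x) * cis (\<sigma> * (t * \<eta> x)))"
  define \<Phi> where "\<Phi> = (\<lambda>(x, t). \<psi> x (t * \<eta> x))"
  have cfg: "continuous_on {A<..} (\<lambda>x. f (g1 x))" by (rule continuous_on_compose2[OF contf g1(1,2)])
  have cw: "continuous_on ({A<..} \<times> {0..1}) w"
  proof -
    have "continuous_on ({A<..} \<times> {0..1}) (\<lambda>p. f (g1 (fst p)))"
      by (rule continuous_on_compose2[OF cfg]) (auto intro!: continuous_intros)
    moreover have "continuous_on ({A<..} \<times> {0..1}) (\<lambda>p. \<eta> (fst p))"
      by (rule continuous_on_compose2[OF c\<eta>]) (auto intro!: continuous_intros)
    ultimately show ?thesis unfolding w_def split_beta by (intro continuous_intros)
  qed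
  have "lifts \<Phi> w ({A<..} \<times> {0..1})"
  proof (rule lifts_jointly_continuous[OF cw])
    show "lifts (\<lambda>t. \<Phi> (x, t)) (\<lambda>t. w (x, t)) {0..1}" if "x \<in> {A<..}" for x
    proof -
      have x: "A < x" using that by simp
      have ran: "t * \<eta> x \<in> {0..\<eta> x + \<kappa> x}" if "t \<in> {0..1}" for t
      proof -
        have pos: "\<eta> x > 0" "\<kappa> x > 0" using arcs[OF x] by blast+
        have "t * \<eta> x \<le> 1 * \<eta> x" by (rule mult_right_mono) (use that pos in auto)
        moreover have "0 \<le> t * \<eta> x" using that pos by simp
        ultimately show ?thesis using pos(2) unfolding atLeastAtMost_iff by linarith
      qed
      have l: "continuous_on {0..\<eta> x + \<kappa> x} (\<psi> x)" "\<psi> x ` {0..\<eta> x + \<kappa> x} \<subseteq> unit_disc"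
        "\<forall>t\<in>{0..\<eta> x + \<kappa> x}. f (\<psi> x t) = f (g1 x) * cis (\<sigma> * t)"
        "(\<lambda>t. f (g1 x) * cis (\<sigma> * t)) ` {0..\<eta> x + \<kappa> x} \<subseteq> {w. R < cmod w}"
        using arcs[OF x] unfolding lifts_def by blast+
      show ?thesis unfolding lifts_def
      proof (intro conjI ballI)
        have "continuous_on {0..1} (\<lambda>t. \<psi> x (t * \<eta> x))"
        proof (rule continuous_on_compose2[OF l(1)])
          show "continuous_on {0..1} (\<lambda>t. t * \<eta> x)" by (intro continuous_intros)
          show "(\<lambda>t. t * \<eta> x) ` {0..1} \<subseteq> {0..\<eta> x + \<kappa> x}" using ran by blast
        qed
        then show "continuous_on {0..1} (\<lambda>t. \<Phi> (x, t))" by (simp add: \<Phi>_def)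
        show "(\<lambda>t. \<Phi> (x, t)) ` {0..1} \<subseteq> unit_disc"
        proof (rule image_subsetI)
          fix t :: real assume "t \<in> {0..1}"
          from subsetD[OF l(2) imageI[OF ran[OF this]]] show "\<Phi> (x, t) \<in> unit_disc" by (simp add: \<Phi>_def)
        qed
        show "f (\<Phi> (x, t)) = w (x, t)" if "t \<in> {0..1}" for t
          using l(3)[rule_format, OF ran[OF that]] by (simp add: \<Phi>_def w_def)
        show "(\<lambda>t. w (x, t)) ` {0..1} \<subseteq> {w. R < cmod w}"
        proof (rule image_subsetI)
          fix t :: real assume "t \<in> {0..1}"
          from subsetD[OF l(4) imageI[OF ran[OF this]]] show "w (x, t) \<in> {w. R < cmod w}" by (simp add: w_def)
        qed
      qed
    qed
    have "continuous_on {A<..} (\<lambda>x. \<Phi> (x, 0)) \<longleftrightarrow> continuous_on {A<..} g1"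
      by (rule continuous_on_cong[OF refl]) (use arcs in \<open>simp add: \<Phi>_def\<close>)
    then show "continuous_on {A<..} (\<lambda>x. \<Phi> (x, 0))" using g1(1) by blast
  qed simp
  then have l: "continuous_on ({A<..} \<times> {0..1}) \<Phi>" "\<Phi> ` ({A<..} \<times> {0..1}) \<subseteq> unit_disc"
    "\<forall>p\<in>{A<..} \<times> {0..1}. f (\<Phi> p) = w p" "w ` ({A<..} \<times> {0..1}) \<subseteq> {w. R < cmod w}"
    unfolding lifts_def by blast+
  have self: "lifts \<Phi> (\<lambda>p. f (\<Phi> p)) ({A<..} \<times> {0..1})" unfolding lifts_def using l by (auto simp: image_subset_iff)
  have sides: "\<Phi> (x, 0) = g1 x \<and> \<Phi> (x, 1) = g2 x \<and> (\<forall>t\<in>{0..1}. cmod (f (\<Phi> (x, t))) = exp x)" if x: "A < x" for x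
  proof (intro conjI ballI)
    show "\<Phi> (x, 0) = g1 x" "\<Phi> (x, 1) = g2 x" using arcs[OF x] by (simp_all add: \<Phi>_def)
    fix t :: real assume "t \<in> {0..1}"
    then have "f (\<Phi> (x, t)) = w (x, t)" using l(3) x by simp
    then show "cmod (f (\<Phi> (x, t))) = exp x" using g1(3)[OF x] by (simp add: w_def norm_mult)
  qed
  show ?thesis by (rule exI[of _ \<Phi>], rule conjI[OF self], intro allI impI, rule sides)
qed

end

text \<open>What holds along the tail of \<open>\<Gamma>\<close> holds along its reparametrisation by modulus.\<close>

lemma (in holomorphic_tract) limit_along_reparametrised_curve:
  assumes a: "a = None" and \<Gamma>: "asymptotic_curve f None \<Gamma>" "path_end \<Gamma> = {\<zeta>}" "meets \<Gamma>"
    and late: "\<forall>\<tau><1. \<forall>\<^sub>F x in at_top. \<exists>t. \<tau> < t \<and> t < 1 \<and> g x = \<Gamma> t"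
  shows "(g \<longlongrightarrow> \<zeta>) at_top" "\<epsilon> > 0 \<Longrightarrow> \<forall>\<^sub>F x in at_top. g x \<in> D \<epsilon>"
proof -
  have bp: "boundary_path \<Gamma>" using \<Gamma>(1) by (simp add: asymptotic_curve_def)
  have transfer: "\<forall>\<^sub>F x in at_top. P (g x)" if P: "\<forall>\<^sub>F t in at_left 1. P (\<Gamma> t)" for P
  proof -
    have "\<exists>\<tau><1. \<forall>t>\<tau>. t < 1 \<longrightarrow> P (\<Gamma> t)" using P by (simp only: eventually_at_left_field)
    then obtain \<tau> where \<tau>: "\<tau> < 1" "\<forall>t>\<tau>. t < 1 \<longrightarrow> P (\<Gamma> t)" by (elim exE conjE)
    from late[rule_format, OF \<tau>(1)] show ?thesis
    proof (rule eventually_mono)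
      fix x assume "\<exists>t. \<tau> < t \<and> t < 1 \<and> g x = \<Gamma> t"
      then obtain t where t: "\<tau> < t" "t < 1" "g x = \<Gamma> t" by (elim exE conjE)
      show "P (g x)" unfolding t(3) by (rule \<tau>(2)[rule_format, OF t(1,2)])
    qed
  qed
  show "(g \<longlongrightarrow> \<zeta>) at_top"
  proof (rule topological_tendstoI)
    fix S assume "open S" "\<zeta> \<in> S"
    then show "\<forall>\<^sub>F x in at_top. g x \<in> S"
      by (intro transfer topological_tendstoD[OF boundary_path_tendsto_end(2)[OF bp \<Gamma>(2)]])
  qed
  assume \<epsilon>: "\<epsilon> > 0"
  have asy: "asymptotic_curve f a \<Gamma>" using \<Gamma> a by simp
  obtain \<tau> where \<tau>: "0 \<le> \<tau>" "\<tau> < 1" "\<Gamma> ` {\<tau>..<1} \<subseteq> D \<epsilon>"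
    by (rule tail_in_D[OF asy \<Gamma>(3) \<epsilon>])
  show "\<forall>\<^sub>F x in at_top. g x \<in> D \<epsilon>"
  proof (rule transfer)
    show "\<forall>\<^sub>F t in at_left 1. \<Gamma> t \<in> D \<epsilon>"
      by (rule eventually_mono[OF eventually_at_left_real[OF \<tau>(2)]]) (use \<tau>(3) in auto)
  qed
qed

lemma filterlim_half_line_parameter:
  fixes A :: real
  shows "filterlim (\<lambda>t. A + t / (1 - t)) at_top (at_left 1)"
proof -
  have "filterlim (\<lambda>t::real. 1 - t) (at_right 0) (at_left 1)"
    unfolding filterlim_at
  proof
    show "\<forall>\<^sub>F t in at_left (1::real). 1 - t \<in> {0<..} \<and> 1 - t \<noteq> 0"
      by (rule eventually_mono[OF eventually_at_left_real[of 0 1]]) auto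
    have "((\<lambda>t::real. 1 - t) \<longlongrightarrow> 1 - 1) (at_left 1)" by (intro tendsto_intros)
    then show "((\<lambda>t::real. 1 - t) \<longlongrightarrow> 0) (at_left 1)" by simp
  qed
  from filterlim_compose[OF filterlim_inverse_at_top_right this]
  have "filterlim (\<lambda>t::real. inverse (1 - t)) at_top (at_left 1)" .
  then have "filterlim (\<lambda>t::real. (A - 1) + inverse (1 - t)) at_top (at_left 1)"
    by (rule filterlim_tendsto_add_at_top[OF tendsto_const])
  moreover have "\<forall>\<^sub>F t in at_left (1::real). (A - 1) + inverse (1 - t) = A + t / (1 - t)"
    by (rule eventually_mono[OF eventually_at_left_real[of 0 1]]) (auto simp: field_simps)
  ultimately show ?thesis using filterlim_cong[OF refl refl] by fast
qed

text \<open>For every bound \<open>B\<close> the level arcs exist on all levels between \<open>A\<close> and \<open>B\<close> in a common direction; one of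
  the two directions occurs for arbitrarily large \<open>B\<close>. The half-strip swept out by the arcs is the convex
  model that cannot exist.\<close>

lemma (in holomorphic_tract) monotonic_accessibility_contradiction:
  assumes a: "a = None" and \<Gamma>: "asymptotic_curve f None \<Gamma>1" "asymptotic_curve f None \<Gamma>2"
    and ends: "path_end \<Gamma>1 = {\<zeta>1}" "path_end \<Gamma>2 = {\<zeta>2}" "\<zeta>1 \<noteq> \<zeta>2"
    and meets: "meets \<Gamma>1" "meets \<Gamma>2"
    and mono: "monotonic_curve (f ` \<Gamma>1 ` {0..<1})" "monotonic_curve (f ` \<Gamma>2 ` {0..<1})"
    and CV: "bounded (critical_values f)"
  shows False
proof -
  obtain R0 where R0: "\<And>v. v \<in> critical_values f \<Longrightarrow> cmod v \<le> R0" using CV unfolding bounded_iff by blast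
  define R where "R = max 1 R0"
  have R: "R > 0" "\<And>v. v \<in> critical_values f \<Longrightarrow> cmod v \<le> R"
    using R0 by (auto simp: R_def le_max_iff_disj)
  interpret RO: regular_over f "{w. R < cmod w}" by (rule regular_over_large_values[OF holf R(2)])
  interpret RL: regular_at_large_values f R by unfold_locales (rule R(1))
  have bp: "boundary_path \<Gamma>1" "boundary_path \<Gamma>2" using \<Gamma> by (simp_all add: asymptotic_curve_def)
  have top: "filterlim (\<lambda>t. cmod (f (\<Gamma> t))) at_top (at_left 1)" if "asymptotic_curve f None \<Gamma>" for \<Gamma>
  proof -
    have "filterlim (\<lambda>t. f (\<Gamma> t)) at_infinity (at_left 1)"
      using that unfolding asymptotic_curve_def tendsto_chordal_None_iff by blast
    then show ?thesis by (simp add: filterlim_at_infinity_conv_norm_at_top)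
  qed
  obtain X1 g1 where g1: "continuous_on {X1..} g1" "g1 ` {X1..} \<subseteq> unit_disc" "R < exp X1" "\<forall>x\<ge>X1. cmod (f (g1 x)) = exp x"
    "\<forall>\<tau><1. \<forall>\<^sub>F x in at_top. \<exists>t. \<tau> < t \<and> t < 1 \<and> g1 x = \<Gamma>1 t"
    using RL.monotonic_curve_reparametrised_by_modulus[OF bp(1) top[OF \<Gamma>(1)] mono(1)] by (elim exE conjE)
  obtain X2 g2 where g2: "continuous_on {X2..} g2" "g2 ` {X2..} \<subseteq> unit_disc" "R < exp X2" "\<forall>x\<ge>X2. cmod (f (g2 x)) = exp x"
    "\<forall>\<tau><1. \<forall>\<^sub>F x in at_top. \<exists>t. \<tau> < t \<and> t < 1 \<and> g2 x = \<Gamma>2 t"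
    using RL.monotonic_curve_reparametrised_by_modulus[OF bp(2) top[OF \<Gamma>(2)] mono(2)] by (elim exE conjE)
  note lim1 = limit_along_reparametrised_curve[OF a \<Gamma>(1) ends(1) meets(1) g1(5)]
  note lim2 = limit_along_reparametrised_curve[OF a \<Gamma>(2) ends(2) meets(2) g2(5)]
  have "\<forall>\<^sub>F x in at_top. g1 x \<noteq> g2 x"
  proof -
    obtain U V where UV: "open U" "open V" "\<zeta>1 \<in> U" "\<zeta>2 \<in> V" "U \<inter> V = {}" using hausdorff[OF ends(3)] by blast
    from topological_tendstoD[OF lim1(1) UV(1,3)] topological_tendstoD[OF lim2(1) UV(2,4)]
    show ?thesis by eventually_elim (use UV(5) in auto)
  qed
  then obtain X3 where X3: "\<forall>x\<ge>X3. g1 x \<noteq> g2 x" unfolding eventually_at_top_linorder by blast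
  define X where "X = max X1 (max X2 X3)"
  have h1: "continuous_on {X..} g1" "g1 ` {X..} \<subseteq> unit_disc" "\<And>x. X \<le> x \<Longrightarrow> cmod (f (g1 x)) = exp x"
  proof -
    have "{X..} \<subseteq> {X1..}" by (auto simp: X_def)
    then show "continuous_on {X..} g1" "g1 ` {X..} \<subseteq> unit_disc"
      using g1(1,2) by (meson continuous_on_subset image_mono order_trans)+
    show "cmod (f (g1 x)) = exp x" if "X \<le> x" for x using g1(4) that by (simp add: X_def)
  qed
  have h2: "continuous_on {X..} g2" "g2 ` {X..} \<subseteq> unit_disc" "\<And>x. X \<le> x \<Longrightarrow> cmod (f (g2 x)) = exp x"
  proof -
    have "{X..} \<subseteq> {X2..}" by (auto simp: X_def)
    then show "continuous_on {X..} g2" "g2 ` {X..} \<subseteq> unit_disc"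
      using g2(1,2) by (meson continuous_on_subset image_mono order_trans)+
    show "cmod (f (g2 x)) = exp x" if "X \<le> x" for x using g2(4) that by (simp add: X_def)
  qed
  have RX: "R < exp X"
  proof -
    have "exp X1 \<le> exp X" by (simp add: X_def)
    with g1(3) show ?thesis by (rule less_le_trans)
  qed
  have ne: "g1 x \<noteq> g2 x" if "X \<le> x" for x using X3 that by (simp add: X_def)
  have in1: "g1 x \<in> unit_disc" if "X \<le> x" for x using h1(2) that by blast
  have in2: "g2 x \<in> unit_disc" if "X \<le> x" for x using h2(2) that by blast
  define b where "b = linepath (g1 X) (g2 X)"
  have b: "path b" "pathstart b = g1 X" "pathfinish b = g2 X" by (simp_all add: b_def)
  have bd: "path_image b \<subseteq> unit_disc"
    unfolding b_def path_image_linepath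
    by (rule closed_segment_subset[OF in1[OF order_refl] in2[OF order_refl] convex_ball])
  have "compact (f ` path_image b)"
    by (intro compact_continuous_image continuous_on_subset[OF contf bd] compact_path_image b)
  then obtain M where M: "\<forall>w\<in>f ` path_image b. cmod w \<le> M" using compact_imp_bounded bounded_iff by blast
  define A where "A = max X M"
  have XA: "X \<le> A" by (simp add: A_def)
  have bA: "cmod (f z) \<le> exp A" if "z \<in> path_image b" for z
  proof -
    have "cmod (f z) \<le> M" using M that by blast
    also have "\<dots> \<le> A" by (simp add: A_def)
    also have "\<dots> \<le> exp A" using exp_ge_add_one_self[of A] by linarith
    finally show ?thesis .
  qed
  have finite_range: "\<exists>\<sigma>\<in>{1,-1}. \<forall>x\<in>{A<..<B}. RL.level_arc \<sigma> (g1 x) (g2 x)" if B: "A < B" for B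
  proof -
    obtain \<epsilon> where \<epsilon>: "\<epsilon> > 0" "\<forall>w. chordal_dist None (Some w) < \<epsilon> \<longrightarrow> exp B < cmod w"
      using chordal_small_None[of "exp B"] by (elim exE conjE)
    have DB: "exp B \<le> cmod (f z)" if "z \<in> D \<epsilon>" for z
    proof -
      have "chordal_dist None (Some (f z)) < \<epsilon>" using D_subset[OF \<epsilon>(1) that] a by blast
      from \<epsilon>(2)[rule_format, OF this] show ?thesis by simp
    qed
    obtain x1 where x1: "\<forall>x\<ge>x1. g1 x \<in> D \<epsilon>" using lim1(2)[OF \<epsilon>(1)] unfolding eventually_at_top_linorder by blast
    obtain x2 where x2: "\<forall>x\<ge>x2. g2 x \<in> D \<epsilon>" using lim2(2)[OF \<epsilon>(1)] unfolding eventually_at_top_linorder by blast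
    have m: "g1 (max X x1) \<in> D \<epsilon>" "g2 (max X x2) \<in> D \<epsilon>" using x1 x2 by simp_all
    obtain \<alpha> where \<alpha>: "path \<alpha>" "path_image \<alpha> \<subseteq> D \<epsilon>" "pathstart \<alpha> = g1 (max X x1)" "pathfinish \<alpha> = g2 (max X x2)"
      by (rule D_joins[OF \<epsilon>(1) m])
    show ?thesis
    proof (rule RL.level_arcs_between_marked_levels[of X g1 g2 b A B \<alpha> "max X x1" "max X x2"])
      show "path_image \<alpha> \<subseteq> unit_disc" using \<alpha>(2) D_subset[OF \<epsilon>(1)] by blast
      show "exp B \<le> cmod (f z)" if "z \<in> path_image \<alpha>" for z using DB \<alpha>(2) that by blast
    qed (fact h1 h2 RX ne b bd bA XA B \<alpha> | simp)+
  qed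
  have "\<exists>\<sigma>\<in>{1,-1}. \<forall>x>A. RL.level_arc \<sigma> (g1 x) (g2 x)"
  proof (cases "\<forall>n::nat. \<exists>m\<ge>n. \<forall>x\<in>{A<..<A + 1 + real m}. RL.level_arc 1 (g1 x) (g2 x)")
    case True
    have "RL.level_arc 1 (g1 x) (g2 x)" if "A < x" for x
    proof -
      obtain n :: nat where n: "x - A < real n" using reals_Archimedean2 by blast
      obtain m where m: "m \<ge> n" "\<forall>x\<in>{A<..<A + 1 + real m}. RL.level_arc 1 (g1 x) (g2 x)" using True by blast
      have "x \<in> {A<..<A + 1 + real m}" using that n m(1) by simp
      then show ?thesis using m(2) by blast
    qed
    then show ?thesis by simp
  next
    case False
    then obtain n :: nat where n: "\<forall>m\<ge>n. \<not> (\<forall>x\<in>{A<..<A + 1 + real m}. RL.level_arc 1 (g1 x) (g2 x))" by blast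
    have "RL.level_arc (-1) (g1 x) (g2 x)" if "A < x" for x
    proof -
      obtain k :: nat where k: "x - A < real k" using reals_Archimedean2 by blast
      define m where "m = max n k"
      have "\<exists>\<sigma>\<in>{1,-1}. \<forall>x\<in>{A<..<A + 1 + real m}. RL.level_arc \<sigma> (g1 x) (g2 x)" by (rule finite_range) simp
      moreover have "\<not> (\<forall>x\<in>{A<..<A + 1 + real m}. RL.level_arc 1 (g1 x) (g2 x))" using n by (simp add: m_def)
      ultimately have "\<forall>x\<in>{A<..<A + 1 + real m}. RL.level_arc (-1) (g1 x) (g2 x)" by blast
      moreover have "x \<in> {A<..<A + 1 + real m}" using that k by (simp add: m_def)
      ultimately show ?thesis by blast
    qed
    then show ?thesis by simp
  qed
  then obtain \<sigma> where \<sigma>: "\<sigma> \<in> {1,-1}" "\<forall>x>A. RL.level_arc \<sigma> (g1 x) (g2 x)" by (elim bexE)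
  have AX: "{A<..} \<subseteq> {X..}" using XA by auto
  have "\<exists>\<Phi> :: real \<times> real \<Rightarrow> complex. RO.lifts \<Phi> (\<lambda>p. f (\<Phi> p)) ({A<..} \<times> {0..1}) \<and>
    (\<forall>x>A. \<Phi> (x, 0) = g1 x \<and> \<Phi> (x, 1) = g2 x \<and> (\<forall>t\<in>{0..1}. cmod (f (\<Phi> (x, t))) = exp x))"
  proof (rule RL.level_strip)
    show "continuous_on {A<..} g1" by (rule continuous_on_subset[OF h1(1) AX])
    show "continuous_on {A<..} g2" by (rule continuous_on_subset[OF h2(1) AX])
    show "g1 ` {A<..} \<subseteq> unit_disc" "g2 ` {A<..} \<subseteq> unit_disc" using h1(2) h2(2) AX by blast+
    show "cmod (f (g1 x)) = exp x" "cmod (f (g2 x)) = exp x" if "A < x" for x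
      using h1(3)[of x] h2(3)[of x] that XA by simp_all
    have "exp X \<le> exp A" using XA by simp
    with RX show "R < exp A" by (rule less_le_trans)
    show "\<sigma> \<in> {1,-1}" by (rule \<sigma>(1))
    show "RL.level_arc \<sigma> (g1 x) (g2 x)" if "A < x" for x using \<sigma>(2) that by blast
  qed
  then obtain \<Phi> :: "real \<times> real \<Rightarrow> complex" where \<Phi>: "RO.lifts \<Phi> (\<lambda>p. f (\<Phi> p)) ({A<..} \<times> {0..1})"
    and side: "\<forall>x>A. \<Phi> (x, 0) = g1 x \<and> \<Phi> (x, 1) = g2 x \<and> (\<forall>t\<in>{0..1}. cmod (f (\<Phi> (x, t))) = exp x)"
    by (elim exE conjE)
  have cont: "continuous_on ({A<..} \<times> {0..1}) \<Phi>" and dsc: "\<Phi> ` ({A<..} \<times> {0..1}) \<subseteq> unit_disc"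
    using \<Phi> unfolding RO.lifts_def by blast+
  define Q where "Q = {q. A + 1 \<le> Re q} \<inter> ({q. 0 \<le> Im q} \<inter> {q. Im q \<le> 1})"
  define \<Psi> where "\<Psi> q = \<Phi> (Re q, Im q)" for q
  define x where "x t = A + 1 + t / (1 - t)" for t :: real
  have xge: "A + 1 \<le> x t" if "t \<in> {0..<1}" for t using that by (simp add: x_def)
  have cx: "continuous_on {0..<1} x" unfolding x_def by (intro continuous_intros) auto
  have xtop: "filterlim x at_top (at_left 1)" unfolding x_def by (rule filterlim_half_line_parameter)
  have near1: "\<forall>\<^sub>F t in at_left (1::real). t \<in> {0..<1}"
    by (rule eventually_mono[OF eventually_at_left_real[of 0 1]]) auto
  have along: "\<Psi> (Complex (x t) 0) = g1 (x t)" "\<Psi> (Complex (x t) 1) = g2 (x t)" if "t \<in> {0..<1}" for t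
    using side xge[OF that] by (simp_all add: \<Psi>_def)
  show False
  proof (rule no_uniformised_pair_of_curves[OF a, of Q \<Psi> "A + 1" "\<lambda>t. Complex (x t) 0" \<zeta>1 "\<lambda>t. Complex (x t) 1" \<zeta>2])
    show "convex Q" unfolding Q_def
      by (intro convex_Int convex_halfspace_Re_ge convex_halfspace_Im_ge convex_halfspace_Im_le)
    show "continuous_on Q \<Psi>" unfolding \<Psi>_def
      by (rule continuous_on_compose2[OF cont]) (auto intro!: continuous_intros simp: Q_def)
    have inst: "(Re q, Im q) \<in> {A<..} \<times> {0..1}" if "q \<in> Q" for q using that by (simp add: Q_def)
    show "\<Psi> ` Q \<subseteq> unit_disc" unfolding \<Psi>_def using dsc inst by blast
    show "cmod (f (\<Psi> q)) = exp (Re q)" if "q \<in> Q" for q using side inst[OF that] by (simp add: \<Psi>_def)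
    show "A + 1 \<le> Re q" if "q \<in> Q" for q using that by (simp add: Q_def)
    show "continuous_on {0..<1} (\<lambda>t. Complex (x t) 0)" "continuous_on {0..<1} (\<lambda>t. Complex (x t) 1)"
      unfolding Complex_eq by (intro continuous_intros cx)+
    show "(\<lambda>t. Complex (x t) 0) ` {0..<1} \<subseteq> Q" "(\<lambda>t. Complex (x t) 1) ` {0..<1} \<subseteq> Q"
      using xge by (simp_all add: Q_def image_subset_iff)
    show "filterlim (\<lambda>t. Re (Complex (x t) 0)) at_top (at_left 1)" "filterlim (\<lambda>t. Re (Complex (x t) 1)) at_top (at_left 1)"
      using xtop by simp_all
    show "((\<lambda>t. \<Psi> (Complex (x t) 0)) \<longlongrightarrow> \<zeta>1) (at_left 1)"
      by (rule Lim_transform_eventually[OF filterlim_compose[OF lim1(1) xtop]])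
         (rule eventually_mono[OF near1], simp only: along)
    show "((\<lambda>t. \<Psi> (Complex (x t) 1)) \<longlongrightarrow> \<zeta>2) (at_left 1)"
      by (rule Lim_transform_eventually[OF filterlim_compose[OF lim2(1) xtop]])
         (rule eventually_mono[OF near1], simp only: along)
    show "cmod \<zeta>1 = 1" "cmod \<zeta>2 = 1"
      by (rule boundary_path_tendsto_end(1)[OF bp(1) ends(1)] boundary_path_tendsto_end(1)[OF bp(2) ends(2)])+
    show "\<zeta>1 \<noteq> \<zeta>2" by (rule ends(3))
    fix \<epsilon> :: real assume "\<epsilon> > 0"
    from eventually_compose_filterlim[OF lim1(2)[OF this] xtop] near1
    show "\<forall>\<^sub>F t in at_left 1. \<Psi> (Complex (x t) 0) \<in> D \<epsilon>"
      by eventually_elim (simp only: along)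
  qed
qed

section \<open>Absence of arc tracts\<close>

text \<open>That the value of the tract is infinite, and case (a), follow from a pair of asymptotic curves supplied
  by the density in the MacLane class. Case (b) selects a second pair, among the curves with monotonic image.\<close>

theorem theorem1:
  fixes f :: "complex \<Rightarrow> complex"
  assumes "f \<in> MacLane_class"
    and "bounded (critical_values f)"
    and "bounded (finite_asymptotic_values f) \<or>
         (\<exists>S. dense_in_circle S \<and> (\<forall>\<zeta>\<in>S. infinity_monotonically_accessible f \<zeta>))"
  shows "\<not> (\<exists>D a. arc_tract f D a)"
proof
  assume "\<exists>D a. arc_tract f D a"
  then obtain D a where t: "tract f D a" and K: "circle_arc (tract_end D)" unfolding arc_tract_def by blast
  have f: "f holomorphic_on unit_disc" "\<not> f constant_on unit_disc"
    and "\<exists>S. dense_in_circle S \<and> (\<forall>\<zeta>\<in>S. \<exists>a. asymptotic_value_at f a \<zeta>)"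
    using assms(1) unfolding MacLane_class_def by blast+
  then obtain S where S: "dense_in_circle S" "\<forall>\<zeta>\<in>S. \<exists>a. asymptotic_value_at f a \<zeta>" by (elim exE conjE)
  interpret holomorphic_tract f D a
  proof
    show "tract_end D \<subseteq> unit_circle" using K unfolding circle_arc_def by auto
  qed (fact f t)+
  obtain \<Gamma>1 \<Gamma>2 \<zeta>1 \<zeta>2 where \<Gamma>: "\<exists>b. asymptotic_curve f b \<Gamma>1" "\<exists>b. asymptotic_curve f b \<Gamma>2"
    "boundary_path \<Gamma>1" "boundary_path \<Gamma>2"
    "path_end \<Gamma>1 = {\<zeta>1}" "path_end \<Gamma>2 = {\<zeta>2}" "\<zeta>1 \<noteq> \<zeta>2" "meets \<Gamma>1" "meets \<Gamma>2"
  proof (rule two_meeting_curves[OF S(1) _ K, of "\<lambda>\<Gamma>. \<exists>b. asymptotic_curve f b \<Gamma>"])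
    fix \<zeta> assume "\<zeta> \<in> S"
    then show "\<exists>\<Gamma>. boundary_path \<Gamma> \<and> path_end \<Gamma> = {\<zeta>} \<and> (\<exists>b. asymptotic_curve f b \<Gamma>)"
      using S(2) unfolding asymptotic_value_at_def asymptotic_curve_def by blast
  qed (rule that)
  have asy: "asymptotic_curve f a \<Gamma>1" "asymptotic_curve f a \<Gamma>2"
    using \<Gamma>(1,2,8,9) asymptotic_value_along_meeting_curve by blast+
  have a: "a = None" by (rule tract_value_not_finite[OF asy \<Gamma>(5-9) f(2)])
  from assms(3) show False
  proof
    assume "bounded (finite_asymptotic_values f)"
    then show False
      by (rule bounded_asymptotic_values_contradiction[OF a asy[unfolded a] \<Gamma>(5-9) assms(2)])
  next
    assume "\<exists>S. dense_in_circle S \<and> (\<forall>\<zeta>\<in>S. infinity_monotonically_accessible f \<zeta>)"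
    then obtain S' where S': "dense_in_circle S'" "\<forall>\<zeta>\<in>S'. infinity_monotonically_accessible f \<zeta>" by (elim exE conjE)
    show False
    proof (rule two_meeting_curves[OF S'(1) _ K, of "\<lambda>\<Gamma>. asymptotic_curve f None \<Gamma> \<and> monotonic_curve (f ` \<Gamma> ` {0..<1})"])
      fix \<zeta> assume "\<zeta> \<in> S'"
      then show "\<exists>\<Gamma>. boundary_path \<Gamma> \<and> path_end \<Gamma> = {\<zeta>} \<and> asymptotic_curve f None \<Gamma> \<and> monotonic_curve (f ` \<Gamma> ` {0..<1})"
        using S'(2) unfolding infinity_monotonically_accessible_def asymptotic_curve_def by blast
    next
      fix \<Gamma>1 \<Gamma>2 \<zeta>1 \<zeta>2
      assume "asymptotic_curve f None \<Gamma>1 \<and> monotonic_curve (f ` \<Gamma>1 ` {0..<1})"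
        "asymptotic_curve f None \<Gamma>2 \<and> monotonic_curve (f ` \<Gamma>2 ` {0..<1})"
        "path_end \<Gamma>1 = {\<zeta>1}" "path_end \<Gamma>2 = {\<zeta>2}" "\<zeta>1 \<noteq> \<zeta>2" "meets \<Gamma>1" "meets \<Gamma>2"
      then show False
        using monotonic_accessibility_contradiction[OF a, of \<Gamma>1 \<Gamma>2 \<zeta>1 \<zeta>2] assms(2) by blast
    qed
  qed
qed

end
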